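(* Let $(b,c)$ be a graph over the discrete measure space $(X,m)$ with associated $1$-harmonic boundary $\partial X$. For a closed quadratic form $Q$ on $\ell^2(X,m)$ the following assertions are equivalent. (i) $Q\in\mathfrak D(b,c)$. (ii) $D(Q)\subset D(Q^{(N)})$ and there exists $q\in \mathrm{Tr}\,\mathfrak D(b,c)$ such that for all $f\in D(Q)$ we have $\gamma f\in D(q)$ and $$Q(f)=Q^{(N)}(f)+q(\gamma f)-q^{DN}(\gamma f),$$ as well as $$Q_1(f)=Q^{(D)}_1(f_0)+q(\gamma f).$$ Here, $f=f_0+f_h$ with $f_0\in D(Q^{(D)})$ and $1$-harmonic $f_h\in D(Q^{(N)})$ is the Royden decomposition of $f$. More precisely, if $Q\in\mathfrak D(b,c)$, then in (ii) the form $q$ can be chosen as $q=\mathrm{Tr}\,Q$, and the map $$\mathfrak D(b,c)\to \mathrm{Tr}\,\mathfrak D(b,c),\qquad Q\mapsto \mathrm{Tr}\,Q,$$ is a bijection.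
   Context: Graphs. $X$ is a countable set with the discrete topology and $m:X\to(0,\infty)$ is a function, viewed as the measure $m(A)=\sum_{x\in A}m(x)$; $(X,m)$ is a discrete measure space. A graph $(b,c)$ over $(X,m)$ consists of a symmetric $b:X\times X\to[0,\infty)$ with $b(x,x)=0$ and $\sum_y b(x,y)<\infty$ for all $x$, and of $c:X\to[0,\infty)$. All functions are real-valued; $C(X)$ is the set of all functions on $X$, $C_c(X)$ those of finite support. Let $\mathcal F=\{f\in C(X)\mid \sum_y b(x,y)|f(y)|<\infty\ \forall x\}$ and, for $f\in\mathcal F$, $\mathcal Lf(x)=\frac1{m(x)}\sum_y b(x,y)(f(x)-f(y))+\frac{c(x)}{m(x)}f(x)$. A function $f\in\mathcal F$ is $1$-harmonic if $(\mathcal L+1)f=0$. For $f\in C(X)$ let $\mathcal Q(f)=\frac12\sum_{x,y}b(x,y)(f(x)-f(y))^2+\sum_x c(x)f(x)^2\in[0,\infty]$ and $\mathcal D=\{f\in C(X)\mid\mathcal Q(f)<\infty\}\subset\mathcal F$. Forms. A (symmetric positive, i.e. nonnegative) quadratic form $Q$ on a real Hilbert space has a subspace $D(Q)$ as domain, is induced by a symmetric bilinear form, and one sets $Q(f)=\infty$ for $f\notin D(Q)$; $Q(f)=Q(f,f)$ on $D(Q)$. $Q\le\widetilde Q$ means $Q(f)\le\widetilde Q(f)$ for all $f$ in the Hilbert space. $Q_1=Q+\|\cdot\|^2$; $Q$ is closed if $D(Q)$ is complete for the form norm $\|\cdot\|_Q=Q_1^{1/2}$. A form on an $L^2$-space is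 Markovian if $Q(Cf)\le Q(f)$ for all $f$ in the $L^2$-space and all normal contractions $C:\mathbb R\to\mathbb R$ (that is, $C(0)=0$ and $|C(s)-C(t)|\le|s-t|$). A Dirichlet form is a closed, densely defined Markovian form; a Dirichlet form in the wide sense is a closed Markovian form, not necessarily densely defined. $Q^{(N)}$ is the restriction of $\mathcal Q$ to $D(Q^{(N)})=\mathcal D\cap\ell^2(X,m)$, and $Q^{(D)}$ is the restriction of $\mathcal Q$ to $D(Q^{(D)})$, the $\|\cdot\|_{Q^{(N)}}$-closure of $C_c(X)$. Both are Dirichlet forms on $\ell^2(X,m)$. Boundary. $\hat X$ is the unique (up to homeomorphism) compact Hausdorff space such that $X\subset\hat X$ is dense with $\{x\}$ open for every $x\in X$, every $f\in D(Q^{(N)})\cap\ell^\infty(X)$ extends to a continuous function on $\hat X$ (again denoted $f$), and these extensions separate the points of $\hat X$. The $1$-harmonic boundary is $\partial X=\{x\in\hat X\setminus X\mid f(x)=0\ \forall f\in D(Q^{(D)})\cap\ell^\infty(X)\}$. Every $f\in D(Q^{(N)})$ extends uniquely to a continuous function $\hat X\to[-\infty,\infty]$ (again denoted $f$); the trace map is $\gamma f=f|_{\partial X}$. Royden decomposition: every $f\in D(Q^{(N)})$ is uniquely $f=f_0+f_h$ with $f_0\in D(Q^{(D)})$ and $f_h\in D(Q^{(N)})$ $1$-harmonic. For $\varphi\in\mathrm{ran}\,\gamma$, $H\varphi$ is the unique $1$-harmonic function in $D(Q^{(N)})$ with $\gamma(H\varphi)=\varphi$. Harmonic measures. For $x\in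 X$ there is a Radon measure $\mu_x$ on $\partial X$ with $\mu_x(\partial X)\le1$ and $H\varphi(x)=\int_{\partial X}\varphi\,d\mu_x$ for all $\varphi=\gamma f$ with $f\in D(Q^{(N)})\cap\ell^\infty(X)$; it is unique if $1\in D(Q^{(N)})$, while if $1\notin D(Q^{(N)})$ there is a point $\infty\in\partial X$ at which all these $\varphi$ vanish, and $\mu_x$ is the unique such measure with $\mu_x(\{\infty\})=0$. The $\mu_x$, $x \in X$, are mutually absolutely continuous with bounded densities. Fix one of them, $\mu$, and let $L^2(\partial X)=L^2(\partial X,\mu)$. One has $\mathrm{ran}\,\gamma\subset L^2(\partial X)$ (identifying functions with their classes). Trace forms. For a Dirichlet form $Q$ on $\ell^2(X,m)$ with $Q^{(N)}\le Q\le Q^{(D)}$, $\mathrm{Tr}\,Q$ is the form on $L^2(\partial X)$ with $D(\mathrm{Tr}\,Q)=\gamma D(Q)$ and $\mathrm{Tr}\,Q(\varphi)=Q_1(H\varphi)$. Set $q^{DN}=\mathrm{Tr}\,Q^{(N)}$. $\mathfrak D(b,c)$ is the set of all Dirichlet forms $Q$ on $\ell^2(X,m)$ with $Q^{(N)}\le Q\le Q^{(D)}$. $\mathrm{Tr}\,\mathfrak D(b,c)$ is the set of all Dirichlet forms in the wide sense $q$ on $L^2(\partial X)$ for which $q\ge q^{DN}$ and $q-q^{DN}$, considered as a quadratic form with domain $D(q)$, is Markovian.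
   Formalization: In (ii) it is also required that every f in D(Q^(N)) with γf in D(q) belongs to D(Q); without this, (ii)⇒(i) fails, e.g. for the closed form Q=0 with D(Q)={0} and q=q^DN. *)

theory Defs
  imports "HOL-Analysis.Analysis"
begin

section \<open>Quadratic forms on real $L^2$-spaces\<close>

text \<open>
  Elements of \<open>L\<^sup>2(M)\<close> are represented by square integrable functions; identification of functions
  that agree almost everywhere is a requirement on forms. A quadratic form is given by its quadratic
  functional with values in \<open>[0,\<infinity>]\<close>, the value being \<open>\<infinity>\<close> exactly off the domain. Functions that are
  not square integrable also get the value \<open>\<infinity>\<close>, so that a form in the mathematical sense
  corresponds to exactly one functional.
\<close>

type_synonym 'x qform = "('x \<Rightarrow> real) \<Rightarrow> ennreal"

definition L2 :: "'x measure \<Rightarrow> ('x \<Rightarrow> real) set" where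
  "L2 M = {f \<in> borel_measurable M. integrable M (\<lambda>x. (f x)\<^sup>2)}"

definition form_dom :: "'x qform \<Rightarrow> ('x \<Rightarrow> real) set" where
  "form_dom Q = {f. Q f < \<infinity>}"

definition quadratic_form :: "'x measure \<Rightarrow> 'x qform \<Rightarrow> bool" where
  "quadratic_form M Q \<longleftrightarrow>
     (\<forall>f. f \<notin> L2 M \<longrightarrow> Q f = \<infinity>) \<and>
     (\<forall>f\<in>L2 M. \<forall>g\<in>L2 M. (AE x in M. f x = g x) \<longrightarrow> Q f = Q g) \<and>
     (\<lambda>_. 0) \<in> form_dom Q \<and>
     (\<forall>f\<in>form_dom Q. \<forall>g\<in>form_dom Q. (\<lambda>x. f x + g x) \<in> form_dom Q) \<and>
     (\<forall>a. \<forall>f\<in>form_dom Q. (\<lambda>x. a * f x) \<in> form_dom Q) \<and>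
     (\<exists>B :: ('x \<Rightarrow> real) \<Rightarrow> ('x \<Rightarrow> real) \<Rightarrow> real.
        (\<forall>f\<in>form_dom Q. \<forall>g\<in>form_dom Q. B f g = B g f) \<and>
        (\<forall>f\<in>form_dom Q. \<forall>g\<in>form_dom Q. \<forall>h\<in>form_dom Q. B (\<lambda>x. f x + g x) h = B f h + B g h) \<and>
        (\<forall>a. \<forall>f\<in>form_dom Q. \<forall>h\<in>form_dom Q. B (\<lambda>x. a * f x) h = a * B f h) \<and>
        (\<forall>f\<in>form_dom Q. 0 \<le> B f f \<and> Q f = ennreal (B f f)))"

definition form_le :: "'x measure \<Rightarrow> 'x qform \<Rightarrow> 'x qform \<Rightarrow> bool" where
  "form_le M Q R \<longleftrightarrow> (\<forall>f\<in>L2 M. Q f \<le> R f)"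

definition normsq :: "'x measure \<Rightarrow> ('x \<Rightarrow> real) \<Rightarrow> ennreal" where
  "normsq M f = (\<integral>\<^sup>+x. ennreal ((f x)\<^sup>2) \<partial>M)"

definition form1 :: "'x measure \<Rightarrow> 'x qform \<Rightarrow> 'x qform" where
  "form1 M Q f = Q f + normsq M f"

definition closed_form :: "'x measure \<Rightarrow> 'x qform \<Rightarrow> bool" where
  "closed_form M Q \<longleftrightarrow>
     (\<forall>F :: nat \<Rightarrow> 'x \<Rightarrow> real.
        (\<forall>n. F n \<in> form_dom Q) \<and>
        (\<forall>e>0. \<exists>N. \<forall>i\<ge>N. \<forall>j\<ge>N. form1 M Q (\<lambda>x. F i x - F j x) < e) \<longrightarrow>
        (\<exists>f\<in>form_dom Q. (\<lambda>n. form1 M Q (\<lambda>x. F n x - f x)) \<longlonglongrightarrow> 0))"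

definition densely_defined :: "'x measure \<Rightarrow> 'x qform \<Rightarrow> bool" where
  "densely_defined M Q \<longleftrightarrow>
     (\<forall>f\<in>L2 M. \<forall>e>0. \<exists>g\<in>form_dom Q. normsq M (\<lambda>x. f x - g x) < e)"

definition normal_contraction :: "(real \<Rightarrow> real) \<Rightarrow> bool" where
  "normal_contraction C \<longleftrightarrow> C 0 = 0 \<and> (\<forall>s t. \<bar>C s - C t\<bar> \<le> \<bar>s - t\<bar>)"

definition markovian :: "'x measure \<Rightarrow> 'x qform \<Rightarrow> bool" where
  "markovian M Q \<longleftrightarrow>
     (\<forall>f\<in>L2 M. \<forall>C. normal_contraction C \<longrightarrow> Q (\<lambda>x. C (f x)) \<le> Q f)"

definition dirichlet_form_wide :: "'x measure \<Rightarrow> 'x qform \<Rightarrow> bool" where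
  "dirichlet_form_wide M Q \<longleftrightarrow> quadratic_form M Q \<and> closed_form M Q \<and> markovian M Q"

definition dirichlet_form :: "'x measure \<Rightarrow> 'x qform \<Rightarrow> bool" where
  "dirichlet_form M Q \<longleftrightarrow> dirichlet_form_wide M Q \<and> densely_defined M Q"

text \<open>
  The difference \<open>q - r\<close> with domain \<open>D(q)\<close>. Subtraction on \<^typ>\<open>ennreal\<close> truncates at \<open>0\<close>; the
  definition is used only for \<open>r \<le> q\<close>, where the values on \<open>D(q)\<close> are finite and the subtraction is
  the ordinary one.
\<close>

definition form_diff :: "'x qform \<Rightarrow> 'x qform \<Rightarrow> 'x qform" where
  "form_diff q r = (\<lambda>f. if f \<in> form_dom q then q f - r f else \<infinity>)"

section \<open>Graphs\<close>

text \<open>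
  The vertex set \<open>X\<close> is the universe of a countable type (finite or infinite).
\<close>

definition graph ::
  "('a::countable \<Rightarrow> real) \<Rightarrow> ('a \<Rightarrow> 'a \<Rightarrow> real) \<Rightarrow> ('a \<Rightarrow> real) \<Rightarrow> bool" where
  "graph m b c \<longleftrightarrow>
     (\<forall>x. 0 < m x) \<and>
     (\<forall>x y. 0 \<le> b x y \<and> b x y = b y x) \<and> (\<forall>x. b x x = 0) \<and>
     (\<forall>x. (\<lambda>y. b x y) summable_on UNIV) \<and>
     (\<forall>x. 0 \<le> c x)"

definition vmeas :: "('a::countable \<Rightarrow> real) \<Rightarrow> 'a measure" where
  "vmeas m = density (count_space UNIV) (\<lambda>x. ennreal (m x))"

definition laplace_dom :: "('a::countable \<Rightarrow> 'a \<Rightarrow> real) \<Rightarrow> ('a \<Rightarrow> real) set" where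
  "laplace_dom b = {f. \<forall>x. (\<lambda>y. b x y * \<bar>f y\<bar>) summable_on UNIV}"

definition laplace ::
  "('a::countable \<Rightarrow> real) \<Rightarrow> ('a \<Rightarrow> 'a \<Rightarrow> real) \<Rightarrow> ('a \<Rightarrow> real) \<Rightarrow> ('a \<Rightarrow> real) \<Rightarrow> 'a \<Rightarrow> real" where
  "laplace m b c f x =
     1 / m x * (\<Sum>\<^sub>\<infinity>y. b x y * (f x - f y)) + c x / m x * f x"

definition harmonic1 ::
  "('a::countable \<Rightarrow> real) \<Rightarrow> ('a \<Rightarrow> 'a \<Rightarrow> real) \<Rightarrow> ('a \<Rightarrow> real) \<Rightarrow> ('a \<Rightarrow> real) \<Rightarrow> bool" where
  "harmonic1 m b c f \<longleftrightarrow> f \<in> laplace_dom b \<and> (\<forall>x. laplace m b c f x + f x = 0)"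

definition energy :: "('a::countable \<Rightarrow> 'a \<Rightarrow> real) \<Rightarrow> ('a \<Rightarrow> real) \<Rightarrow> 'a qform" where
  "energy b c f =
     (\<integral>\<^sup>+x. \<integral>\<^sup>+y. ennreal (b x y * (f x - f y)\<^sup>2) \<partial>count_space UNIV \<partial>count_space UNIV) / 2
     + (\<integral>\<^sup>+x. ennreal (c x * (f x)\<^sup>2) \<partial>count_space UNIV)"

definition QN ::
  "('a::countable \<Rightarrow> real) \<Rightarrow> ('a \<Rightarrow> 'a \<Rightarrow> real) \<Rightarrow> ('a \<Rightarrow> real) \<Rightarrow> 'a qform" where
  "QN m b c f = (if f \<in> L2 (vmeas m) then energy b c f else \<infinity>)"

definition finsupp :: "('a \<Rightarrow> real) set" where
  "finsupp = {f. finite {x. f x \<noteq> 0}}"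

definition domD ::
  "('a::countable \<Rightarrow> real) \<Rightarrow> ('a \<Rightarrow> 'a \<Rightarrow> real) \<Rightarrow> ('a \<Rightarrow> real) \<Rightarrow> ('a \<Rightarrow> real) set" where
  "domD m b c =
     {f \<in> form_dom (QN m b c). \<forall>e>0. \<exists>g\<in>finsupp. form1 (vmeas m) (QN m b c) (\<lambda>x. f x - g x) < e}"

definition QD ::
  "('a::countable \<Rightarrow> real) \<Rightarrow> ('a \<Rightarrow> 'a \<Rightarrow> real) \<Rightarrow> ('a \<Rightarrow> real) \<Rightarrow> 'a qform" where
  "QD m b c f = (if f \<in> domD m b c then energy b c f else \<infinity>)"

definition bddfun :: "('a \<Rightarrow> real) set" where
  "bddfun = {f. bounded (range f)}"

definition royden0 ::
  "('a::countable \<Rightarrow> real) \<Rightarrow> ('a \<Rightarrow> 'a \<Rightarrow> real) \<Rightarrow> ('a \<Rightarrow> real) \<Rightarrow> ('a \<Rightarrow> real) \<Rightarrow> 'a \<Rightarrow> real" where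
  "royden0 m b c f =
     (THE f0. f0 \<in> form_dom (QD m b c) \<and> (\<lambda>x. f x - f0 x) \<in> form_dom (QN m b c) \<and>
              harmonic1 m b c (\<lambda>x. f x - f0 x))"

section \<open>The harmonic boundary\<close>

text \<open>
  The compactification is an arbitrary topology \<open>K\<close> together with an embedding \<open>i\<close> of the vertices
  having the defining properties; these determine it up to homeomorphism.
\<close>

definition compactification ::
  "('a::countable \<Rightarrow> real) \<Rightarrow> ('a \<Rightarrow> 'a \<Rightarrow> real) \<Rightarrow> ('a \<Rightarrow> real) \<Rightarrow> 'b topology \<Rightarrow> ('a \<Rightarrow> 'b) \<Rightarrow> bool"
  where
  "compactification m b c K i \<longleftrightarrow>
     compact_space K \<and> Hausdorff_space K \<and>
     inj i \<and> range i \<subseteq> topspace K \<and> K closure_of (range i) = topspace K \<and>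
     (\<forall>x. openin K {i x}) \<and>
     (\<forall>f \<in> form_dom (QN m b c) \<inter> bddfun.
        \<exists>F. continuous_map K euclideanreal F \<and> (\<forall>x. F (i x) = f x)) \<and>
     (\<forall>p\<in>topspace K. \<forall>q\<in>topspace K. p \<noteq> q \<longrightarrow>
        (\<exists>f \<in> form_dom (QN m b c) \<inter> bddfun. \<exists>F. continuous_map K euclideanreal F \<and>
           (\<forall>x. F (i x) = f x) \<and> F p \<noteq> F q))"

text \<open>
  A continuous extension with values in \<open>[-\<infinity>,\<infinity>]\<close> is unique on the space because the vertices are
  dense.
\<close>

definition cont_ext :: "'b topology \<Rightarrow> ('a \<Rightarrow> 'b) \<Rightarrow> ('a \<Rightarrow> real) \<Rightarrow> 'b \<Rightarrow> ereal" where
  "cont_ext K i f = (SOME F. continuous_map K euclidean F \<and> (\<forall>x. F (i x) = ereal (f x)))"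

definition bdry ::
  "('a::countable \<Rightarrow> real) \<Rightarrow> ('a \<Rightarrow> 'a \<Rightarrow> real) \<Rightarrow> ('a \<Rightarrow> real) \<Rightarrow> 'b topology \<Rightarrow> ('a \<Rightarrow> 'b) \<Rightarrow> 'b set"
  where
  "bdry m b c K i =
     {p \<in> topspace K - range i. \<forall>f \<in> form_dom (QD m b c) \<inter> bddfun. cont_ext K i f p = 0}"

definition gamma ::
  "('a::countable \<Rightarrow> real) \<Rightarrow> ('a \<Rightarrow> 'a \<Rightarrow> real) \<Rightarrow> ('a \<Rightarrow> real) \<Rightarrow> 'b topology \<Rightarrow> ('a \<Rightarrow> 'b) \<Rightarrow>
   ('a \<Rightarrow> real) \<Rightarrow> 'b \<Rightarrow> ereal" where
  "gamma m b c K i f = restrict (cont_ext K i f) (bdry m b c K i)"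

definition harmonic_ext ::
  "('a::countable \<Rightarrow> real) \<Rightarrow> ('a \<Rightarrow> 'a \<Rightarrow> real) \<Rightarrow> ('a \<Rightarrow> real) \<Rightarrow> 'b topology \<Rightarrow> ('a \<Rightarrow> 'b) \<Rightarrow>
   ('b \<Rightarrow> ereal) \<Rightarrow> 'a \<Rightarrow> real" where
  "harmonic_ext m b c K i \<phi> =
     (THE h. h \<in> form_dom (QN m b c) \<and> harmonic1 m b c h \<and> gamma m b c K i h = \<phi>)"

definition radon_on :: "'b topology \<Rightarrow> 'b measure \<Rightarrow> bool" where
  "radon_on T \<mu> \<longleftrightarrow>
     space \<mu> = topspace T \<and> sets \<mu> = sigma_sets (topspace T) {U. openin T U} \<and>
     (\<forall>C. compactin T C \<longrightarrow> emeasure \<mu> C < \<infinity>) \<and>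
     (\<forall>A\<in>sets \<mu>. emeasure \<mu> A = (SUP C\<in>{C. compactin T C \<and> C \<subseteq> A}. emeasure \<mu> C))"

text \<open>
  If the constant function \<open>1\<close> is not in the domain of \<^const>\<open>QN\<close>, a point at which all bounded
  functions in the domain vanish is unique, since these functions separate points. For a bounded
  function the trace is finite, so passing from \<^typ>\<open>ereal\<close> to \<^typ>\<open>real\<close> changes nothing.
\<close>

definition harmonic_measure ::
  "('a::countable \<Rightarrow> real) \<Rightarrow> ('a \<Rightarrow> 'a \<Rightarrow> real) \<Rightarrow> ('a \<Rightarrow> real) \<Rightarrow> 'b topology \<Rightarrow> ('a \<Rightarrow> 'b) \<Rightarrow>
   'a \<Rightarrow> 'b measure \<Rightarrow> bool" where
  "harmonic_measure m b c K i x \<mu> \<longleftrightarrow>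
     radon_on (subtopology K (bdry m b c K i)) \<mu> \<and>
     emeasure \<mu> (bdry m b c K i) \<le> 1 \<and>
     (\<forall>f \<in> form_dom (QN m b c) \<inter> bddfun.
        harmonic_ext m b c K i (gamma m b c K i f) x
          = (\<integral>p. real_of_ereal (gamma m b c K i f p) \<partial>\<mu>)) \<and>
     ((\<lambda>_. 1) \<notin> form_dom (QN m b c) \<longrightarrow>
        (\<forall>p \<in> bdry m b c K i.
           (\<forall>f \<in> form_dom (QN m b c) \<inter> bddfun. gamma m b c K i f p = 0) \<longrightarrow> emeasure \<mu> {p} = 0))"

text \<open>
  Mutual absolute continuity of the harmonic measures with bounded densities is required in both
  directions. It is automatic for connected graphs and can fail for disconnected ones, where
  functions on the boundary of one component are not seen by the harmonic measures of another.
\<close>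

definition bounded_density :: "'b measure \<Rightarrow> 'b measure \<Rightarrow> bool" where
  "bounded_density \<mu> \<nu> \<longleftrightarrow>
     (\<exists>\<rho> \<in> borel_measurable \<mu>. (\<exists>C::real. \<forall>p. \<rho> p \<le> ennreal C) \<and> \<nu> = density \<mu> \<rho>)"

section \<open>Trace forms\<close>

text \<open>
  The element of \<open>L\<^sup>2(\<partial>X)\<close> determined by \<open>\<gamma>f\<close>: traces of functions in the domain of
  \<^const>\<open>QN\<close> are finite almost everywhere with respect to harmonic measure, and the real-valued
  representative differs from \<open>\<gamma>f\<close> only where \<open>\<gamma>f\<close> is infinite.
\<close>

definition gammaL2 ::
  "('a::countable \<Rightarrow> real) \<Rightarrow> ('a \<Rightarrow> 'a \<Rightarrow> real) \<Rightarrow> ('a \<Rightarrow> real) \<Rightarrow> 'b topology \<Rightarrow> ('a \<Rightarrow> 'b) \<Rightarrow>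
   ('a \<Rightarrow> real) \<Rightarrow> 'b \<Rightarrow> real" where
  "gammaL2 m b c K i f = (\<lambda>p. real_of_ereal (gamma m b c K i f p))"

text \<open>
  A square integrable function is in the domain of the trace form if its class is the class of
  \<open>\<gamma>f\<close> for some \<open>f \<in> D(Q)\<close>; the value \<open>Q\<^sub>1(H \<gamma>f)\<close> does not depend on the chosen \<open>f\<close>.
\<close>

definition trace_form ::
  "('a::countable \<Rightarrow> real) \<Rightarrow> ('a \<Rightarrow> 'a \<Rightarrow> real) \<Rightarrow> ('a \<Rightarrow> real) \<Rightarrow> 'b topology \<Rightarrow> ('a \<Rightarrow> 'b) \<Rightarrow>
   'b measure \<Rightarrow> 'a qform \<Rightarrow> 'b qform" where
  "trace_form m b c K i \<mu> Q \<phi> =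
     (let P = (\<lambda>f. f \<in> form_dom Q \<and> (AE p in \<mu>. \<phi> p = gammaL2 m b c K i f p)) in
      if \<phi> \<in> L2 \<mu> \<and> (\<exists>f. P f)
      then form1 (vmeas m) Q (harmonic_ext m b c K i (gamma m b c K i (SOME f. P f)))
      else \<infinity>)"

definition qDN ::
  "('a::countable \<Rightarrow> real) \<Rightarrow> ('a \<Rightarrow> 'a \<Rightarrow> real) \<Rightarrow> ('a \<Rightarrow> real) \<Rightarrow> 'b topology \<Rightarrow> ('a \<Rightarrow> 'b) \<Rightarrow>
   'b measure \<Rightarrow> 'b qform" where
  "qDN m b c K i \<mu> = trace_form m b c K i \<mu> (QN m b c)"

definition DF ::
  "('a::countable \<Rightarrow> real) \<Rightarrow> ('a \<Rightarrow> 'a \<Rightarrow> real) \<Rightarrow> ('a \<Rightarrow> real) \<Rightarrow> 'a qform set" where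
  "DF m b c =
     {Q. dirichlet_form (vmeas m) Q \<and>
         form_le (vmeas m) (QN m b c) Q \<and> form_le (vmeas m) Q (QD m b c)}"

definition TrDF ::
  "('a::countable \<Rightarrow> real) \<Rightarrow> ('a \<Rightarrow> 'a \<Rightarrow> real) \<Rightarrow> ('a \<Rightarrow> real) \<Rightarrow> 'b topology \<Rightarrow> ('a \<Rightarrow> 'b) \<Rightarrow>
   'b measure \<Rightarrow> 'b qform set" where
  "TrDF m b c K i \<mu> =
     {q. dirichlet_form_wide \<mu> q \<and> form_le \<mu> (qDN m b c K i \<mu>) q \<and>
         markovian \<mu> (form_diff q (qDN m b c K i \<mu>))}"

text \<open>
  The representation of \<open>Q\<close> by a boundary form \<open>q\<close>. The last clause says that \<open>D(Q)\<close> is all of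
  \<open>{f \<in> D(Q\<^sup>(\<^sup>N\<^sup>)). \<gamma>f \<in> D(q)}\<close>, that is, that the formulas hold with the convention that forms are
  \<open>\<infinity>\<close> off their domains. Without it every closed restriction of a represented form, such as the
  form with domain \<open>{0}\<close>, would count as represented. For \<open>q\<close> in \<^const>\<open>TrDF\<close> all terms
  in the first formula are finite for \<open>f \<in> D(Q)\<close> and \<open>q \<ge> q\<^sup>D\<^sup>N\<close>, so no truncation
  occurs in the subtraction.
\<close>

definition represented_by ::
  "('a::countable \<Rightarrow> real) \<Rightarrow> ('a \<Rightarrow> 'a \<Rightarrow> real) \<Rightarrow> ('a \<Rightarrow> real) \<Rightarrow> 'b topology \<Rightarrow> ('a \<Rightarrow> 'b) \<Rightarrow>
   'b measure \<Rightarrow> 'a qform \<Rightarrow> 'b qform \<Rightarrow> bool" where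
  "represented_by m b c K i \<mu> Q q \<longleftrightarrow>
     (\<forall>f \<in> form_dom Q.
        gammaL2 m b c K i f \<in> form_dom q \<and>
        Q f = QN m b c f + q (gammaL2 m b c K i f) - qDN m b c K i \<mu> (gammaL2 m b c K i f) \<and>
        form1 (vmeas m) Q f
          = form1 (vmeas m) (QD m b c) (royden0 m b c f) + q (gammaL2 m b c K i f)) \<and>
     (\<forall>f \<in> form_dom (QN m b c). gammaL2 m b c K i f \<in> form_dom q \<longrightarrow> f \<in> form_dom Q)"

end

theory Submission
  imports Defs
begin

text \<open>
  Throughout, \<open>D\<^sup>N\<close> and \<open>D\<^sup>D\<close> denote the domains of \<open>Q\<^sup>N\<close> and \<open>Q\<^sup>D\<close>, and a lower index \<open>1\<close> means that
  the square of the \<open>L\<^sup>2\<close>-norm has been added. In the formal text the domains are \<open>N\<close> and \<open>D0\<close>, and \<open>E\<close>, \<open>B\<close>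
  are the bilinear forms of \<open>Q\<^sup>N\<^sub>1\<close> and \<open>Q\<^sub>1\<close>; \<open>\<gamma>2\<close> is the real-valued representative of \<open>\<gamma>\<close>.

  The trace sees exactly the harmonic part of a function. If \<open>\<gamma>f\<close> vanishes on the boundary, then
  \<open>{\<bar>f\<bar> \<ge> \<epsilon>}\<close> is a compact set missing the boundary, and some function of \<open>D\<^sup>D\<close> has absolute value at
  least \<open>1\<close> at all of its vertices; a function of \<open>D\<^sup>N\<close> dominated by a function of \<open>D\<^sup>D\<close> is in \<open>D\<^sup>D\<close>, and so
  \<open>f \<in> D\<^sup>D\<close> (\<open>vanishing_boundary_values\<close>). The harmonic measures sharpen this to vanishing almost
  everywhere (\<open>D0_if_gammaL2_zero\<close>), because bounded harmonic functions are integrals of their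
  traces. Moreover \<open>\<parallel>\<gamma>f\<parallel>\<^sup>2 \<le> (3/m(z)) Q\<^sup>N\<^sub>1(f)\<close> (\<open>trace_bound\<close>): for bounded harmonic \<open>f\<close> the left side
  is the value at \<open>z\<close> of the harmonic part of \<open>f\<^sup>2\<close>, which is estimated by testing \<open>f\<^sup>2\<close> against the
  equilibrium function of \<open>z\<close>.

  Now let \<open>Q\<^sup>N \<le> Q \<le> Q\<^sup>D\<close>. The form \<open>Q - Q\<^sup>N\<close> is nonnegative on \<open>D(Q)\<close> and vanishes on \<open>D\<^sup>D\<close>; by the
  Cauchy-Schwarz inequality it depends on \<open>f\<close> only through its harmonic part, that is, through
  \<open>\<gamma>f\<close>. Since the two parts of the Royden decomposition are orthogonal for \<open>Q\<^sup>N\<^sub>1\<close>, both formulas for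
  \<open>Q\<close> follow with \<open>q = Tr Q\<close>, and \<open>Tr Q - q\<^sup>D\<^sup>N\<close> is \<open>Q - Q\<^sup>N\<close> read on the boundary.

  The heart of the matter is that \<open>Q - Q\<^sup>N\<close> is Markovian (\<open>excess_markovian\<close>). For a finite set \<open>F\<close> of
  vertices, minimise \<open>Q\<^sub>1\<close> over all functions with prescribed values on \<open>F\<close>. The minimum is a Dirichlet
  form on the finite set \<open>F\<close>, hence a sum of jump terms and killing terms. Because \<open>Q\<close> and \<open>Q\<^sup>N\<close> have
  the same mixed terms with finitely supported functions, Green's formula computes its coefficients,
  and as the minimisers of indicator functions have values in \<open>[0,1]\<close>, the jump weights are at least
  \<open>b(x,y)\<close> and the killing weights at least \<open>c(x) + m(x)\<close>. So the finite form minus the part of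
  \<open>Q\<^sup>N\<^sub>1\<close> that lives on \<open>F\<close> still has nonnegative weights and is decreased by every normal contraction.
  Letting \<open>F\<close> exhaust the graph gives the claim for \<open>Q\<^sub>1 - Q\<^sup>N\<^sub>1 = Q - Q\<^sup>N\<close>.

  Conversely, \<open>q\<close> is the trace of the form \<open>Q\<^sup>N(f) + (q - q\<^sup>D\<^sup>N)(\<gamma>f)\<close> (\<open>lifted\<close>). It is closed since
  \<open>Q\<^sup>N\<close> and \<open>q\<close> are and the trace is continuous, Markovian as a sum of Markovian forms, and it is the
  only form represented by \<open>q\<close>.

  All limits of functions on the graph are taken with one compactness principle: in a complete form
  domain, a pointwise limit of functions with bounded form norm is in the domain
  (\<open>pointwise_limit\<close>).
\<close>

section \<open>Function spaces with a semi-inner product\<close>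

text \<open>
  Functions are added and subtracted pointwise. The value of a bilinear form on the diagonal is
  written \<open>quad\<close>, which keeps terms short when the argument is a difference.
\<close>
abbreviation fun_minus (infixl "\<ominus>" 65) where "f \<ominus> g \<equiv> (\<lambda>x. f x - g x)"
abbreviation fun_plus (infixl "\<oplus>" 65) where "f \<oplus> g \<equiv> (\<lambda>x. f x + g x)"
abbreviation quad where "quad B f \<equiv> B f f"

lemma nonneg_quadratic_discriminant:
  fixes \<alpha> \<beta> \<delta> :: real
  assumes "\<And>t. 0 \<le> \<alpha> - 2 * t * \<beta> + t\<^sup>2 * \<delta>" and "0 \<le> \<delta>"
  shows "\<beta>\<^sup>2 \<le> \<alpha> * \<delta>"
proof (cases "\<delta> = 0")
  case True
  \<comment> \<open>A nonzero linear term without quadratic term takes negative values.\<close>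
  have "\<beta> = 0"
  proof (rule ccontr)
    assume "\<beta> \<noteq> 0"
    then show False using assms(1)[of "(\<alpha> + 1) / (2 * \<beta>)"] True by simp
  qed
  then show ?thesis using True by simp
next
  case False
  with assms(2) have d: "\<delta> > 0" by simp
  have "0 \<le> \<delta> * (\<alpha> - 2 * (\<beta> / \<delta>) * \<beta> + (\<beta> / \<delta>)\<^sup>2 * \<delta>)"
    using assms(1)[of "\<beta> / \<delta>"] d by simp
  also have "\<dots> = \<alpha> * \<delta> - \<beta>\<^sup>2"
    using d by (simp add: field_simps power2_eq_square)
  finally show ?thesis by simp
qed

text \<open>
  A subspace of a function space with a positive semidefinite symmetric form. The
  linear structure is that of functions, and \<open>D\<close> is a parameter because forms are defined on proper
  subspaces of \<open>L\<^sup>2\<close> only.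
\<close>

locale inner_fun_space =
  fixes D :: "('x \<Rightarrow> real) set" and B :: "('x \<Rightarrow> real) \<Rightarrow> ('x \<Rightarrow> real) \<Rightarrow> real"
  assumes zero_mem: "(\<lambda>_. 0) \<in> D"
    and add_mem: "\<lbrakk>f \<in> D; g \<in> D\<rbrakk> \<Longrightarrow> (f \<oplus> g) \<in> D"
    and scale_mem: "f \<in> D \<Longrightarrow> (\<lambda>x. a * f x) \<in> D"
    and sym: "\<lbrakk>f \<in> D; g \<in> D\<rbrakk> \<Longrightarrow> B f g = B g f"
    and add_left: "\<lbrakk>f \<in> D; g \<in> D; h \<in> D\<rbrakk> \<Longrightarrow> B (f \<oplus> g) h = B f h + B g h"
    and scale_left: "\<lbrakk>f \<in> D; h \<in> D\<rbrakk> \<Longrightarrow> B (\<lambda>x. a * f x) h = a * B f h"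
    and nonneg: "f \<in> D \<Longrightarrow> 0 \<le> B f f"
begin

lemma lincomb_mem: "\<lbrakk>f \<in> D; g \<in> D\<rbrakk> \<Longrightarrow> (\<lambda>x. f x + a * g x) \<in> D"
  by (intro add_mem scale_mem)

lemma diff_mem: "\<lbrakk>f \<in> D; g \<in> D\<rbrakk> \<Longrightarrow> (f \<ominus> g) \<in> D"
  using lincomb_mem[of f g "-1"] by simp

lemma add_right: "\<lbrakk>f \<in> D; g \<in> D; h \<in> D\<rbrakk> \<Longrightarrow> B h (f \<oplus> g) = B h f + B h g"
  using sym[of h "\<lambda>x. f x + g x"] sym[of h f] sym[of h g] add_left[of f g h] add_mem[of f g] by simp

lemma scale_right: "\<lbrakk>f \<in> D; h \<in> D\<rbrakk> \<Longrightarrow> B h (\<lambda>x. a * f x) = a * B h f"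
  using sym[of h "\<lambda>x. a * f x"] sym[of h f] scale_left[of f h a] scale_mem[of f a] by simp

lemma diff_left: "\<lbrakk>f \<in> D; g \<in> D; h \<in> D\<rbrakk> \<Longrightarrow> B (f \<ominus> g) h = B f h - B g h"
  using add_left[of f "\<lambda>x. (-1) * g x" h] scale_left[of g h "-1"] scale_mem[of g "-1"] by simp

lemma diff_right: "\<lbrakk>f \<in> D; g \<in> D; h \<in> D\<rbrakk> \<Longrightarrow> B h (f \<ominus> g) = B h f - B h g"
  using sym[of h "\<lambda>x. f x - g x"] sym[of h f] sym[of h g] diff_left[of f g h] diff_mem[of f g] by simp

lemma norm_lincomb:
  "\<lbrakk>f \<in> D; g \<in> D\<rbrakk> \<Longrightarrow> quad B (\<lambda>x. f x + a * g x) = B f f + 2 * a * B f g + a\<^sup>2 * B g g"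
  using sym[of g f] add_left[of f "\<lambda>x. a * g x" "\<lambda>x. f x + a * g x"] add_right[of f "\<lambda>x. a * g x" f]
    add_right[of f "\<lambda>x. a * g x" g] scale_left[of g "\<lambda>x. f x + a * g x" a] scale_right[of g f a]
    scale_right[of g g a] lincomb_mem[of f g a] scale_mem[of g a]
  by (simp add: power2_eq_square algebra_simps)

lemma norm_add:
  "\<lbrakk>f \<in> D; g \<in> D\<rbrakk> \<Longrightarrow> quad B (f \<oplus> g) = B f f + 2 * B f g + B g g"
  using norm_lincomb[of f g 1] by simp

lemma norm_diff:
  "\<lbrakk>f \<in> D; g \<in> D\<rbrakk> \<Longrightarrow> quad B (f \<ominus> g) = B f f - 2 * B f g + B g g"
  using norm_lincomb[of f g "-1"] by simp

lemma norm_scale: "f \<in> D \<Longrightarrow> quad B (\<lambda>x. a * f x) = a\<^sup>2 * B f f"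
  using scale_left[of f "\<lambda>x. a * f x" a] scale_right[of f f a] scale_mem[of f a] by (simp add: power2_eq_square)

lemma Cauchy_Schwarz:
  assumes "f \<in> D" "g \<in> D"
  shows "(B f g)\<^sup>2 \<le> B f f * B g g"
proof (rule nonneg_quadratic_discriminant)
  fix t
  show "0 \<le> B f f - 2 * t * B f g + t\<^sup>2 * B g g"
    using nonneg[OF lincomb_mem[OF assms, of "-t"]] norm_lincomb[OF assms, of "-t"] by simp
qed (simp add: nonneg assms)

lemma norm_zero_orthogonal: "\<lbrakk>f \<in> D; g \<in> D; B g g = 0\<rbrakk> \<Longrightarrow> B f g = 0"
  using Cauchy_Schwarz[of f g] by simp

lemma norm_add_le:
  assumes "f \<in> D" "g \<in> D"
  shows "quad B (f \<oplus> g) \<le> 2 * B f f + 2 * B g g"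
  using norm_add[OF assms] norm_diff[OF assms] nonneg[OF diff_mem[OF assms]] by simp

lemma midpoint:
  assumes "f \<in> D" "g \<in> D"
  shows "quad B (f \<ominus> g)
    = 2 * B f f + 2 * B g g - 4 * quad B (\<lambda>x. (1/2) * f x + (1/2) * g x)"
proof -
  have "quad B (\<lambda>x. (1/2) * f x + (1/2) * g x)
      = (1/2)\<^sup>2 * quad B (f \<oplus> g)"
    using norm_scale[OF add_mem[OF assms], of "1/2"] by (simp add: distrib_left)
  then show ?thesis using norm_add[OF assms] norm_diff[OF assms] by (simp add: power2_eq_square)
qed

lemma norm_tendsto:
  assumes F: "\<And>n. F n \<in> D" and f: "f \<in> D"
    and lim: "(\<lambda>n. quad B (F n \<ominus> f)) \<longlonglongrightarrow> 0" and g: "g \<in> D"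
  shows "(\<lambda>n. B (F n) g) \<longlonglongrightarrow> B f g" and "(\<lambda>n. quad B (F n)) \<longlonglongrightarrow> B f f"
proof -
  have *: "(\<lambda>n. B (F n) h) \<longlonglongrightarrow> B f h" if h: "h \<in> D" for h
  proof -
    have lim0: "(\<lambda>n. sqrt (quad B (F n \<ominus> f) * B h h)) \<longlonglongrightarrow> 0"
      using tendsto_real_sqrt[OF tendsto_mult[OF lim tendsto_const[of "B h h"]]] by simp
    have "\<bar>B (F n) h - B f h\<bar> \<le> sqrt (quad B (F n \<ominus> f) * B h h)" for n
      using Cauchy_Schwarz[OF diff_mem[OF F f] h, of n] diff_left[OF F f h, of n]
      by (simp add: real_le_rsqrt)
    then have "\<forall>n. norm (B (F n) h - B f h) \<le> sqrt (quad B (F n \<ominus> f) * B h h)"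
      by simp
    from Lim_null_comparison[OF always_eventually[OF this] lim0]
    have "(\<lambda>n. B (F n) h - B f h) \<longlonglongrightarrow> 0" .
    then show ?thesis by (simp add: LIM_zero_iff)
  qed
  show "(\<lambda>n. B (F n) g) \<longlonglongrightarrow> B f g" by (rule *[OF g])
  have "(\<lambda>n. quad B (F n \<ominus> f) + 2 * B (F n) f - B f f) \<longlonglongrightarrow> 0 + 2 * B f f - B f f"
    by (intro tendsto_intros lim * f)
  then show "(\<lambda>n. quad B (F n)) \<longlonglongrightarrow> B f f"
    using norm_diff[OF F f] by simp
qed

end

definition Cauchy_wrt :: "(('x \<Rightarrow> real) \<Rightarrow> ('x \<Rightarrow> real) \<Rightarrow> real) \<Rightarrow> (nat \<Rightarrow> 'x \<Rightarrow> real) \<Rightarrow> bool" where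
  "Cauchy_wrt B F \<longleftrightarrow> (\<forall>e>0. \<exists>n. \<forall>i\<ge>n. \<forall>j\<ge>n. quad B (F i \<ominus> F j) < e)"

definition complete_wrt :: "(('x \<Rightarrow> real) \<Rightarrow> ('x \<Rightarrow> real) \<Rightarrow> real) \<Rightarrow> ('x \<Rightarrow> real) set \<Rightarrow> bool" where
  "complete_wrt B S \<longleftrightarrow>
     (\<forall>F. (\<forall>n. F n \<in> S) \<and> Cauchy_wrt B F \<longrightarrow> (\<exists>f\<in>S. (\<lambda>n. quad B (F n \<ominus> f)) \<longlonglongrightarrow> 0))"

lemma complete_wrtI:
  assumes "\<And>F. \<lbrakk>\<And>n. F n \<in> S; Cauchy_wrt B F\<rbrakk> \<Longrightarrow> \<exists>f\<in>S. (\<lambda>n. quad B (F n \<ominus> f)) \<longlonglongrightarrow> 0"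
  shows "complete_wrt B S"
  using assms unfolding complete_wrt_def by blast

lemma complete_wrtE:
  assumes "complete_wrt B S" "\<And>n. F n \<in> S" "Cauchy_wrt B F"
  obtains f where "f \<in> S" "(\<lambda>n. quad B (F n \<ominus> f)) \<longlonglongrightarrow> 0"
  using assms unfolding complete_wrt_def by blast

lemma Cauchy_wrtD:
  assumes "Cauchy_wrt B F" "e > 0"
  obtains n where "\<And>i j. i \<ge> n \<Longrightarrow> j \<ge> n \<Longrightarrow> quad B (F i \<ominus> F j) < e"
  using assms unfolding Cauchy_wrt_def by meson

lemma Cauchy_wrt_mono:
  assumes C: "Cauchy_wrt B F" and k: "k > 0"
    and le: "\<And>i j. quad B' (G i \<ominus> G j) \<le> k * quad B (F i \<ominus> F j)"
  shows "Cauchy_wrt B' G"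
  unfolding Cauchy_wrt_def
proof (intro allI impI)
  fix e :: real assume "e > 0"
  then have "e / k > 0" using k by simp
  then obtain n where n: "\<And>i j. i \<ge> n \<Longrightarrow> j \<ge> n \<Longrightarrow> quad B (F i \<ominus> F j) < e / k"
    using Cauchy_wrtD[OF C] by blast
  have "quad B' (G i \<ominus> G j) < e" if "i \<ge> n" "j \<ge> n" for i j
    using le[of i j] n[OF that] k by (simp add: pos_less_divide_eq mult.commute)
  then show "\<exists>n. \<forall>i\<ge>n. \<forall>j\<ge>n. quad B' (G i \<ominus> G j) < e" by blast
qed

lemma null_sequence_le:
  fixes a b :: "nat \<Rightarrow> real"
  assumes "b \<longlonglongrightarrow> 0" "\<And>n. 0 \<le> a n" "\<And>n. a n \<le> k * b n"
  shows "a \<longlonglongrightarrow> 0"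
proof (rule tendsto_sandwich[of "\<lambda>_. 0"])
  show "(\<lambda>n. k * b n) \<longlonglongrightarrow> 0" using tendsto_mult[OF tendsto_const[of k] assms(1)] by simp
qed (use assms in auto)

text \<open>
  Completeness passes from \<open>D\<close> to \<open>S\<close> if \<open>u\<close> maps Cauchy sequences to Cauchy sequences and \<open>v\<close> maps their
  limits back. For \<open>u\<close> the harmonic extension and \<open>v\<close> the trace this yields closedness of trace forms.
\<close>

lemma complete_transfer:
  assumes D: "complete_wrt B D" and uv: "\<And>\<phi>. \<phi> \<in> S \<Longrightarrow> u \<phi> \<in> D" "\<And>f. f \<in> D \<Longrightarrow> v f \<in> S"
    and u: "\<And>\<phi> \<psi>. \<lbrakk>\<phi> \<in> S; \<psi> \<in> S\<rbrakk> \<Longrightarrow> quad B (u \<phi> \<ominus> u \<psi>) \<le> quad B' (\<phi> \<ominus> \<psi>)"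
    and v: "\<And>\<phi> f. \<lbrakk>\<phi> \<in> S; f \<in> D\<rbrakk> \<Longrightarrow> 0 \<le> quad B' (\<phi> \<ominus> v f)"
      "\<And>\<phi> f. \<lbrakk>\<phi> \<in> S; f \<in> D\<rbrakk> \<Longrightarrow> quad B' (\<phi> \<ominus> v f) \<le> k * quad B (u \<phi> \<ominus> f)"
  shows "complete_wrt B' S"
proof (rule complete_wrtI)
  fix F :: "nat \<Rightarrow> 'b \<Rightarrow> real" assume F: "\<And>n. F n \<in> S" and C: "Cauchy_wrt B' F"
  have "Cauchy_wrt B (\<lambda>n. u (F n))" by (rule Cauchy_wrt_mono[OF C, of 1]) (simp_all add: u F)
  then obtain f where f: "f \<in> D" "(\<lambda>n. quad B (u (F n) \<ominus> f)) \<longlonglongrightarrow> 0"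
    using complete_wrtE[where F = "\<lambda>n. u (F n)", OF D uv(1)[OF F]] by blast
  have "(\<lambda>n. quad B' (F n \<ominus> v f)) \<longlonglongrightarrow> 0" by (rule null_sequence_le[OF f(2) v(1,2)]) (rule F f(1))+
  then show "\<exists>f\<in>S. (\<lambda>n. quad B' (F n \<ominus> f)) \<longlonglongrightarrow> 0" using uv(2)[OF f(1)] by blast
qed

lemma complete_wrt_cong:
  assumes "complete_wrt B S" "\<And>f g. \<lbrakk>f \<in> S; g \<in> S\<rbrakk> \<Longrightarrow> (f \<ominus> g) \<in> S" "\<And>f. f \<in> S \<Longrightarrow> quad B' f = quad B f"
    and "\<And>f. f \<in> S \<Longrightarrow> 0 \<le> quad B f"
  shows "complete_wrt B' S"
  by (rule complete_transfer[OF assms(1), where u = id and v = id and k = 1]) (use assms(2-4) in auto)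

lemma ennreal_all_pos_iff:
  assumes "\<And>e e'. \<lbrakk>P e; e \<le> e'\<rbrakk> \<Longrightarrow> P e'"
  shows "(\<forall>e>0. P e) \<longleftrightarrow> (\<forall>r>0. P (ennreal r))"
proof (intro iffI allI impI)
  fix e :: ennreal assume R: "\<forall>r>0. P (ennreal r)" and "e > 0"
  then obtain r where "r > 0" "ennreal r \<le> e"
    by (metis ennreal_cases ennreal_less_zero_iff order_refl top_greatest zero_less_one)
  then show "P e" using R assms by blast
qed simp

context inner_fun_space
begin

lemma eval_tendsto:
  assumes k: "\<And>g. g \<in> D \<Longrightarrow> (g x)\<^sup>2 \<le> k * B g g" and "\<And>n. F n \<in> D" "f \<in> D"
    and "(\<lambda>n. quad B (F n \<ominus> f)) \<longlonglongrightarrow> 0"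
  shows "(\<lambda>n. F n x) \<longlonglongrightarrow> f x"
proof -
  have "(\<lambda>n. (F n x - f x)\<^sup>2) \<longlonglongrightarrow> 0"
    by (rule null_sequence_le[OF assms(4) _ k[OF diff_mem[OF assms(2,3)]]]) simp
  then have "(\<lambda>n. F n x - f x) \<longlonglongrightarrow> 0" by simp
  then show ?thesis by (simp add: LIM_zero_iff)
qed

lemma minimizing_sequence_converges:
  assumes S: "S \<subseteq> D" "complete_wrt B S"
    and F: "\<And>n. F n \<in> S"
    and le: "\<And>i j. i \<le> j \<Longrightarrow> quad B (F i \<ominus> F j) \<le> a i"
    and a: "a \<longlonglongrightarrow> 0"
  obtains f where "f \<in> S" "(\<lambda>n. quad B (F n \<ominus> f)) \<longlonglongrightarrow> 0"
proof -
  have FD: "F n \<in> D" for n using F S by auto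
  have "Cauchy_wrt B F"
    unfolding Cauchy_wrt_def
  proof (intro allI impI)
    fix e :: real assume "e > 0"
    from order_tendstoD(2)[OF a this] obtain N where N: "\<And>n. n \<ge> N \<Longrightarrow> a n < e"
      by (auto simp: eventually_sequentially)
    have "quad B (F i \<ominus> F j) < e" if ij: "i \<ge> N" "j \<ge> N" for i j
    proof (cases "i \<le> j")
      case True
      then show ?thesis using le[OF True] N[OF ij(1)] by simp
    next
      case False
      have "quad B (F i \<ominus> F j) = quad B (F j \<ominus> F i)"
        using norm_diff[OF FD FD] sym[OF FD FD] by simp
      then show ?thesis using False le[of j i] N[OF ij(2)] by simp
    qed
    then show "\<exists>N. \<forall>i\<ge>N. \<forall>j\<ge>N. quad B (F i \<ominus> F j) < e" by blast
  qed
  from complete_wrtE[OF S(2) F this] that show ?thesis by blast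
qed

text \<open>
  The usual minimising sequence for the distance from \<open>f\<close> to \<open>S\<close> is Cauchy by the parallelogram law; the
  minimiser is orthogonal because its distance cannot be decreased along any direction in \<open>S\<close>.
\<close>

lemma orthogonal_projection:
  assumes S: "S \<subseteq> D" "complete_wrt B S"
    and S0: "(\<lambda>_. 0) \<in> S" and Sadd: "\<And>f g a. \<lbrakk>f \<in> S; g \<in> S\<rbrakk> \<Longrightarrow> (\<lambda>x. f x + a * g x) \<in> S"
    and f: "f \<in> D"
  obtains s where "s \<in> S" "\<And>u. u \<in> S \<Longrightarrow> B (f \<ominus> s) u = 0"
proof -
  define N where "N u = quad B (f \<ominus> u)" for u
  define d where "d = Inf (N ` S)"
  have N0: "0 \<le> N u" if "u \<in> S" for u
    unfolding N_def using that S f by (intro nonneg diff_mem) auto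
  have bdd: "bdd_below (N ` S)" using N0 by (auto intro!: bdd_belowI[of _ 0])
  have dle: "d \<le> N u" if "u \<in> S" for u
    unfolding d_def using bdd that by (auto intro: cInf_lower)
  have "\<exists>u\<in>S. N u < d + inverse (real (Suc n))" for n
  proof -
    have "Inf (N ` S) < d + inverse (real (Suc n))" unfolding d_def by simp
    then show ?thesis using cInf_lessD[of "N ` S"] S0 by blast
  qed
  then obtain F where F: "\<And>n. F n \<in> S" and FN: "\<And>n. N (F n) < d + inverse (real (Suc n))"
    by metis
  have FD: "F n \<in> D" for n using F S by auto
  have le: "quad B (F i \<ominus> F j) \<le> 4 * inverse (real (Suc i))" if "i \<le> j" for i j
  proof -
    have mid: "(\<lambda>x. (1/2) * F i x + (1/2) * F j x) \<in> S"
    proof -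
      have "(\<lambda>x. 0 + (1/2) * F i x) \<in> S" using Sadd[OF S0 F[of i], of "1/2"] by simp
      then show ?thesis using Sadd[of "\<lambda>x. (1/2) * F i x" "F j" "1/2"] F by simp
    qed
    have "quad B (F i \<ominus> F j)
        = quad B (\<lambda>x. (f x - F j x) - (f x - F i x))"
      by simp
    also have "\<dots> = 2 * N (F j) + 2 * N (F i)
        - 4 * quad B (\<lambda>x. (1/2) * (f x - F j x) + (1/2) * (f x - F i x))"
      unfolding N_def by (rule midpoint) (intro diff_mem f FD)+
    also have "(\<lambda>x. (1/2) * (f x - F j x) + (1/2) * (f x - F i x)) = (\<lambda>x. f x - ((1/2) * F i x + (1/2) * F j x))"
      by (auto simp: field_simps)
    also have "2 * N (F j) + 2 * N (F i) - 4 * quad B (\<lambda>x. f x - ((1/2) * F i x + (1/2) * F j x))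
       \<le> 2 * (d + inverse (real (Suc j))) + 2 * (d + inverse (real (Suc i))) - 4 * d"
      using FN[of i] FN[of j] dle[OF mid] unfolding N_def by (simp add: less_imp_le)
    also have "\<dots> \<le> 4 * inverse (real (Suc i))"
      using le_imp_inverse_le[of "real (Suc i)" "real (Suc j)"] that by simp
    finally show ?thesis .
  qed
  have lim0: "(\<lambda>i. 4 * inverse (real (Suc i))) \<longlonglongrightarrow> 0"
    using tendsto_mult[OF tendsto_const[of 4] LIMSEQ_inverse_real_of_nat] by simp
  obtain s where s: "s \<in> S" "(\<lambda>n. quad B (F n \<ominus> s)) \<longlonglongrightarrow> 0"
    using minimizing_sequence_converges[where F = F, OF S F le lim0] by blast
  show ?thesis
  proof (rule that[OF s(1)])
    fix u assume u: "u \<in> S"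
    have uD: "u \<in> D" and sD: "s \<in> D" using u s S by auto
    have sq: "(B (f \<ominus> F n) u)\<^sup>2 \<le> inverse (real (Suc n)) * B u u" for n
    proof (rule nonneg_quadratic_discriminant)
      fix t
      have "(\<lambda>x. F n x + t * u x) \<in> S" by (rule Sadd[OF F u])
      from dle[OF this] have "d \<le> quad B (\<lambda>x. (f x - F n x) + (-t) * u x)"
        unfolding N_def by (simp add: algebra_simps)
      also have "\<dots> = N (F n) - 2 * t * B (f \<ominus> F n) u + t\<^sup>2 * B u u"
        unfolding N_def by (subst norm_lincomb) (auto intro: diff_mem f FD uD)
      finally show "0 \<le> inverse (real (Suc n)) - 2 * t * B (f \<ominus> F n) u + t\<^sup>2 * B u u"
        using FN[of n] by simp
    qed (rule nonneg[OF uD])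
    have "(\<lambda>n. (B (f \<ominus> F n) u)\<^sup>2) \<longlonglongrightarrow> 0"
      by (rule null_sequence_le[OF LIMSEQ_inverse_real_of_nat, of _ "B u u"]) (use sq in \<open>simp_all add: mult.commute\<close>)
    moreover have "(\<lambda>n. (B (f \<ominus> F n) u)\<^sup>2) \<longlonglongrightarrow> (B f u - B s u)\<^sup>2"
      unfolding diff_left[OF f FD uD] by (intro tendsto_intros norm_tendsto(1)[OF FD sD s(2) uD])
    ultimately have "(B f u - B s u)\<^sup>2 = 0" by (rule LIMSEQ_unique[symmetric])
    then show "B (f \<ominus> s) u = 0" using diff_left[OF f sD uD] by simp
  qed
qed

text \<open>
  A substitute for weak compactness. Let \<open>K n\<close> be the set of all \<open>g\<close> in the domain whose distance
  to \<open>f\<close> at any point is at most the supremum of the distances of \<open>F k\<close>, \<open>k \<ge> n\<close>. These sets are convex,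
  decreasing, contain the tails, and shrink pointwise to \<open>f\<close>. Elements of almost minimal norm of
  \<open>K n\<close> form a Cauchy sequence by the parallelogram law, since the minimal norms increase to a finite
  limit. Its limit can only be \<open>f\<close>.
\<close>

lemma pointwise_limit:
  assumes D: "complete_wrt B D"
    and pt: "\<And>x. \<exists>k. \<forall>g\<in>D. (g x)\<^sup>2 \<le> k * B g g"
    and F: "\<And>n. F n \<in> D" and lim: "\<And>x. (\<lambda>n. F n x) \<longlonglongrightarrow> f x"
    and le: "\<And>n. quad B (F n) \<le> a n" and a: "a \<longlonglongrightarrow> \<alpha>"
  shows "f \<in> D" and "B f f \<le> \<alpha>"
proof -
  define K where "K n = {g \<in> D. \<forall>x \<epsilon>. (\<forall>k\<ge>n. \<bar>F k x - f x\<bar> \<le> \<epsilon>) \<longrightarrow> \<bar>g x - f x\<bar> \<le> \<epsilon>}" for n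
  have KD: "K n \<subseteq> D" for n by (auto simp: K_def)
  have KF: "F k \<in> K n" if "n \<le> k" for n k using that F by (auto simp: K_def)
  have Kmono: "K j \<subseteq> K i" if "i \<le> j" for i j using that unfolding K_def by (auto dest: le_trans)
  have Kmid: "(\<lambda>x. (1/2) * g x + (1/2) * h x) \<in> K n" if "g \<in> K n" "h \<in> K n" for g h n
  proof -
    have "\<bar>(1/2) * g x + (1/2) * h x - f x\<bar> \<le> \<epsilon>" if "\<forall>k\<ge>n. \<bar>F k x - f x\<bar> \<le> \<epsilon>" for x \<epsilon>
    proof -
      have "\<bar>g x - f x\<bar> \<le> \<epsilon>" "\<bar>h x - f x\<bar> \<le> \<epsilon>"
        using that \<open>g \<in> K n\<close> \<open>h \<in> K n\<close> by (auto simp: K_def)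
      then show ?thesis by argo
    qed
    moreover have "(\<lambda>x. (1/2) * g x + (1/2) * h x) \<in> D"
      using that KD by (intro add_mem scale_mem) auto
    ultimately show ?thesis unfolding K_def by blast
  qed
  define N where "N g = B g g" for g
  define d where "d n = Inf (N ` K n)" for n
  have bdd: "bdd_below (N ` K n)" for n
    using KD nonneg by (auto intro!: bdd_belowI[of _ 0] simp: N_def)
  have dle: "d n \<le> N g" if "g \<in> K n" for n g
    unfolding d_def using bdd that by (auto intro: cInf_lower)
  have dmono: "incseq d"
  proof (rule incseq_SucI)
    fix n
    have "K (Suc n) \<noteq> {}" using KF by blast
    then show "d n \<le> d (Suc n)"
      unfolding d_def by (intro cInf_superset_mono) (auto simp: bdd image_mono Kmono)
  qed
  have da: "d n \<le> \<alpha>" for n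
  proof (rule Lim_bounded2[OF a, of n])
    show "\<forall>k\<ge>n. d n \<le> a k" using dle[OF KF] le by (auto simp: N_def intro: order_trans)
  qed
  then have conv: "convergent d" 
    using dmono by (intro Bseq_mono_convergent incseq_bounded) (auto simp: incseq_def)
  define \<delta> where "\<delta> = lim d"
  have dlim: "d \<longlonglongrightarrow> \<delta>" using conv by (simp add: \<delta>_def convergent_LIMSEQ_iff)
  have \<delta>a: "\<delta> \<le> \<alpha>" using LIMSEQ_le_const2[OF dlim] da by auto
  have d\<delta>: "d n \<le> \<delta>" for n by (rule incseq_le[OF dmono dlim])
  have "\<exists>g\<in>K n. N g < d n + inverse (real (Suc n))" for n
  proof -
    have "Inf (N ` K n) < d n + inverse (real (Suc n))" unfolding d_def by simp
    moreover have "K n \<noteq> {}" using KF by blast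
    ultimately show ?thesis using cInf_lessD[of "N ` K n"] by blast
  qed
  then obtain G where G: "\<And>n. G n \<in> K n" and GN: "\<And>n. N (G n) < d n + inverse (real (Suc n))"
    by metis
  have GD: "G n \<in> D" for n using G KD by blast
  define r where "r i = 2 * (\<delta> - d i) + 4 * inverse (real (Suc i))" for i
  have GC: "quad B (G i \<ominus> G j) \<le> r i" if "i \<le> j" for i j
  proof -
    have "G j \<in> K i" using G Kmono[OF that] by blast
    then have "d i \<le> N (\<lambda>x. (1/2) * G i x + (1/2) * G j x)" by (intro dle Kmid G)
    moreover have "inverse (real (Suc j)) \<le> inverse (real (Suc i))"
      using that by (intro le_imp_inverse_le) auto
    then have "N (G j) \<le> \<delta> + inverse (real (Suc i))"
      using GN[of j] d\<delta>[of j] by linarith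
    moreover have "quad B (G i \<ominus> G j)
        = 2 * N (G i) + 2 * N (G j) - 4 * N (\<lambda>x. (1/2) * G i x + (1/2) * G j x)"
      unfolding N_def by (rule midpoint[OF GD GD])
    ultimately show ?thesis
      unfolding r_def using GN[of i] by argo
  qed
  have "r \<longlonglongrightarrow> 2 * (\<delta> - \<delta>) + 4 * 0"
    unfolding r_def by (intro tendsto_intros dlim LIMSEQ_inverse_real_of_nat)
  then have r0: "r \<longlonglongrightarrow> 0" by simp
  obtain g where g: "g \<in> D" "(\<lambda>n. quad B (G n \<ominus> g)) \<longlonglongrightarrow> 0"
    using minimizing_sequence_converges[where F = G and a = r, OF subset_refl D GD GC r0] by blast
  have "g x = f x" for x
  proof -
    obtain k where k: "\<And>h. h \<in> D \<Longrightarrow> (h x)\<^sup>2 \<le> k * B h h" using pt by blast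
    have 1: "(\<lambda>n. G n x) \<longlonglongrightarrow> g x" by (rule eval_tendsto[OF k GD g])
    have 2: "(\<lambda>n. G n x) \<longlonglongrightarrow> f x"
    proof (rule LIMSEQ_I)
      fix e :: real assume "0 < e"
      then obtain n where n: "\<And>k. k \<ge> n \<Longrightarrow> \<bar>F k x - f x\<bar> < e / 2"
        using LIMSEQ_D[OF lim[of x], of "e/2"] by auto
      have "\<bar>G k x - f x\<bar> \<le> e / 2" if "k \<ge> n" for k
      proof -
        have "\<forall>j\<ge>k. \<bar>F j x - f x\<bar> \<le> e / 2" using n that by (meson le_trans less_imp_le)
        with G[of k] show ?thesis unfolding K_def by blast
      qed
      with \<open>0 < e\<close> show "\<exists>no. \<forall>k\<ge>no. norm (G k x - f x) < e"
        by (intro exI[of _ n]) force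
    qed
    show ?thesis using LIMSEQ_unique[OF 1 2] .
  qed
  then have gf: "g = f" by auto
  show "f \<in> D" using g gf by simp
  have "(\<lambda>n. quad B (G n)) \<longlonglongrightarrow> B f f" using norm_tendsto(2)[OF GD g(1) g(2) g(1)] gf by simp
  moreover have "(\<lambda>n. d n + inverse (real (Suc n))) \<longlonglongrightarrow> \<delta> + 0"
    by (intro tendsto_intros dlim LIMSEQ_inverse_real_of_nat)
  ultimately have "B f f \<le> \<delta> + 0"
    using GN by (intro LIMSEQ_le) (auto simp: N_def intro!: exI[of _ 0] less_imp_le)
  then show "B f f \<le> \<alpha>" using \<delta>a by simp
qed

end

section \<open>Quadratic forms on \<open>L\<^sup>2\<close>-spaces\<close>

definition L2_inner :: "'x measure \<Rightarrow> ('x \<Rightarrow> real) \<Rightarrow> ('x \<Rightarrow> real) \<Rightarrow> real" where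
  "L2_inner M f g = (\<integral>x. f x * g x \<partial>M)"

lemma L2_iff: "f \<in> L2 M \<longleftrightarrow> f \<in> borel_measurable M \<and> normsq M f < \<infinity>"
  unfolding L2_def normsq_def by (auto simp: integrable_iff_bounded)

lemma normsq_L2: "f \<in> L2 M \<Longrightarrow> normsq M f = ennreal (L2_inner M f f)"
  unfolding L2_def normsq_def L2_inner_def
  by (auto simp: nn_integral_eq_integral power2_eq_square[symmetric])

lemma L2_mult_integrable:
  assumes "f \<in> L2 M" "g \<in> L2 M" shows "integrable M (\<lambda>x. f x * g x)"
proof (rule Bochner_Integration.integrable_bound)
  show "integrable M (\<lambda>x. (f x)\<^sup>2 + (g x)\<^sup>2)" using assms by (auto simp: L2_def)
  show "(\<lambda>x. f x * g x) \<in> borel_measurable M" using assms by (auto simp: L2_def)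
  have "\<bar>a * b\<bar> \<le> a\<^sup>2 + b\<^sup>2" for a b :: real
  proof -
    have "2 * (\<bar>a\<bar> * \<bar>b\<bar>) \<le> a\<^sup>2 + b\<^sup>2" "0 \<le> \<bar>a\<bar> * \<bar>b\<bar>"
      using sum_squares_bound[of "\<bar>a\<bar>" "\<bar>b\<bar>"] by (simp_all add: mult.assoc)
    then show ?thesis unfolding abs_mult by linarith
  qed
  then show "AE x in M. norm (f x * g x) \<le> norm ((f x)\<^sup>2 + (g x)\<^sup>2)" by simp
qed

lemma L2_add: "f \<in> L2 M \<Longrightarrow> g \<in> L2 M \<Longrightarrow> (f \<oplus> g) \<in> L2 M"
  using L2_mult_integrable[of f M g] by (auto simp: L2_def power2_sum mult.assoc)

lemma L2_scale: "f \<in> L2 M \<Longrightarrow> (\<lambda>x. a * f x) \<in> L2 M"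
  by (auto simp: L2_def power_mult_distrib)

lemma inner_fun_space_L2: "inner_fun_space (L2 M) (L2_inner M)"
proof
  show "(\<lambda>_. 0) \<in> L2 M" by (simp add: L2_def)
  fix f g h :: "'a \<Rightarrow> real" and a assume f: "f \<in> L2 M" and h: "h \<in> L2 M"
  show "(\<lambda>x. a * f x) \<in> L2 M" by (rule L2_scale[OF f])
  show "L2_inner M f h = L2_inner M h f" by (simp add: L2_inner_def mult.commute)
  show "L2_inner M (\<lambda>x. a * f x) h = a * L2_inner M f h" by (simp add: L2_inner_def mult.assoc)
  show "0 \<le> L2_inner M f f" by (simp add: L2_inner_def)
  assume g: "g \<in> L2 M"
  show "L2_inner M (f \<oplus> g) h = L2_inner M f h + L2_inner M g h"
    using L2_mult_integrable[OF f h] L2_mult_integrable[OF g h] by (simp add: L2_inner_def distrib_right)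
  show "(f \<oplus> g) \<in> L2 M" by (rule L2_add[OF f g])
qed

interpretation L2: inner_fun_space "L2 M" "L2_inner M" for M
  by (rule inner_fun_space_L2)

lemma inner_fun_space_cong:
  assumes "inner_fun_space D B" and eq: "\<And>f g. \<lbrakk>f \<in> D; g \<in> D\<rbrakk> \<Longrightarrow> B' f g = B f g"
  shows "inner_fun_space D B'"
proof -
  interpret inner_fun_space D B by fact
  show ?thesis
  proof
    fix f g h :: "'a \<Rightarrow> real" and a assume f: "f \<in> D" and h: "h \<in> D"
    show "B' f h = B' h f" using eq[OF f h] eq[OF h f] sym[OF f h] by simp
    show "B' (\<lambda>x. a * f x) h = a * B' f h"
      using eq[OF scale_mem[OF f] h] eq[OF f h] scale_left[OF f h] by simp
    show "0 \<le> B' f f" using eq[OF f f] nonneg[OF f] by simp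
    show "(\<lambda>x. a * f x) \<in> D" by (rule scale_mem[OF f])
    assume g: "g \<in> D"
    show "B' (f \<oplus> g) h = B' f h + B' g h"
      using eq[OF add_mem[OF f g] h] eq[OF f h] eq[OF g h] add_left[OF f g h] by simp
    show "(f \<oplus> g) \<in> D" by (rule add_mem[OF f g])
  qed (rule zero_mem)
qed

lemma inner_fun_space_subspace:
  assumes "inner_fun_space D B" and "S \<subseteq> D" and "(\<lambda>_. 0) \<in> S"
    and "\<And>f g. \<lbrakk>f \<in> S; g \<in> S\<rbrakk> \<Longrightarrow> (f \<oplus> g) \<in> S" and "\<And>f a. f \<in> S \<Longrightarrow> (\<lambda>x. a * f x) \<in> S"
  shows "inner_fun_space S B"
proof -
  interpret inner_fun_space D B by fact
  show ?thesis
  proof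
    fix f g h :: "'a \<Rightarrow> real" and a assume f: "f \<in> S" and h: "h \<in> S"
    then have D: "f \<in> D" "h \<in> D" using assms(2) by auto
    show "B f h = B h f" "B (\<lambda>x. a * f x) h = a * B f h" "0 \<le> B f f"
      by (rule sym scale_left nonneg; fact D)+
    show "(\<lambda>x. a * f x) \<in> S" by (rule assms(5)[OF f])
    assume g: "g \<in> S"
    then have "g \<in> D" using assms(2) by auto
    then show "B (f \<oplus> g) h = B f h + B g h" by (rule add_left[OF D(1) _ D(2)])
    show "(f \<oplus> g) \<in> S" by (rule assms(4)[OF f g])
  qed (rule assms(3))
qed

lemma inner_fun_space_lincomb:
  assumes "inner_fun_space D B" and "inner_fun_space D B'" and pos: "\<And>f. f \<in> D \<Longrightarrow> 0 \<le> B f f + k * B' f f"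
  shows "inner_fun_space D (\<lambda>f g. B f g + k * B' f g)"
proof -
  interpret inner_fun_space D B by fact
  interpret B': inner_fun_space D B' by fact
  show ?thesis
  proof
    fix f g h :: "'a \<Rightarrow> real" and a assume f: "f \<in> D" and h: "h \<in> D"
    show "B f h + k * B' f h = B h f + k * B' h f" using sym[OF f h] B'.sym[OF f h] by simp
    show "B (\<lambda>x. a * f x) h + k * B' (\<lambda>x. a * f x) h = a * (B f h + k * B' f h)"
      unfolding scale_left[OF f h] B'.scale_left[OF f h] by (simp add: algebra_simps)
    show "(\<lambda>x. a * f x) \<in> D" by (rule scale_mem[OF f])
    assume g: "g \<in> D"
    show "B (f \<oplus> g) h + k * B' (f \<oplus> g) h = B f h + k * B' f h + (B g h + k * B' g h)"
      unfolding add_left[OF f g h] B'.add_left[OF f g h] by (simp add: algebra_simps)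
    show "(f \<oplus> g) \<in> D" by (rule add_mem[OF f g])
  qed (use pos zero_mem in auto)
qed

text \<open>
  The bilinear form is recovered from the values of the form by polarisation, so that no choice of a
  bilinear form is involved and forms that agree almost everywhere have equal bilinear forms.
\<close>

definition polar :: "'x qform \<Rightarrow> ('x \<Rightarrow> real) \<Rightarrow> ('x \<Rightarrow> real) \<Rightarrow> real" where
  "polar Q f g = (enn2real (Q (f \<oplus> g)) - enn2real (Q (f \<ominus> g))) / 4"

lemma polar_unique:
  assumes B: "inner_fun_space (form_dom Q) B" and Q: "\<And>f. f \<in> form_dom Q \<Longrightarrow> Q f = ennreal (B f f)"
    and f: "f \<in> form_dom Q" and g: "g \<in> form_dom Q"
  shows "polar Q f g = B f g"
proof -
  interpret inner_fun_space "form_dom Q" B by (rule B)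
  show ?thesis
    unfolding polar_def Q[OF add_mem[OF f g]] Q[OF diff_mem[OF f g]]
    using nonneg[OF add_mem[OF f g]] nonneg[OF diff_mem[OF f g]]
    by (simp add: norm_add[OF f g] norm_diff[OF f g])
qed

lemma polar_diag:
  assumes B: "inner_fun_space (form_dom Q) B" and Q: "\<And>f. f \<in> form_dom Q \<Longrightarrow> Q f = ennreal (B f f)"
  shows "inner_fun_space (form_dom Q) (polar Q)"
    and "\<And>f. f \<in> form_dom Q \<Longrightarrow> Q f = ennreal (polar Q f f)"
proof -
  have p: "polar Q f g = B f g" if "f \<in> form_dom Q" "g \<in> form_dom Q" for f g
    using polar_unique[OF B Q] that by blast
  show "inner_fun_space (form_dom Q) (polar Q)" by (rule inner_fun_space_cong[OF B p])
  show "Q f = ennreal (polar Q f f)" if "f \<in> form_dom Q" for f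
    using p[OF that that] Q[OF that] by simp
qed

lemma quadratic_formI:
  assumes "\<And>f. f \<notin> L2 M \<Longrightarrow> Q f = \<infinity>"
    and "\<And>f g. \<lbrakk>f \<in> L2 M; g \<in> L2 M; AE x in M. f x = g x\<rbrakk> \<Longrightarrow> Q f = Q g"
    and "inner_fun_space (form_dom Q) B" and "\<And>f. f \<in> form_dom Q \<Longrightarrow> Q f = ennreal (B f f)"
  shows "quadratic_form M Q"
proof -
  interpret inner_fun_space "form_dom Q" B by fact
  show ?thesis unfolding quadratic_form_def
    by (intro conjI exI[of _ B] ballI allI impI assms zero_mem add_mem scale_mem sym add_left scale_left nonneg)
qed

lemma quadratic_formD:
  assumes "quadratic_form M Q"
  shows "\<And>f. f \<notin> L2 M \<Longrightarrow> Q f = \<infinity>"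
    and "\<And>f g. \<lbrakk>f \<in> L2 M; g \<in> L2 M; AE x in M. f x = g x\<rbrakk> \<Longrightarrow> Q f = Q g"
    and "inner_fun_space (form_dom Q) (polar Q)" and "\<And>f. f \<in> form_dom Q \<Longrightarrow> Q f = ennreal (polar Q f f)"
proof -
  note A = assms[unfolded quadratic_form_def]
  show "\<And>f. f \<notin> L2 M \<Longrightarrow> Q f = \<infinity>" using A[THEN conjunct1] by blast
  show "\<And>f g. \<lbrakk>f \<in> L2 M; g \<in> L2 M; AE x in M. f x = g x\<rbrakk> \<Longrightarrow> Q f = Q g"
    using A[THEN conjunct2, THEN conjunct1] by blast
  obtain B where B: "\<forall>f\<in>form_dom Q. \<forall>g\<in>form_dom Q. B f g = B g f"
      "\<forall>f\<in>form_dom Q. \<forall>g\<in>form_dom Q. \<forall>h\<in>form_dom Q. B (f \<oplus> g) h = B f h + B g h"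
      "\<forall>a. \<forall>f\<in>form_dom Q. \<forall>h\<in>form_dom Q. B (\<lambda>x. a * f x) h = a * B f h"
      "\<forall>f\<in>form_dom Q. 0 \<le> B f f \<and> Q f = ennreal (B f f)"
    using A[THEN conjunct2, THEN conjunct2, THEN conjunct2, THEN conjunct2, THEN conjunct2] by blast
  have i: "inner_fun_space (form_dom Q) B"
  proof (rule inner_fun_space.intro)
    show "(\<lambda>_. 0) \<in> form_dom Q" using A[THEN conjunct2, THEN conjunct2, THEN conjunct1] .
    show "\<And>f g. \<lbrakk>f \<in> form_dom Q; g \<in> form_dom Q\<rbrakk> \<Longrightarrow> (f \<oplus> g) \<in> form_dom Q"
      using A[THEN conjunct2, THEN conjunct2, THEN conjunct2, THEN conjunct1] by blast
    show "\<And>f a. f \<in> form_dom Q \<Longrightarrow> (\<lambda>x. a * f x) \<in> form_dom Q"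
      using A[THEN conjunct2, THEN conjunct2, THEN conjunct2, THEN conjunct2, THEN conjunct1] by blast
  qed (use B in blast)+
  from polar_diag[OF i] B(4) show "inner_fun_space (form_dom Q) (polar Q)"
    and "\<And>f. f \<in> form_dom Q \<Longrightarrow> Q f = ennreal (polar Q f f)" by blast+
qed

lemma form_dom_L2: "quadratic_form M Q \<Longrightarrow> f \<in> form_dom Q \<Longrightarrow> f \<in> L2 M"
  using quadratic_formD(1)[of M Q f] by (cases "f \<in> L2 M") (auto simp: form_dom_def)

lemma normsq_cong_AE: "AE x in M. f x = g x \<Longrightarrow> normsq M f = normsq M g"
  unfolding normsq_def by (rule nn_integral_cong_AE) auto

lemma L2_inner_cong_AE:
  assumes "f \<in> L2 M" "g \<in> L2 M" "AE x in M. f x = g x"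
  shows "L2_inner M f f = L2_inner M g g"
  using normsq_cong_AE[OF assms(3)] normsq_L2[OF assms(1)] normsq_L2[OF assms(2)]
    L2.nonneg[OF assms(1)] L2.nonneg[OF assms(2)] by simp

lemma
  assumes Q: "quadratic_form M Q"
  shows form_dom_form1: "form_dom (form1 M Q) = form_dom Q"
    and quadratic_form1: "quadratic_form M (form1 M Q)"
    and polar_form1: "\<And>f g. \<lbrakk>f \<in> form_dom Q; g \<in> form_dom Q\<rbrakk> \<Longrightarrow> polar (form1 M Q) f g = polar Q f g + L2_inner M f g"
proof -
  interpret inner_fun_space "form_dom Q" "polar Q" by (rule quadratic_formD[OF Q])
  have L: "f \<in> L2 M" if "f \<in> form_dom Q" for f using form_dom_L2[OF Q that] .
  show dom: "form_dom (form1 M Q) = form_dom Q"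
  proof
    show "form_dom Q \<subseteq> form_dom (form1 M Q)"
    proof
      fix f assume f: "f \<in> form_dom Q"
      then show "f \<in> form_dom (form1 M Q)"
        using L2_iff[of f M] L[OF f] by (auto simp: form_dom_def form1_def)
    qed
  qed (auto simp: form_dom_def form1_def)
  have val: "form1 M Q f = ennreal (polar Q f f + L2_inner M f f)" if f: "f \<in> form_dom Q" for f
    unfolding form1_def quadratic_formD(4)[OF Q f] normsq_L2[OF L[OF f]]
    using nonneg[OF f] L2.nonneg[OF L[OF f]] by simp
  have "inner_fun_space (form_dom Q) (L2_inner M)"
    using inner_fun_space_subspace[OF inner_fun_space_L2 _ zero_mem add_mem scale_mem] L by blast
  from inner_fun_space_lincomb[OF inner_fun_space_axioms this, of 1]
  have i: "inner_fun_space (form_dom (form1 M Q)) (\<lambda>f g. polar Q f g + L2_inner M f g)"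
    unfolding dom using nonneg L2.nonneg L by force
  show "quadratic_form M (form1 M Q)"
  proof (rule quadratic_formI[OF _ _ i])
    show "form1 M Q f = \<infinity>" if "f \<notin> L2 M" for f
      using quadratic_formD(1)[OF Q that] by (simp add: form1_def)
    show "form1 M Q f = form1 M Q g" if "f \<in> L2 M" "g \<in> L2 M" "AE x in M. f x = g x" for f g
      using quadratic_formD(2)[OF Q that] normsq_cong_AE[OF that(3)] by (simp add: form1_def)
  qed (use val dom in auto)
  show "polar (form1 M Q) f g = polar Q f g + L2_inner M f g" if "f \<in> form_dom Q" "g \<in> form_dom Q" for f g
    by (rule polar_unique[OF i]) (use val that dom in auto)
qed

text \<open>
  It is often \<open>Q\<^sub>1\<close> that has a convenient bilinear form; subtracting the inner product of \<open>L\<^sup>2\<close> gives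
  one for \<open>Q\<close>.
\<close>

lemma quadratic_form_if_form1:
  assumes off: "\<And>f. f \<notin> L2 M \<Longrightarrow> Q f = \<infinity>"
    and ae: "\<And>f g. \<lbrakk>f \<in> L2 M; g \<in> L2 M; AE x in M. f x = g x\<rbrakk> \<Longrightarrow> Q f = Q g"
    and B: "inner_fun_space (form_dom Q) B" and val: "\<And>f. f \<in> form_dom Q \<Longrightarrow> form1 M Q f = ennreal (B f f)"
  shows "quadratic_form M Q"
proof -
  interpret inner_fun_space "form_dom Q" B by (rule B)
  have L: "f \<in> L2 M" if "f \<in> form_dom Q" for f using that off[of f] by (cases "f \<in> L2 M") (auto simp: form_dom_def)
  have *: "L2_inner M f f \<le> B f f \<and> Q f = ennreal (B f f - L2_inner M f f)" if f: "f \<in> form_dom Q" for f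
  proof -
    obtain r where r: "Q f = ennreal r" "0 \<le> r"
      using f by (cases "Q f") (auto simp: form_dom_def)
    have "ennreal (B f f) = ennreal (r + L2_inner M f f)"
      using val[OF f] r normsq_L2[OF L[OF f]] L2.nonneg[OF L[OF f]] by (simp add: form1_def)
    then have "B f f = r + L2_inner M f f"
      using nonneg[OF f] r L2.nonneg[OF L[OF f]]
      by (subst (asm) ennreal_inj) (auto intro: add_nonneg_nonneg)
    then show ?thesis using r by simp
  qed
  have "inner_fun_space (form_dom Q) (L2_inner M)"
    using inner_fun_space_subspace[OF inner_fun_space_L2 _ zero_mem add_mem scale_mem] L by blast
  from inner_fun_space_lincomb[OF inner_fun_space_axioms this, of "-1"]
  have "inner_fun_space (form_dom Q) (\<lambda>f g. B f g - L2_inner M f g)"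
    using * by simp
  from quadratic_formI[OF off ae this] * show ?thesis by auto
qed

lemma closed_form_iff_complete:
  assumes Q: "quadratic_form M Q"
  shows "closed_form M Q \<longleftrightarrow> complete_wrt (polar (form1 M Q)) (form_dom Q)"
proof -
  note Q1 = quadratic_form1[OF Q]
  interpret inner_fun_space "form_dom Q" "polar (form1 M Q)"
    using quadratic_formD(3)[OF Q1] form_dom_form1[OF Q] by simp
  have val: "form1 M Q f = ennreal (polar (form1 M Q) f f)" if "f \<in> form_dom Q" for f
    using quadratic_formD(4)[OF Q1] form_dom_form1[OF Q] that by simp
  have 1: "(\<forall>e>0. \<exists>N. \<forall>i\<ge>N. \<forall>j\<ge>N. form1 M Q (F i \<ominus> F j) < e) \<longleftrightarrow> Cauchy_wrt (polar (form1 M Q)) F"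
    if F: "\<And>n. F n \<in> form_dom Q" for F :: "nat \<Rightarrow> 'a \<Rightarrow> real"
  proof -
    have "form1 M Q (F i \<ominus> F j) < ennreal r \<longleftrightarrow> quad (polar (form1 M Q)) (F i \<ominus> F j) < r" for i j r
      using val[OF diff_mem[OF F F]] nonneg[OF diff_mem[OF F F]] by (simp add: ennreal_less_iff)
    moreover have "(\<forall>e>0. \<exists>N. \<forall>i\<ge>N. \<forall>j\<ge>N. form1 M Q (F i \<ominus> F j) < e) \<longleftrightarrow>
        (\<forall>r>0. \<exists>N. \<forall>i\<ge>N. \<forall>j\<ge>N. form1 M Q (F i \<ominus> F j) < ennreal r)"
      by (rule ennreal_all_pos_iff) (meson less_le_trans)
    ultimately show ?thesis by (simp add: Cauchy_wrt_def)
  qed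
  have 2: "(\<lambda>n. form1 M Q (F n \<ominus> f)) \<longlonglongrightarrow> 0 \<longleftrightarrow>
      (\<lambda>n. polar (form1 M Q) (F n \<ominus> f) (F n \<ominus> f)) \<longlonglongrightarrow> 0"
    if F: "\<And>n. F n \<in> form_dom Q" and f: "f \<in> form_dom Q" for F :: "nat \<Rightarrow> 'a \<Rightarrow> real" and f
    using val[OF diff_mem[OF F f]] nonneg[OF diff_mem[OF F f]]
      tendsto_ennreal_iff[of "\<lambda>n. polar (form1 M Q) (F n \<ominus> f) (F n \<ominus> f)" sequentially 0]
    by simp
  show ?thesis
    unfolding closed_form_def complete_wrt_def using 1 2 by (auto; blast)
qed

section \<open>Normal contractions\<close>

lemma normal_contraction_abs_le: "normal_contraction C \<Longrightarrow> \<bar>C s\<bar> \<le> \<bar>s\<bar>"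
  unfolding normal_contraction_def by (metis diff_zero)

definition clip :: "real \<Rightarrow> real \<Rightarrow> real" where
  "clip r t = max (- r) (min t r)"

lemma normal_contraction_clip: "0 \<le> r \<Longrightarrow> normal_contraction (clip r)"
  unfolding normal_contraction_def clip_def by (auto simp: max_def min_def)

lemma abs_clip_le: "0 \<le> r \<Longrightarrow> \<bar>clip r t\<bar> \<le> r"
  by (auto simp: clip_def max_def min_def)

lemma clip_eq_self: "\<bar>t\<bar> \<le> r \<Longrightarrow> clip r t = t"
  by (auto simp: clip_def max_def min_def)

lemma normal_contraction_unit: "normal_contraction (\<lambda>t. max 0 (min t 1))"
  unfolding normal_contraction_def by (auto simp: max_def min_def)

section \<open>Closures of subspaces\<close>

context inner_fun_space
begin

definition closure_of_subspace :: "('x \<Rightarrow> real) set \<Rightarrow> ('x \<Rightarrow> real) set" where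
  "closure_of_subspace S = {f \<in> D. \<forall>e>0. \<exists>g\<in>S. quad B (f \<ominus> g) < e}"

lemma subset_closure: "S \<subseteq> D \<Longrightarrow> S \<subseteq> closure_of_subspace S"
proof
  fix f assume S: "S \<subseteq> D" and f: "f \<in> S"
  then have fD: "f \<in> D" by blast
  have "quad B (f \<ominus> f) = 0" using norm_diff[OF fD fD] by simp
  then show "f \<in> closure_of_subspace S"
    unfolding closure_of_subspace_def using fD f by force
qed

lemma closure_lincomb:
  assumes S: "S \<subseteq> D" and Sl: "\<And>f g a. \<lbrakk>f \<in> S; g \<in> S\<rbrakk> \<Longrightarrow> (\<lambda>x. f x + a * g x) \<in> S"
    and f: "f \<in> closure_of_subspace S" and g: "g \<in> closure_of_subspace S"
  shows "(\<lambda>x. f x + a * g x) \<in> closure_of_subspace S"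
proof -
  have fD: "f \<in> D" and gD: "g \<in> D" using f g by (auto simp: closure_of_subspace_def)
  have "\<exists>h\<in>S. quad B (\<lambda>x. (f x + a * g x) - h x) < e" if e: "e > 0" for e
  proof -
    have "e / 4 > 0" "e / (4 * (a\<^sup>2 + 1)) > 0" using e by (auto intro!: divide_pos_pos add_nonneg_pos)
    then obtain u v where u: "u \<in> S" "quad B (f \<ominus> u) < e / 4"
      and v: "v \<in> S" "quad B (g \<ominus> v) < e / (4 * (a\<^sup>2 + 1))"
      using f g unfolding closure_of_subspace_def by blast
    have uD: "u \<in> D" and vD: "v \<in> D" using u v S by auto
    note fu = diff_mem[OF fD uD] and gv = diff_mem[OF gD vD]
    have "0 < 4 * (a\<^sup>2 + 1)" by (simp add: add_nonneg_pos)
    from v(2)[unfolded pos_less_divide_eq[OF this]]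
    have "a\<^sup>2 * quad B (g \<ominus> v) < e / 4"
      using nonneg[OF gv] by (simp add: algebra_simps)
    moreover have "quad B (\<lambda>x. (f x - u x) + a * (g x - v x))
        \<le> 2 * quad B (f \<ominus> u) + 2 * (a\<^sup>2 * quad B (g \<ominus> v))"
      using norm_add_le[OF fu scale_mem[OF gv, of a]] norm_scale[OF gv, of a] by simp
    moreover have "(\<lambda>x. (f x - u x) + a * (g x - v x)) = (\<lambda>x. (f x + a * g x) - (u x + a * v x))"
      by (auto simp: algebra_simps)
    ultimately have "quad B (\<lambda>x. (f x + a * g x) - (u x + a * v x)) < e"
      using u(2) by simp
    then show ?thesis using Sl[OF u(1) v(1), of a] by (intro bexI[of _ "\<lambda>x. u x + a * v x"])
  qed
  then show ?thesis using lincomb_mem[OF fD gD] by (simp add: closure_of_subspace_def)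
qed

lemma closure_complete:
  assumes D: "complete_wrt B D" and S: "S \<subseteq> D"
  shows "complete_wrt B (closure_of_subspace S)"
proof (rule complete_wrtI)
  fix F assume F: "\<And>n. F n \<in> closure_of_subspace S" and C: "Cauchy_wrt B F"
  have FD: "F n \<in> D" for n using F by (auto simp: closure_of_subspace_def)
  obtain f where f: "f \<in> D" and lim: "(\<lambda>n. quad B (F n \<ominus> f)) \<longlonglongrightarrow> 0"
    using complete_wrtE[OF D FD C] by blast
  have "\<exists>g\<in>S. quad B (f \<ominus> g) < e" if e: "e > 0" for e
  proof -
    have "e / 4 > 0" using e by simp
    from order_tendstoD(2)[OF lim this] obtain n where n: "quad B (F n \<ominus> f) < e / 4"
      by (auto simp: eventually_sequentially)
    obtain g where g: "g \<in> S" "quad B (F n \<ominus> g) < e / 4"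
      using F \<open>e / 4 > 0\<close> unfolding closure_of_subspace_def by blast
    have gD: "g \<in> D" using g S by auto
    have "quad B (\<lambda>x. (F n x - g x) + (-1) * (F n x - f x))
      \<le> 2 * quad B (F n \<ominus> g) + 2 * quad B (F n \<ominus> f)"
      using norm_add_le[OF diff_mem[OF FD gD] scale_mem[OF diff_mem[OF FD f], of "-1"], of n n]
        norm_scale[OF diff_mem[OF FD f], of "-1" n] by simp
    then have "quad B (f \<ominus> g) < e" using g(2) n by simp
    then show ?thesis using g(1) by blast
  qed
  then have "f \<in> closure_of_subspace S" using f by (simp add: closure_of_subspace_def)
  then show "\<exists>f\<in>closure_of_subspace S. (\<lambda>n. quad B (F n \<ominus> f)) \<longlonglongrightarrow> 0"
    using lim by blast
qed

text \<open>
  Orthogonality survives approximation, by the Cauchy-Schwarz inequality.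
\<close>

lemma orthogonal_closure:
  assumes S: "S \<subseteq> D" and f: "f \<in> D" and orth: "\<And>g. g \<in> S \<Longrightarrow> B f g = 0"
    and h: "h \<in> closure_of_subspace S"
  shows "B f h = 0"
proof (rule ccontr)
  assume "B f h \<noteq> 0"
  then have pos: "(B f h)\<^sup>2 / (B f f + 1) > 0" using nonneg[OF f] by (intro divide_pos_pos) auto
  have hD: "h \<in> D" using h by (auto simp: closure_of_subspace_def)
  obtain g where g: "g \<in> S" "quad B (h \<ominus> g) < (B f h)\<^sup>2 / (B f f + 1)"
    using h pos unfolding closure_of_subspace_def by blast
  have gD: "g \<in> D" using g S by auto
  have "(B f h)\<^sup>2 \<le> B f f * quad B (h \<ominus> g)"
    using Cauchy_Schwarz[OF f diff_mem[OF hD gD]] diff_right[OF hD gD f] orth[OF g(1)] by simp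
  also have "\<dots> \<le> (B f f + 1) * quad B (h \<ominus> g)"
    using nonneg[OF diff_mem[OF hD gD]] by (simp add: algebra_simps)
  also have "\<dots> < (B f h)\<^sup>2"
    using g(2) nonneg[OF f] by (simp add: field_simps)
  finally show False by simp
qed

end

text \<open>
  The map \<open>T\<close> has to be linear on \<open>S\<close> only: harmonic extension is linear on traces and meaningless
  elsewhere.
\<close>

lemma inner_fun_space_pullback:
  assumes "inner_fun_space D B" and S: "inner_fun_space S B'"
    and add: "\<And>f g. \<lbrakk>f \<in> S; g \<in> S\<rbrakk> \<Longrightarrow> T (f \<oplus> g) = (T f \<oplus> T g)"
    and scale: "\<And>a f. f \<in> S \<Longrightarrow> T (\<lambda>x. a * f x) = (\<lambda>y. a * T f y)"
  shows "inner_fun_space {f \<in> S. T f \<in> D} (\<lambda>f g. B (T f) (T g))"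
proof -
  interpret inner_fun_space D B by fact
  interpret S: inner_fun_space S B' by fact
  show ?thesis
  proof
    have "T (\<lambda>_. 0) = (\<lambda>_. 0)" using scale[OF S.zero_mem, of 0] by simp
    then show "(\<lambda>_. 0) \<in> {f \<in> S. T f \<in> D}" using zero_mem S.zero_mem by simp
    fix f g h a assume f: "f \<in> {f \<in> S. T f \<in> D}" and h: "h \<in> {f \<in> S. T f \<in> D}"
    show "(\<lambda>x. a * f x) \<in> {f \<in> S. T f \<in> D}" using f scale[of f a] scale_mem[of "T f" a] S.scale_mem[of f a] by simp
    show "B (T f) (T h) = B (T h) (T f)" using f h sym by simp
    show "B (T (\<lambda>x. a * f x)) (T h) = a * B (T f) (T h)" using f h scale[of f a] scale_left by simp
    show "0 \<le> quad B (T f)" using f nonneg by simp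
    assume g: "g \<in> {f \<in> S. T f \<in> D}"
    show "(f \<oplus> g) \<in> {f \<in> S. T f \<in> D}"
      using f g add[of f g] add_mem[of "T f" "T g"] S.add_mem[of f g] by simp
    show "B (T (f \<oplus> g)) (T h) = B (T f) (T h) + B (T g) (T h)"
      using f g h add[of f g] add_left[of "T f" "T g" "T h"] by simp
  qed
qed

section \<open>The energy of a graph\<close>

lemma nn_integral_count_space_sum:
  "(\<integral>\<^sup>+k. F k \<partial>count_space UNIV) =
     (\<integral>\<^sup>+x. F (Inl x) \<partial>count_space UNIV) + (\<integral>\<^sup>+y. F (Inr y) \<partial>count_space UNIV)"
proof -
  have "(\<integral>\<^sup>+k. F k \<partial>count_space UNIV)
      = (\<integral>\<^sup>+k. F k * indicator (range Inl) k + F k * indicator (range Inr) k \<partial>count_space UNIV)"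
  proof (rule nn_integral_cong)
    fix k show "F k = F k * indicator (range Inl) k + F k * indicator (range Inr) k"
      by (cases k) (auto simp: indicator_def)
  qed
  also have "\<dots> = (\<integral>\<^sup>+k. F k * indicator (range Inl) k \<partial>count_space UNIV)
      + (\<integral>\<^sup>+k. F k * indicator (range Inr) k \<partial>count_space UNIV)"
    by (rule nn_integral_add) auto
  also have "(\<integral>\<^sup>+k. F k * indicator (range Inl) k \<partial>count_space UNIV) = (\<integral>\<^sup>+x. F (Inl x) \<partial>count_space UNIV)"
    using nn_integral_bij_count_space[of Inl UNIV "range Inl" F]
    by (simp add: bij_betw_def nn_integral_count_space_indicator)
  also have "(\<integral>\<^sup>+k. F k * indicator (range Inr) k \<partial>count_space UNIV) = (\<integral>\<^sup>+x. F (Inr x) \<partial>count_space UNIV)"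
    using nn_integral_bij_count_space[of Inr UNIV "range Inr" F]
    by (simp add: bij_betw_def nn_integral_count_space_indicator)
  finally show ?thesis .
qed

locale weighted_graph =
  fixes m :: "'a::countable \<Rightarrow> real" and b :: "'a \<Rightarrow> 'a \<Rightarrow> real" and c :: "'a \<Rightarrow> real"
  assumes graph: "graph m b c"
begin

lemma m_pos: "0 < m x" and b_nonneg: "0 \<le> b x y" and b_sym: "b x y = b y x"
  and b_summable: "(\<lambda>y. b x y) summable_on UNIV" and c_nonneg: "0 \<le> c x"
  using graph by (auto simp: graph_def)

abbreviation "V \<equiv> vmeas m"
abbreviation "N \<equiv> form_dom (QN m b c)"
abbreviation "N1 \<equiv> form1 (vmeas m) (QN m b c)"
abbreviation "E \<equiv> polar (form1 (vmeas m) (QN m b c))"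

lemma AE_vmeas: "(AE x in V. P x) \<longleftrightarrow> (\<forall>x. P x)"
  unfolding vmeas_def by (subst AE_density) (auto simp: AE_count_space m_pos)

lemma measurable_vmeas: "f \<in> borel_measurable V"
  unfolding vmeas_def by simp

lemma normsq_vmeas: "normsq V f = (\<integral>\<^sup>+x. ennreal (m x * (f x)\<^sup>2) \<partial>count_space UNIV)"
  unfolding normsq_def vmeas_def
  by (subst nn_integral_density) (auto simp: ennreal_mult m_pos less_imp_le)

lemma L2_vmeas: "f \<in> L2 V \<longleftrightarrow> normsq V f < \<infinity>"
  using L2_iff[of f V] measurable_vmeas by auto

text \<open>
  The form \<open>Q\<^sup>N\<^sub>1\<close> is the square of an \<open>\<ell>\<^sup>2\<close>-norm: the index set consists of the ordered pairs of vertices and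
  of two copies of the vertices, one for the killing term and one for the measure. The factor \<open>1/2\<close>
  accounts for every edge being counted twice.
\<close>

definition grad :: "('a \<Rightarrow> real) \<Rightarrow> ('a \<times> 'a) + ('a + 'a) \<Rightarrow> real" where
  "grad f k = (case k of Inl (x, y) \<Rightarrow> sqrt (b x y / 2) * (f x - f y)
                | Inr (Inl x) \<Rightarrow> sqrt (c x) * f x
                | Inr (Inr x) \<Rightarrow> sqrt (m x) * f x)"

lemma grad_simps:
  "grad f (Inl (x, y)) = sqrt (b x y / 2) * (f x - f y)"
  "grad f (Inr (Inl x)) = sqrt (c x) * f x"
  "grad f (Inr (Inr x)) = sqrt (m x) * f x"
  by (auto simp: grad_def)

lemma index_cases:
  obtains (edge) x y where "k = Inl (x, y)" | (killing) x where "k = Inr (Inl x)" | (mass) x where "k = Inr (Inr x)"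
  by (metis old.sum.exhaust surj_pair)

lemma grad_sq:
  "(grad f (Inl (x, y)))\<^sup>2 = b x y * (f x - f y)\<^sup>2 / 2"
  "(grad f (Inr (Inl x)))\<^sup>2 = c x * (f x)\<^sup>2"
  "(grad f (Inr (Inr x)))\<^sup>2 = m x * (f x)\<^sup>2"
  using b_nonneg[of x y] c_nonneg[of x] m_pos[of x] by (auto simp: grad_simps power_mult_distrib)

lemma grad_add: "grad (f \<oplus> g) = (grad f \<oplus> grad g)"
proof
  fix k show "grad (f \<oplus> g) k = grad f k + grad g k"
    by (cases k rule: index_cases) (simp_all add: grad_simps algebra_simps)
qed

lemma grad_scale: "grad (\<lambda>x. a * f x) = (\<lambda>k. a * grad f k)"
proof
  fix k show "grad (\<lambda>x. a * f x) k = a * grad f k"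
    by (cases k rule: index_cases) (simp_all add: grad_simps algebra_simps)
qed

lemma energy_grad: "energy b c f = (\<integral>\<^sup>+z. ennreal ((grad f (Inl z))\<^sup>2) \<partial>count_space UNIV)
    + (\<integral>\<^sup>+x. ennreal ((grad f (Inr (Inl x)))\<^sup>2) \<partial>count_space UNIV)"
proof -
  have "(\<integral>\<^sup>+x. \<integral>\<^sup>+y. ennreal (b x y * (f x - f y)\<^sup>2) \<partial>count_space UNIV \<partial>count_space UNIV) / 2
      = (\<integral>\<^sup>+z. (case z of (x, y) \<Rightarrow> ennreal (b x y * (f x - f y)\<^sup>2)) \<partial>count_space UNIV) / 2"
    by (subst nn_integral_fst_count_space[symmetric]) simp
  also have "\<dots> = (\<integral>\<^sup>+z. (case z of (x, y) \<Rightarrow> ennreal (b x y * (f x - f y)\<^sup>2)) / 2 \<partial>count_space UNIV)"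
    by (rule nn_integral_divide[symmetric]) simp
  also have "\<dots> = (\<integral>\<^sup>+z. ennreal ((grad f (Inl z))\<^sup>2) \<partial>count_space UNIV)"
    by (intro nn_integral_cong) (auto simp: grad_sq b_nonneg ennreal_divide_numeral split: prod.splits)
  finally show ?thesis unfolding energy_def by (simp add: grad_sq)
qed

lemma energy_normsq: "energy b c f + normsq V f = normsq (count_space UNIV) (grad f)"
  unfolding energy_grad normsq_vmeas normsq_def[of "count_space UNIV"]
  by (simp add: nn_integral_count_space_sum grad_sq add.assoc)

lemma N1_grad: "N1 f = normsq (count_space UNIV) (grad f)"
proof (cases "f \<in> L2 V")
  case True
  then show ?thesis using energy_normsq[of f] by (simp add: form1_def QN_def)
next
  case False
  then have "normsq V f = \<infinity>" using L2_vmeas by (simp add: less_top[symmetric])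
  then show ?thesis using energy_normsq[of f] by (simp add: form1_def)
qed

lemma N_iff_N1: "f \<in> N \<longleftrightarrow> N1 f < \<infinity>"
  using L2_vmeas[of f] by (auto simp: form_dom_def form1_def QN_def)

lemma N_iff_grad: "f \<in> N \<longleftrightarrow> grad f \<in> L2 (count_space UNIV)"
  using N_iff_N1 N1_grad L2_iff by auto

lemma inner_fun_space_grad: "inner_fun_space N (\<lambda>f g. L2_inner (count_space UNIV) (grad f) (grad g))"
proof -
  have "N = {f \<in> UNIV. grad f \<in> L2 (count_space UNIV)}" using N_iff_grad by blast
  moreover have "inner_fun_space (UNIV :: ('a \<Rightarrow> real) set) (\<lambda>_ _. 0)" by unfold_locales auto
  ultimately show ?thesis
    using inner_fun_space_pullback[where T = grad and S = UNIV and B' = "\<lambda>_ _. 0",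
        OF inner_fun_space_L2[of "count_space UNIV"] _ grad_add grad_scale] by simp
qed

lemma quadratic_form_QN: "quadratic_form V (QN m b c)"
proof (rule quadratic_form_if_form1)
  show "inner_fun_space N (\<lambda>f g. L2_inner (count_space UNIV) (grad f) (grad g))"
    by (rule inner_fun_space_grad)
  show "N1 f = ennreal (L2_inner (count_space UNIV) (grad f) (grad f))" if "f \<in> N" for f
    using that N_iff_grad N1_grad normsq_L2 by metis
  show "QN m b c f = QN m b c g" if "AE x in V. f x = g x" for f g
  proof -
    have "f = g" using that AE_vmeas by auto
    then show ?thesis by simp
  qed
qed (simp add: QN_def)

sublocale inner_fun_space N E
  using quadratic_formD(3)[OF quadratic_form1[OF quadratic_form_QN]] form_dom_form1[OF quadratic_form_QN] by simp

lemma N1_E: "f \<in> N \<Longrightarrow> N1 f = ennreal (E f f)"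
  using quadratic_formD(4)[OF quadratic_form1[OF quadratic_form_QN]] form_dom_form1[OF quadratic_form_QN] by simp

lemma E_grad: "\<lbrakk>f \<in> N; g \<in> N\<rbrakk> \<Longrightarrow> E f g = L2_inner (count_space UNIV) (grad f) (grad g)"
proof (rule polar_unique)
  show "inner_fun_space (form_dom N1) (\<lambda>f g. L2_inner (count_space UNIV) (grad f) (grad g))"
    using inner_fun_space_grad form_dom_form1[OF quadratic_form_QN] by simp
  show "N1 f = ennreal (L2_inner (count_space UNIV) (grad f) (grad f))" if "f \<in> form_dom N1" for f
    using that N_iff_grad N1_grad normsq_L2 form_dom_form1[OF quadratic_form_QN] by metis
qed (use form_dom_form1[OF quadratic_form_QN] in auto)

lemma E_bound: "f \<in> N \<Longrightarrow> N1 f \<le> ennreal r \<Longrightarrow> 0 \<le> r \<Longrightarrow> E f f \<le> r"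
  using N1_E by simp

lemma point_bound: "f \<in> N \<Longrightarrow> m x * (f x)\<^sup>2 \<le> E f f"
proof -
  assume f: "f \<in> N"
  have "ennreal (m x * (f x)\<^sup>2) \<le> N1 f"
    unfolding N1_grad normsq_def
    using nn_integral_ge_point[of "Inr (Inr x)" UNIV "\<lambda>k. ennreal ((grad f k)\<^sup>2)"] by (simp add: grad_sq)
  then show ?thesis using N1_E[OF f] nonneg[OF f] by simp
qed

lemma eval_bound: "\<exists>k. \<forall>g\<in>N. (g x)\<^sup>2 \<le> k * E g g"
proof (intro exI ballI)
  fix g assume "g \<in> N"
  from point_bound[OF this, of x] show "(g x)\<^sup>2 \<le> (1 / m x) * E g g"
    using m_pos[of x] by (simp add: field_simps)
qed

lemma E_eq_0: "f \<in> N \<Longrightarrow> E f f = 0 \<Longrightarrow> f x = 0"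
proof -
  assume "f \<in> N" "E f f = 0"
  then have "m x * (f x)\<^sup>2 \<le> 0" using point_bound[of f x] by simp
  moreover have "0 \<le> m x * (f x)\<^sup>2" using m_pos[of x] by simp
  ultimately have "m x * (f x)\<^sup>2 = 0" by simp
  then show "f x = 0" using m_pos[of x] by simp
qed

lemma N1_Fatou:
  assumes lim: "\<And>x. (\<lambda>n. G n x) \<longlonglongrightarrow> g x" and le: "\<And>n. n \<ge> n0 \<Longrightarrow> N1 (G n) \<le> e"
  shows "N1 g \<le> e"
proof -
  have gl: "(\<lambda>n. grad (G n) k) \<longlonglongrightarrow> grad g k" for k
    by (cases k rule: index_cases) (auto simp: grad_simps intro!: tendsto_intros lim)
  have "N1 g = (\<integral>\<^sup>+k. liminf (\<lambda>n. ennreal ((grad (G n) k)\<^sup>2)) \<partial>count_space UNIV)"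
    unfolding N1_grad normsq_def
    by (intro nn_integral_cong lim_imp_Liminf[symmetric] tendsto_ennrealI tendsto_power gl) simp
  also have "\<dots> \<le> liminf (\<lambda>n. N1 (G n))"
    unfolding N1_grad normsq_def by (rule nn_integral_liminf) simp
  also have "\<dots> \<le> limsup (\<lambda>n. N1 (G n))" by (rule Liminf_le_Limsup) simp
  also have "\<dots> \<le> e" by (rule Limsup_bounded) (use le in \<open>auto simp: eventually_sequentially\<close>)
  finally show ?thesis .
qed

text \<open>
  A Cauchy sequence converges pointwise by \<open>point_bound\<close>, and Fatou's lemma turns the pointwise limit into a
  limit for the form.
\<close>

lemma complete_N: "complete_wrt E N"
proof (rule complete_wrtI)
  fix F :: "nat \<Rightarrow> 'a \<Rightarrow> real"
  assume FN: "\<And>n. F n \<in> N" and C: "Cauchy_wrt E F"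
  have "Cauchy (\<lambda>n. F n x)" for x
  proof (rule CauchyI)
    fix e :: real assume e: "e > 0"
    then have "m x * e\<^sup>2 > 0" using m_pos by simp
    with C obtain n where n: "\<And>i j. i \<ge> n \<Longrightarrow> j \<ge> n \<Longrightarrow> quad E (F i \<ominus> F j) < m x * e\<^sup>2"
      using Cauchy_wrtD by blast
    have "norm (F i x - F j x) < e" if "i \<ge> n" "j \<ge> n" for i j
    proof -
      have "m x * (F i x - F j x)\<^sup>2 < m x * e\<^sup>2"
        using point_bound[OF diff_mem[OF FN FN], of x i j] n[OF that] by simp
      then have "(F i x - F j x)\<^sup>2 < e\<^sup>2" using m_pos[of x] by simp
      then show ?thesis using e by (metis abs_of_pos abs_le_square_iff not_le real_norm_def)
    qed
    then show "\<exists>M. \<forall>i\<ge>M. \<forall>j\<ge>M. norm (F i x - F j x) < e" by blast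
  qed
  then have "\<exists>l. (\<lambda>n. F n x) \<longlonglongrightarrow> l" for x by (simp add: Cauchy_convergent_iff convergent_def)
  then obtain f where f: "\<And>x. (\<lambda>n. F n x) \<longlonglongrightarrow> f x" by metis
  have *: "\<exists>n. \<forall>i\<ge>n. N1 (F i \<ominus> f) \<le> ennreal e" if e: "e > 0" for e
  proof -
    obtain n where n: "\<And>i j. i \<ge> n \<Longrightarrow> j \<ge> n \<Longrightarrow> quad E (F i \<ominus> F j) < e"
      using Cauchy_wrtD[OF C e] by blast
    have "N1 (F i \<ominus> f) \<le> ennreal e" if i: "i \<ge> n" for i
    proof (rule N1_Fatou)
      show "(\<lambda>j. F i x - F j x) \<longlonglongrightarrow> F i x - f x" for x by (intro tendsto_intros f)
      show "N1 (F i \<ominus> F j) \<le> ennreal e" if "j \<ge> n" for j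
        using n[OF i that] N1_E[OF diff_mem[OF FN FN], of i j] by (simp add: ennreal_leI)
    qed
    then show ?thesis by blast
  qed
  obtain i where "N1 (F i \<ominus> f) \<le> ennreal 1" using *[of 1] by auto
  then have "N1 (F i \<ominus> f) < \<infinity>" using ennreal_less_top le_less_trans by fastforce
  then have "(F i \<ominus> f) \<in> N" using N_iff_N1 by blast
  from diff_mem[OF FN this, of i] have "(\<lambda>x. F i x - (F i x - f x)) \<in> N" .
  then have fN: "f \<in> N" by simp
  have "(\<lambda>n. quad E (F n \<ominus> f)) \<longlonglongrightarrow> 0"
  proof (rule LIMSEQ_I)
    fix e :: real assume "e > 0"
    then obtain n where n: "\<And>i. i \<ge> n \<Longrightarrow> N1 (F i \<ominus> f) \<le> ennreal (e/2)" using *[of "e/2"] by auto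
    have "quad E (F i \<ominus> f) \<le> e / 2" if "i \<ge> n" for i
      using E_bound[OF diff_mem[OF FN fN] n[OF that]] \<open>e > 0\<close> by simp
    then show "\<exists>no. \<forall>n\<ge>no. norm (quad E (F n \<ominus> f) - 0) < e"
      using nonneg[OF diff_mem[OF FN fN]] \<open>e > 0\<close> by (intro exI[of _ n]) force
  qed
  then show "\<exists>f\<in>N. (\<lambda>n. quad E (F n \<ominus> f)) \<longlonglongrightarrow> 0" using fN by blast
qed

end

definition delta :: "'a \<Rightarrow> 'a \<Rightarrow> real" where
  "delta y = (\<lambda>x. if x = y then 1 else 0)"

lemma finsupp_induct [consumes 1, case_names zero add]:
  assumes "f \<in> finsupp" and "P (\<lambda>_. 0)" and step: "\<And>f y a. \<lbrakk>f \<in> finsupp; P f\<rbrakk> \<Longrightarrow> P (\<lambda>x. f x + a * delta y x)"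
  shows "P f"
proof -
  have "P f" if "finite A" "{x. f x \<noteq> 0} \<subseteq> A" for f A
    using that
  proof (induction A arbitrary: f rule: finite_induct)
    case empty
    then have "f = (\<lambda>_. 0)" by auto
    then show ?case using assms(2) by simp
  next
    case (insert y A)
    let ?g = "\<lambda>x. if x = y then 0 else f x"
    have sub: "{x. ?g x \<noteq> 0} \<subseteq> A" using insert.prems by auto
    have "finite {x. ?g x \<noteq> 0}" by (rule finite_subset[OF sub insert.hyps(1)])
    then have "?g \<in> finsupp" by (simp only: finsupp_def mem_Collect_eq)
    from step[OF this insert.IH[OF sub], of "f y" y]
    have "P (\<lambda>x. ?g x + f y * delta y x)" .
    moreover have "(\<lambda>x. ?g x + f y * delta y x) = f" by (auto simp: delta_def)
    ultimately show ?case by simp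
  qed
  then show ?thesis using assms(1) by (auto simp: finsupp_def)
qed

lemma finsupp_lincomb: "f \<in> finsupp \<Longrightarrow> g \<in> finsupp \<Longrightarrow> (\<lambda>x. f x + a * g x) \<in> finsupp"
proof -
  assume "f \<in> finsupp" "g \<in> finsupp"
  then have "finite ({x. f x \<noteq> 0} \<union> {x. g x \<noteq> 0})" by (simp add: finsupp_def)
  then have "finite {x. f x + a * g x \<noteq> 0}" by (rule rev_finite_subset) auto
  then show ?thesis by (simp add: finsupp_def)
qed

lemma finsupp_zero: "(\<lambda>_. 0) \<in> finsupp" by (simp add: finsupp_def)

lemma finsupp_delta: "delta y \<in> finsupp" by (simp add: finsupp_def delta_def)

lemma finsupp_if_dominated: "g \<in> finsupp \<Longrightarrow> (\<And>x. \<bar>f x\<bar> \<le> \<bar>g x\<bar>) \<Longrightarrow> f \<in> finsupp"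
proof -
  assume g: "g \<in> finsupp" and le: "\<And>x. \<bar>f x\<bar> \<le> \<bar>g x\<bar>"
  have "{x. f x \<noteq> 0} \<subseteq> {x. g x \<noteq> 0}"
  proof clarify
    fix x assume "f x \<noteq> 0" "g x = 0" then show False using le[of x] by simp
  qed
  then show ?thesis using g finite_subset by (auto simp: finsupp_def)
qed

lemma finite_to_nat_less: "finite {x::'a::countable. to_nat x < n}"
  by (rule inj_on_finite[of to_nat _ "{..<n}"]) (auto intro: inj_onI)

lemma L2_count: "f \<in> L2 (count_space UNIV) \<longleftrightarrow> integrable (count_space UNIV) (\<lambda>k. (f k)\<^sup>2)"
  by (simp add: L2_def)

context weighted_graph
begin

lemma N_grad_le:
  assumes f: "f \<in> N" and g: "g \<in> N"
    and le: "\<And>k. (grad h k)\<^sup>2 \<le> \<alpha> * (grad f k)\<^sup>2 + \<beta> * (grad g k)\<^sup>2"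
  shows "h \<in> N" and "E h h \<le> \<alpha> * E f f + \<beta> * E g g"
proof -
  have I: "integrable (count_space UNIV) (\<lambda>k. \<alpha> * (grad f k)\<^sup>2 + \<beta> * (grad g k)\<^sup>2)"
    using f g by (auto simp: N_iff_grad L2_count)
  have J: "integrable (count_space UNIV) (\<lambda>k. (grad h k)\<^sup>2)"
    by (rule Bochner_Integration.integrable_bound[OF I]) (auto simp: AE_count_space intro: order_trans[OF le])
  then show hN: "h \<in> N" by (simp add: N_iff_grad L2_count)
  have "E h h = (\<integral>k. (grad h k)\<^sup>2 \<partial>count_space UNIV)"
    unfolding E_grad[OF hN hN] L2_inner_def by (simp add: power2_eq_square)
  also have "\<dots> \<le> (\<integral>k. \<alpha> * (grad f k)\<^sup>2 + \<beta> * (grad g k)\<^sup>2 \<partial>count_space UNIV)"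
    by (rule integral_mono[OF J I le])
  also have "\<dots> = \<alpha> * E f f + \<beta> * E g g"
    unfolding E_grad[OF f f] E_grad[OF g g] L2_inner_def using f g
    by (subst Bochner_Integration.integral_add) (auto simp: N_iff_grad L2_count power2_eq_square[symmetric])
  finally show "E h h \<le> \<alpha> * E f f + \<beta> * E g g" .
qed

lemma grad_dominated:
  assumes le: "\<And>x. \<bar>h x\<bar> \<le> \<bar>f x\<bar> + \<bar>g x\<bar>" and le2: "\<And>x y. \<bar>h x - h y\<bar> \<le> \<bar>f x - f y\<bar> + \<bar>g x - g y\<bar>"
  shows "\<bar>grad h k\<bar> \<le> \<bar>grad f k\<bar> + \<bar>grad g k\<bar>"
proof (cases k rule: index_cases)
  case (edge x y)
  then show ?thesis
    using mult_left_mono[OF le2[of x y], of "sqrt (b x y / 2)"] b_nonneg[of x y]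
    by (simp add: grad_simps abs_mult distrib_left)
next
  case (killing x)
  then show ?thesis
    using mult_left_mono[OF le[of x], of "sqrt (c x)"] c_nonneg[of x]
    by (simp add: grad_simps abs_mult distrib_left)
next
  case (mass x)
  then show ?thesis
    using mult_left_mono[OF le[of x], of "sqrt (m x)"] m_pos[of x]
    by (simp add: grad_simps abs_mult distrib_left)
qed

text \<open>
  Lipschitz operations on pairs of functions stay in the domain, with control of the norm. This covers
  products of bounded functions and the cut-offs used below.
\<close>

lemma N_dominated:
  assumes f: "f \<in> N" and g: "g \<in> N"
    and le: "\<And>x. \<bar>h x\<bar> \<le> \<bar>f x\<bar> + \<bar>g x\<bar>" and le2: "\<And>x y. \<bar>h x - h y\<bar> \<le> \<bar>f x - f y\<bar> + \<bar>g x - g y\<bar>"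
  shows "h \<in> N" and "E h h \<le> 2 * E f f + 2 * E g g"
proof -
  have "(grad h k)\<^sup>2 \<le> 2 * (grad f k)\<^sup>2 + 2 * (grad g k)\<^sup>2" for k
  proof -
    have "(grad h k)\<^sup>2 \<le> (\<bar>grad f k\<bar> + \<bar>grad g k\<bar>)\<^sup>2"
      using grad_dominated[where k = k, OF le le2] by (simp add: abs_le_square_iff[symmetric])
    also have "\<dots> \<le> 2 * (grad f k)\<^sup>2 + 2 * (grad g k)\<^sup>2"
      using sum_squares_bound[of "\<bar>grad f k\<bar>" "\<bar>grad g k\<bar>"] by (simp add: power2_sum)
    finally show ?thesis .
  qed
  from N_grad_le[OF f g this] show "h \<in> N" "E h h \<le> 2 * E f f + 2 * E g g" by auto
qed

lemma N_contraction:
  assumes f: "f \<in> N" and le: "\<And>x. \<bar>h x\<bar> \<le> \<bar>f x\<bar>" and le2: "\<And>x y. \<bar>h x - h y\<bar> \<le> \<bar>f x - f y\<bar>"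
  shows "h \<in> N" and "E h h \<le> E f f"
proof -
  have "\<bar>grad h k\<bar> \<le> \<bar>grad f k\<bar> + \<bar>grad (\<lambda>_. 0) k\<bar>" for k
    by (rule grad_dominated) (simp_all add: le le2)
  moreover have "grad (\<lambda>_. 0) k = 0" for k using grad_scale[where a = 0 and f = "\<lambda>_. 0"] by simp
  ultimately have "(grad h k)\<^sup>2 \<le> 1 * (grad f k)\<^sup>2 + 0 * (grad f k)\<^sup>2" for k
    by (simp add: abs_le_square_iff[symmetric])
  from N_grad_le[OF f f this] show "h \<in> N" "E h h \<le> E f f" by auto
qed

lemma markovian_QN: "markovian V (QN m b c)"
  unfolding markovian_def
proof (intro ballI allI impI)
  fix f :: "'a \<Rightarrow> real" and C :: "real \<Rightarrow> real" assume f: "f \<in> L2 V" and C: "normal_contraction C"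
  have C1: "\<bar>C s - C t\<bar> \<le> \<bar>s - t\<bar>" for s t using C by (simp add: normal_contraction_def)
  have C0: "\<bar>C s\<bar> \<le> \<bar>s\<bar>" for s using C C1[of s 0] by (simp add: normal_contraction_def)
  have sq1: "(C s - C t)\<^sup>2 \<le> (s - t)\<^sup>2" for s t using C1 by (simp add: abs_le_square_iff[symmetric])
  have sq0: "(C s)\<^sup>2 \<le> s\<^sup>2" for s using C0 by (simp add: abs_le_square_iff[symmetric])
  have "normsq V (\<lambda>x. C (f x)) \<le> normsq V f"
    unfolding normsq_vmeas
    by (intro nn_integral_mono ennreal_leI mult_left_mono sq0) (simp add: m_pos less_imp_le)
  then have L: "(\<lambda>x. C (f x)) \<in> L2 V" using f by (simp add: L2_vmeas le_less_trans)
  have "energy b c (\<lambda>x. C (f x)) \<le> energy b c f"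
    unfolding energy_def
    by (intro add_mono divide_right_mono_ennreal nn_integral_mono ennreal_leI mult_left_mono sq0 sq1 b_nonneg c_nonneg)
  then show "QN m b c (\<lambda>x. C (f x)) \<le> QN m b c f" using f L by (simp add: QN_def)
qed

subsection \<open>Finitely supported functions\<close>

lemma delta_mem: "delta y \<in> N"
proof -
  define s where "s = (\<integral>\<^sup>+z. ennreal (b y z) \<partial>count_space UNIV)"
  have "integrable (count_space UNIV) (b y)"
    using b_summable[of y] b_nonneg abs_summable_equivalent[of "b y" UNIV]
    by (simp add: Infinite_Set_Sum.abs_summable_on_def)
  then have s: "s < \<infinity>" unfolding s_def by (simp add: nn_integral_eq_integral b_nonneg)
  have pt: "(\<integral>\<^sup>+z. ennreal (u z) * indicator {y} z \<partial>count_space UNIV) = ennreal (u y)" for u :: "'a \<Rightarrow> real"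
    by (simp add: nn_integral_indicator_singleton)
  have in1: "(\<integral>\<^sup>+z. ennreal (b x z * (delta y x - delta y z)\<^sup>2) \<partial>count_space UNIV)
      \<le> ennreal (b y x) + s * indicator {y} x" for x
  proof (cases "x = y")
    case True
    have "(\<integral>\<^sup>+z. ennreal (b x z * (delta y x - delta y z)\<^sup>2) \<partial>count_space UNIV) \<le> s"
      unfolding s_def True using b_nonneg by (intro nn_integral_mono ennreal_leI) (auto simp: delta_def)
    then show ?thesis using True by simp (metis add_increasing zero_le)
  next
    case False
    have "(\<integral>\<^sup>+z. ennreal (b x z * (delta y x - delta y z)\<^sup>2) \<partial>count_space UNIV)
       = (\<integral>\<^sup>+z. ennreal (b x z) * indicator {y} z \<partial>count_space UNIV)"
      using False by (intro nn_integral_cong) (auto simp: delta_def indicator_def)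
    then show ?thesis using False pt b_sym[of x y] by simp
  qed
  have "(\<integral>\<^sup>+x. \<integral>\<^sup>+z. ennreal (b x z * (delta y x - delta y z)\<^sup>2) \<partial>count_space UNIV \<partial>count_space UNIV)
     \<le> (\<integral>\<^sup>+x. ennreal (b y x) + s * indicator {y} x \<partial>count_space UNIV)"
    by (intro nn_integral_mono in1)
  also have "\<dots> = s + s"
    by (subst nn_integral_add) (auto simp: s_def[symmetric] nn_integral_cmult_indicator)
  also have "\<dots> < \<infinity>" using s by simp
  finally have 1: "(\<integral>\<^sup>+x. \<integral>\<^sup>+z. ennreal (b x z * (delta y x - delta y z)\<^sup>2) \<partial>count_space UNIV \<partial>count_space UNIV) < \<infinity>" .
  have 2: "(\<integral>\<^sup>+x. ennreal (u x * (delta y x)\<^sup>2) \<partial>count_space UNIV) < \<infinity>" for u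
  proof -
    have "(\<integral>\<^sup>+x. ennreal (u x * (delta y x)\<^sup>2) \<partial>count_space UNIV) = (\<integral>\<^sup>+x. ennreal (u x) * indicator {y} x \<partial>count_space UNIV)"
      by (intro nn_integral_cong) (auto simp: delta_def indicator_def)
    then show ?thesis using pt[of u] by simp
  qed
  have "energy b c (delta y) < \<infinity>" "normsq V (delta y) < \<infinity>"
    unfolding energy_def normsq_vmeas using 1 2[of c] 2[of m]
    by (auto simp: ennreal_divide_eq_top_iff less_top[symmetric])
  then show ?thesis by (simp add: form_dom_def QN_def L2_vmeas)
qed

lemma finsupp_N: "finsupp \<subseteq> N"
proof
  fix f :: "'a \<Rightarrow> real" assume "f \<in> finsupp"
  then show "f \<in> N" by (induction rule: finsupp_induct) (auto intro: zero_mem lincomb_mem delta_mem)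
qed

subsection \<open>Green's formula\<close>

lemma L2_inner_has_sum:
  assumes "f \<in> L2 (count_space UNIV)" "g \<in> L2 (count_space UNIV)"
  shows "((\<lambda>k. f k * g k) has_sum L2_inner (count_space UNIV) f g) UNIV"
proof -
  have a: "Infinite_Set_Sum.abs_summable_on (\<lambda>k. f k * g k) UNIV"
    using L2_mult_integrable[OF assms] by (simp add: Infinite_Set_Sum.abs_summable_on_def)
  then have "(\<lambda>k. f k * g k) summable_on UNIV"
    using abs_summable_equivalent abs_summable_summable by blast
  then show ?thesis
    using infsetsum_infsum[OF a] by (simp add: L2_inner_def infsetsum_def)
qed

lemma edge_sq_summable:
  assumes "f \<in> N" shows "(\<lambda>z. b y z * (f y - f z)\<^sup>2) summable_on UNIV"
proof -
  have "(\<lambda>k. grad f k * grad f k) summable_on UNIV"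
    using L2_inner_has_sum[of "grad f" "grad f"] assms N_iff_grad has_sum_imp_summable by blast
  then have "(\<lambda>k. grad f k * grad f k) summable_on range (\<lambda>z. Inl (y, z))"
    using summable_on_subset_banach by blast
  then have "((\<lambda>k. grad f k * grad f k) \<circ> (\<lambda>z. Inl (y, z))) summable_on UNIV"
    by (subst (asm) summable_on_reindex) (auto intro: injI)
  moreover have "((\<lambda>k. grad f k * grad f k) \<circ> (\<lambda>z. Inl (y, z))) = (\<lambda>z. b y z * (f y - f z)\<^sup>2 * (1/2))"
    by (auto simp: grad_sq power2_eq_square[symmetric])
  ultimately show ?thesis using summable_on_cmult_left[of _ UNIV 2] by fastforce
qed

lemma edge_abs_summable:
  assumes "f \<in> N" shows "(\<lambda>z. b y z * \<bar>f y - f z\<bar>) summable_on UNIV"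
proof (rule summable_on_comparison_test)
  show "(\<lambda>z. b y z + b y z * (f y - f z)\<^sup>2) summable_on UNIV"
    by (intro summable_on_add b_summable edge_sq_summable assms)
  fix z
  have "\<bar>t\<bar> \<le> 1 + t\<^sup>2" for t :: real
    using sum_squares_bound[of 1 "\<bar>t\<bar>"] by (simp; argo)
  from mult_left_mono[OF this b_nonneg]
  show "b y z * \<bar>f y - f z\<bar> \<le> b y z + b y z * (f y - f z)\<^sup>2" by (simp add: distrib_left)
qed (simp add: b_nonneg)

lemma edge_summable:
  assumes "f \<in> N" shows "(\<lambda>z. b y z * (f y - f z)) summable_on UNIV"
  using abs_summable_summable[of "\<lambda>z. b y z * (f y - f z)" UNIV] edge_abs_summable[OF assms, of y]
  by (simp add: abs_mult b_nonneg)

lemma N_laplace_dom: "N \<subseteq> laplace_dom b"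
proof
  fix f assume f: "f \<in> N"
  have "(\<lambda>z. b y z * \<bar>f z\<bar>) summable_on UNIV" for y
  proof (rule summable_on_comparison_test)
    show "(\<lambda>z. b y z * \<bar>f y\<bar> + b y z * \<bar>f y - f z\<bar>) summable_on UNIV"
      by (intro summable_on_add summable_on_cmult_left b_summable edge_abs_summable f)
    fix z
    have "\<bar>f z\<bar> \<le> \<bar>f y\<bar> + \<bar>f y - f z\<bar>" by argo
    from mult_left_mono[OF this b_nonneg]
    show "b y z * \<bar>f z\<bar> \<le> b y z * \<bar>f y\<bar> + b y z * \<bar>f y - f z\<bar>" by (simp add: distrib_left)
  qed (simp add: b_nonneg)
  then show "f \<in> laplace_dom b" by (simp add: laplace_dom_def)
qed

lemma has_sum_extend:
  assumes "inj h" and "((\<lambda>z. g (h z)) has_sum s) UNIV" and "\<And>k. k \<notin> range h \<Longrightarrow> g k = 0"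
  shows "(g has_sum s) UNIV"
proof -
  have "(g has_sum s) (range h)"
    using assms(2) by (subst has_sum_reindex) (auto simp: assms(1) comp_def)
  then show ?thesis
    using has_sum_cong_neutral[of UNIV "range h" g g s] assms(3) by simp
qed

text \<open>
  Only the pairs \<open>(y,z)\<close> and \<open>(z,y)\<close> contribute, and by symmetry they contribute equally; the functions
  \<open>A\<close>, \<open>A'\<close> and \<open>A''\<close> in the proof collect the former, the latter and the killing and measure terms.
\<close>

lemma Green:
  assumes f: "f \<in> N"
  shows "E f (delta y) = (m y + c y) * f y + (\<Sum>\<^sub>\<infinity>z. b y z * (f y - f z))"
proof -
  define s where "s = (\<Sum>\<^sub>\<infinity>z. b y z * (f y - f z))"
  have s: "((\<lambda>z. b y z * (f y - f z)) has_sum s) UNIV"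
    unfolding s_def using edge_summable[OF f] by simp
  then have s2: "((\<lambda>z. 1/2 * (b y z * (f y - f z))) has_sum 1/2 * s) UNIV"
    by (rule has_sum_cmult_right)
  define A where "A k = (case k of Inl (x, z) \<Rightarrow> if x = y then b x z / 2 * (f x - f z) else 0 | Inr _ \<Rightarrow> 0)"
    for k :: "('a \<times> 'a) + ('a + 'a)"
  define A' where "A' k = (case k of Inl (x, z) \<Rightarrow> if z = y then b x z / 2 * (f z - f x) else 0 | Inr _ \<Rightarrow> 0)"
    for k :: "('a \<times> 'a) + ('a + 'a)"
  define A'' where "A'' k = (if k = Inr (Inl y) then c y * f y else if k = Inr (Inr y) then m y * f y else 0)"
    for k :: "('a \<times> 'a) + ('a + 'a)"
  have hA: "(A has_sum 1/2 * s) UNIV"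
  proof (rule has_sum_extend[where h = "\<lambda>z. Inl (y, z)"])
    show "((\<lambda>z. A (Inl (y, z))) has_sum 1/2 * s) UNIV" using s2 by (simp add: A_def)
    show "A k = 0" if "k \<notin> range (\<lambda>z. Inl (y, z))" for k
      using that by (cases k rule: index_cases) (auto simp: A_def)
  qed (auto intro: injI)
  have hA': "(A' has_sum 1/2 * s) UNIV"
  proof (rule has_sum_extend[where h = "\<lambda>z. Inl (z, y)"])
    show "((\<lambda>z. A' (Inl (z, y))) has_sum 1/2 * s) UNIV" using s2 by (simp add: A'_def b_sym[of _ y])
    show "A' k = 0" if "k \<notin> range (\<lambda>z. Inl (z, y))" for k
      using that by (cases k rule: index_cases) (auto simp: A'_def)
  qed (auto intro: injI)
  have "(A'' has_sum (c y * f y + m y * f y)) {Inr (Inl y), Inr (Inr y)}"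
    by (rule has_sum_finiteI) (auto simp: A''_def)
  moreover have "(A'' has_sum (c y * f y + m y * f y)) {Inr (Inl y), Inr (Inr y)}
      \<longleftrightarrow> (A'' has_sum (c y * f y + m y * f y)) UNIV"
    by (rule has_sum_cong_neutral) (auto simp: A''_def)
  ultimately have hA'': "(A'' has_sum (c y * f y + m y * f y)) UNIV" by simp
  have "((\<lambda>k. A k + A' k + A'' k) has_sum (1/2 * s + 1/2 * s + (c y * f y + m y * f y))) UNIV"
    by (intro has_sum_add hA hA' hA'')
  moreover have "grad f k * grad (delta y) k = A k + A' k + A'' k" for k
  proof (cases k rule: index_cases)
    case (edge x z)
    have "grad f k * grad (delta y) k
        = (sqrt (b x z / 2) * sqrt (b x z / 2)) * ((f x - f z) * (delta y x - delta y z))"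
      unfolding edge grad_simps by (simp only: mult_ac)
    also have "sqrt (b x z / 2) * sqrt (b x z / 2) = b x z / 2" using b_nonneg[of x z] by simp
    finally show ?thesis by (auto simp: edge A_def A'_def A''_def delta_def algebra_simps)
  next
    case (killing x)
    then show ?thesis using c_nonneg[of x] by (auto simp: grad_simps A_def A'_def A''_def delta_def)
  next
    case (mass x)
    then show ?thesis using m_pos[of x] by (auto simp: grad_simps A_def A'_def A''_def delta_def)
  qed
  ultimately have "((\<lambda>k. grad f k * grad (delta y) k) has_sum (s + (c y * f y + m y * f y))) UNIV"
    by simp
  moreover have "((\<lambda>k. grad f k * grad (delta y) k) has_sum E f (delta y)) UNIV"
    unfolding E_grad[OF f delta_mem] using f delta_mem N_iff_grad by (intro L2_inner_has_sum) auto
  ultimately have "E f (delta y) = s + (c y * f y + m y * f y)" using has_sum_unique by blast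
  then show ?thesis unfolding s_def by (simp add: algebra_simps)
qed

text \<open>
  Green's formula says that \<open>m(y) (L + 1) f(y)\<close> is the \<open>Q\<^sup>N\<^sub>1\<close>-product of \<open>f\<close> with the point mass at \<open>y\<close>.
\<close>

lemma harmonic1_iff_delta: "f \<in> N \<Longrightarrow> harmonic1 m b c f \<longleftrightarrow> (\<forall>y. E f (delta y) = 0)"
proof -
  assume f: "f \<in> N"
  have "m y * (laplace m b c f y + f y) = E f (delta y)" for y
    unfolding Green[OF f] laplace_def using m_pos[of y] by (simp add: field_simps)
  then have "laplace m b c f y + f y = 0 \<longleftrightarrow> E f (delta y) = 0" for y
    using m_pos[of y] by (metis less_numeral_extra(3) mult_eq_0_iff)
  then show ?thesis using N_laplace_dom f by (auto simp: harmonic1_def)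
qed

subsection \<open>The closure of the finitely supported functions\<close>

lemma domD_closure: "domD m b c = closure_of_subspace finsupp"
proof -
  have "(\<forall>e>0. \<exists>g\<in>finsupp. N1 (f \<ominus> g) < e) \<longleftrightarrow> (\<forall>e>0. \<exists>g\<in>finsupp. quad E (f \<ominus> g) < e)" if f: "f \<in> N" for f
  proof -
    have "N1 (f \<ominus> g) < ennreal r \<longleftrightarrow> quad E (f \<ominus> g) < r" if "g \<in> finsupp" for g r
      using N1_E[OF diff_mem[OF f]] nonneg[OF diff_mem[OF f]] finsupp_N that by (auto simp: ennreal_less_iff subset_iff)
    moreover have "(\<forall>e>0. \<exists>g\<in>finsupp. N1 (f \<ominus> g) < e) \<longleftrightarrow> (\<forall>r>0. \<exists>g\<in>finsupp. N1 (f \<ominus> g) < ennreal r)"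
      by (rule ennreal_all_pos_iff) (meson less_le_trans)
    ultimately show ?thesis by simp
  qed
  then show ?thesis unfolding domD_def closure_of_subspace_def by blast
qed

abbreviation "D0 \<equiv> domD m b c"

lemma D0_N: "f \<in> D0 \<Longrightarrow> f \<in> N" by (simp add: domD_def)

lemma finsupp_D0: "finsupp \<subseteq> D0"
  unfolding domD_closure by (rule subset_closure[OF finsupp_N])

lemma D0_lincomb: "\<lbrakk>f \<in> D0; g \<in> D0\<rbrakk> \<Longrightarrow> (\<lambda>x. f x + a * g x) \<in> D0"
  unfolding domD_closure by (rule closure_lincomb[OF finsupp_N finsupp_lincomb])

lemma D0_zero: "(\<lambda>_. 0) \<in> D0" using finsupp_D0 finsupp_zero by blast

lemma D0_add: "\<lbrakk>f \<in> D0; g \<in> D0\<rbrakk> \<Longrightarrow> (f \<oplus> g) \<in> D0" using D0_lincomb[of f g 1] by simp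

lemma D0_scale: "f \<in> D0 \<Longrightarrow> (\<lambda>x. a * f x) \<in> D0" using D0_lincomb[OF D0_zero, of f a] by simp

lemma complete_D0: "complete_wrt E D0"
  unfolding domD_closure by (rule closure_complete[OF complete_N finsupp_N])

sublocale D0: inner_fun_space "domD m b c" E
  by (rule inner_fun_space_subspace[OF inner_fun_space_axioms]) (auto intro: D0_N D0_zero D0_add D0_scale)

lemma D0_pointwise_limit:
  assumes "\<And>n. F n \<in> D0" and "\<And>x. (\<lambda>n. F n x) \<longlonglongrightarrow> f x" and "\<And>n. quad E (F n) \<le> r"
  shows "f \<in> D0"
proof (rule D0.pointwise_limit(1)[OF complete_D0 _ assms tendsto_const])
  show "\<exists>k. \<forall>g\<in>D0. (g x)\<^sup>2 \<le> k * E g g" for x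
    using eval_bound[of x] D0_N by blast
qed

text \<open>
  Cut \<open>f\<close> off at the height of finitely supported approximations of \<open>g\<close>. The resulting functions are
  finitely supported, bounded in norm and converge pointwise to \<open>f\<close>, as \<open>f\<close> itself is not affected by
  the cut-off at height \<open>\<bar>g\<bar>\<close>.
\<close>

lemma D0_dominated:
  assumes f: "f \<in> N" and g: "g \<in> D0" and le: "\<And>x. \<bar>f x\<bar> \<le> \<bar>g x\<bar>"
  shows "f \<in> D0"
proof -
  have gN: "g \<in> N" using g D0_N by blast
  have "\<exists>h\<in>finsupp. quad E (g \<ominus> h) < inverse (real (Suc n))" for n
    using g unfolding domD_closure closure_of_subspace_def by simp
  then obtain h where h: "\<And>n. h n \<in> finsupp"
    and hE: "\<And>n. quad E (g \<ominus> h n) < inverse (real (Suc n))" by metis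
  have hN: "h n \<in> N" for n using h finsupp_N by blast
  have hE': "quad E (h n \<ominus> g) < inverse (real (Suc n))" for n
    using hE[of n] norm_diff[OF gN hN[of n]] norm_diff[OF hN[of n] gN] sym[OF gN hN[of n]] by simp
  have "(\<lambda>n. quad E (h n \<ominus> g)) \<longlonglongrightarrow> 0"
    by (rule null_sequence_le[OF LIMSEQ_inverse_real_of_nat nonneg[OF diff_mem[OF hN gN]], of _ 1])
      (simp add: less_imp_le[OF hE'] del: of_nat_Suc)
  note hE0 = this
  have hlim: "(\<lambda>n. h n x) \<longlonglongrightarrow> g x" for x
  proof -
    obtain k where k: "\<And>g. g \<in> N \<Longrightarrow> (g x)\<^sup>2 \<le> k * E g g" using eval_bound by blast
    show ?thesis by (rule eval_tendsto[OF k hN gN hE0])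
  qed
  have hb: "quad E (h n) \<le> 2 * E g g + 2" for n
  proof -
    have "quad E (\<lambda>x. (h n x - g x) + g x)
        \<le> 2 * quad E (h n \<ominus> g) + 2 * E g g"
      by (rule norm_add_le[OF diff_mem[OF hN gN] gN])
    moreover have "inverse (real (Suc n)) \<le> 1" by (simp add: field_simps)
    ultimately show ?thesis using hE'[of n] by simp
  qed
  define F where "F n x = max (- \<bar>h n x\<bar>) (min (f x) \<bar>h n x\<bar>)" for n x
  have "\<bar>F n x\<bar> \<le> \<bar>h n x\<bar>" for n x by (auto simp: F_def)
  then have "F n \<in> finsupp" for n using finsupp_if_dominated[OF h] by blast
  then have 1: "F n \<in> D0" for n using finsupp_D0 by blast
  have 2: "(\<lambda>n. F n x) \<longlonglongrightarrow> f x" for x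
  proof -
    have "(\<lambda>n. F n x) \<longlonglongrightarrow> max (- \<bar>g x\<bar>) (min (f x) \<bar>g x\<bar>)"
      unfolding F_def by (intro tendsto_intros hlim)
    moreover have "max (- \<bar>g x\<bar>) (min (f x) \<bar>g x\<bar>) = f x" using le[of x] by (auto simp: max_def min_def)
    ultimately show ?thesis by simp
  qed
  have 3: "quad E (F n) \<le> 2 * E f f + 2 * (2 * E g g + 2)" for n
  proof -
    have "quad E (F n) \<le> 2 * E f f + 2 * quad E (h n)"
    proof (rule N_dominated(2)[OF f hN[of n]])
      fix x y
      show "\<bar>F n x\<bar> \<le> \<bar>f x\<bar> + \<bar>h n x\<bar>" by (auto simp: F_def max_def min_def abs_if)
      show "\<bar>F n x - F n y\<bar> \<le> \<bar>f x - f y\<bar> + \<bar>h n x - h n y\<bar>"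
        unfolding F_def by (auto simp: max_def min_def abs_if)
    qed
    then show ?thesis using hb[of n] by simp
  qed
  show ?thesis by (rule D0_pointwise_limit[OF 1 2 3])
qed

lemma N_normal_contraction:
  assumes "f \<in> N" "normal_contraction C"
  shows "(\<lambda>x. C (f x)) \<in> N" and "quad E (\<lambda>x. C (f x)) \<le> E f f"
  using N_contraction[OF assms(1), of "\<lambda>x. C (f x)"] normal_contraction_abs_le[OF assms(2)] assms(2)
  by (auto simp: normal_contraction_def)

lemma D0_normal_contraction: "f \<in> D0 \<Longrightarrow> normal_contraction C \<Longrightarrow> (\<lambda>x. C (f x)) \<in> D0"
  using D0_dominated[OF N_normal_contraction(1)] D0_N normal_contraction_abs_le by blast

lemma QD_eq_QN: "f \<in> D0 \<Longrightarrow> QD m b c f = QN m b c f"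
  using D0_N form_dom_L2[OF quadratic_form_QN] by (simp add: QD_def QN_def)

lemma form_dom_QD: "form_dom (QD m b c) = D0"
proof -
  have "QD m b c f < \<infinity> \<longleftrightarrow> f \<in> D0" for f
  proof (cases "f \<in> D0")
    case True
    then show ?thesis using QD_eq_QN[OF True] D0_N[OF True] by (simp add: form_dom_def)
  qed (simp add: QD_def)
  then show ?thesis by (auto simp: form_dom_def)
qed

lemma form1_QD: "f \<in> D0 \<Longrightarrow> form1 V (QD m b c) f = N1 f"
  by (simp add: form1_def QD_eq_QN)

lemma quadratic_form_QD: "quadratic_form V (QD m b c)"
proof (rule quadratic_form_if_form1)
  show "QD m b c f = \<infinity>" if "f \<notin> L2 V" for f
    using that D0_N form_dom_L2[OF quadratic_form_QN] by (auto simp: QD_def)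
  show "QD m b c f = QD m b c g" if "AE x in V. f x = g x" for f g
  proof -
    have "f = g" using that AE_vmeas by auto
    then show ?thesis by simp
  qed
  show "inner_fun_space (form_dom (QD m b c)) E" unfolding form_dom_QD by (rule D0.inner_fun_space_axioms)
  show "form1 V (QD m b c) f = ennreal (E f f)" if "f \<in> form_dom (QD m b c)" for f
    using that form1_QD N1_E D0_N by (simp add: form_dom_QD)
qed

lemma polar_form1_QD: "\<lbrakk>f \<in> D0; g \<in> D0\<rbrakk> \<Longrightarrow> polar (form1 V (QD m b c)) f g = E f g"
proof (rule polar_unique)
  note dom = form_dom_form1[OF quadratic_form_QD, unfolded form_dom_QD]
  show "inner_fun_space (form_dom (form1 V (QD m b c))) E" unfolding dom by (rule D0.inner_fun_space_axioms)
  show "form1 V (QD m b c) f = ennreal (E f f)" if "f \<in> form_dom (form1 V (QD m b c))" for f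
    using that form1_QD N1_E D0_N by (simp add: dom)
qed (simp_all add: form_dom_form1[OF quadratic_form_QD] form_dom_QD)

lemma closed_form_QN: "closed_form V (QN m b c)"
  using closed_form_iff_complete[OF quadratic_form_QN] complete_N by simp

lemma closed_form_QD: "closed_form V (QD m b c)"
  unfolding closed_form_iff_complete[OF quadratic_form_QD] form_dom_QD
  by (rule complete_wrt_cong[OF complete_D0 D0.diff_mem]) (auto simp: polar_form1_QD D0.nonneg)

lemma markovian_QD: "markovian V (QD m b c)"
  unfolding markovian_def
proof (intro ballI allI impI)
  fix f :: "'a \<Rightarrow> real" and C :: "real \<Rightarrow> real" assume f: "f \<in> L2 V" and C: "normal_contraction C"
  show "QD m b c (\<lambda>x. C (f x)) \<le> QD m b c f"
  proof (cases "f \<in> D0")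
    case True
    then show ?thesis
      using QD_eq_QN D0_normal_contraction[OF True C] markovian_QN f C by (simp add: markovian_def)
  qed (simp add: QD_def)
qed

subsection \<open>The Royden decomposition\<close>

lemma harmonic_orthogonal:
  assumes "f \<in> N" "harmonic1 m b c f" "g \<in> D0"
  shows "E f g = 0"
proof (rule orthogonal_closure[OF finsupp_N assms(1)])
  fix h :: "'a \<Rightarrow> real" assume "h \<in> finsupp"
  then show "E f h = 0"
  proof (induction rule: finsupp_induct)
    case zero
    then show ?case using scale_right[OF zero_mem assms(1), of 0] by simp
  next
    case (add g y a)
    then have "g \<in> N" using finsupp_N by blast
    then show ?case
      using add_right[OF _ scale_mem[OF delta_mem] assms(1), of g a y] scale_right[OF delta_mem assms(1), of a y]
        add.IH harmonic1_iff_delta[OF assms(1)] assms(2) by simp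
  qed
qed (use assms(3) domD_closure in simp)

lemma harmonic1_diff:
  assumes "f \<in> N" "g \<in> N" "harmonic1 m b c f" "harmonic1 m b c g"
  shows "harmonic1 m b c (f \<ominus> g)"
  using assms harmonic1_iff_delta[OF diff_mem[OF assms(1,2)]] diff_left[OF assms(1,2) delta_mem]
    harmonic1_iff_delta[OF assms(1)] harmonic1_iff_delta[OF assms(2)] by simp

lemma harmonic_D0_zero: "f \<in> D0 \<Longrightarrow> harmonic1 m b c f \<Longrightarrow> f x = 0"
  using harmonic_orthogonal[of f f] E_eq_0[of f x] D0_N by blast

lemma royden_unique:
  assumes "f \<in> N" "f0 \<in> D0" "harmonic1 m b c (f \<ominus> f0)"
  shows "royden0 m b c f = f0"
  unfolding royden0_def form_dom_QD
proof (rule the_equality)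
  show "f0 \<in> D0 \<and> (f \<ominus> f0) \<in> N \<and> harmonic1 m b c (f \<ominus> f0)"
    using assms diff_mem D0_N by blast
  fix g assume g: "g \<in> D0 \<and> (f \<ominus> g) \<in> N \<and> harmonic1 m b c (f \<ominus> g)"
  have "harmonic1 m b c (\<lambda>x. (f x - g x) - (f x - f0 x))"
    using g by (intro harmonic1_diff[OF _ diff_mem[OF assms(1) D0_N[OF assms(2)]] _ assms(3)]) auto
  then have "harmonic1 m b c (f0 \<ominus> g)" by simp
  then have "f0 x - g x = 0" for x using harmonic_D0_zero[OF D0.diff_mem] g assms(2) by blast
  then show "g = f0" by (simp add: fun_eq_iff)
qed

definition harm :: "('a \<Rightarrow> real) \<Rightarrow> 'a \<Rightarrow> real" where
  "harm f x = f x - royden0 m b c f x"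

lemma royden:
  assumes f: "f \<in> N"
  shows royden0_D0: "royden0 m b c f \<in> D0" and harm_N: "harm f \<in> N" and harmonic_harm: "harmonic1 m b c (harm f)"
proof -
  obtain f0 where f0: "f0 \<in> D0" and orth: "\<And>u. u \<in> D0 \<Longrightarrow> E (f \<ominus> f0) u = 0"
    using orthogonal_projection[OF _ complete_D0 D0_zero D0_lincomb f] D0_N by blast
  have N: "(f \<ominus> f0) \<in> N" using f f0 D0_N diff_mem by blast
  have h: "harmonic1 m b c (f \<ominus> f0)"
    using orth[OF subsetD[OF finsupp_D0 finsupp_delta]] harmonic1_iff_delta[OF N] by blast
  have r: "royden0 m b c f = f0" by (rule royden_unique[OF f f0 h])
  show "royden0 m b c f \<in> D0" "harm f \<in> N" "harmonic1 m b c (harm f)"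
    using f0 N h by (simp_all add: r harm_def[abs_def])
qed

lemma harm_cong:
  assumes "f \<in> N" "g \<in> N" "(f \<ominus> g) \<in> D0"
  shows "harm f = harm g"
proof -
  have "(\<lambda>x. royden0 m b c g x + 1 * (f x - g x)) \<in> D0"
    by (intro D0_lincomb royden0_D0 assms)
  moreover have "harmonic1 m b c (\<lambda>x. f x - (royden0 m b c g x + 1 * (f x - g x)))"
    using harmonic_harm[OF assms(2)] by (simp add: harm_def[abs_def])
  ultimately have "royden0 m b c f = (\<lambda>x. royden0 m b c g x + 1 * (f x - g x))"
    by (rule royden_unique[OF assms(1)])
  then show ?thesis by (auto simp: harm_def)
qed

lemma harm_harmonic: "f \<in> N \<Longrightarrow> harmonic1 m b c f \<Longrightarrow> harm f = f"
  using royden_unique[of f "\<lambda>_. 0"] D0_zero by (auto simp: harm_def)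

lemma E_royden:
  assumes f: "f \<in> N"
  shows "E f f = quad E (royden0 m b c f) + quad E (harm f)"
proof -
  note 0 = royden0_D0[OF f]
  have "quad E (harm f \<oplus> royden0 m b c f)
     = quad E (harm f) + quad E (royden0 m b c f)"
    using norm_add[OF harm_N[OF f] D0_N[OF 0]] harmonic_orthogonal[OF harm_N[OF f] harmonic_harm[OF f] 0] by simp
  then show ?thesis by (simp add: harm_def)
qed

lemma E_harm_le: "f \<in> N \<Longrightarrow> quad E (harm f) \<le> E f f"
  using E_royden nonneg[OF D0_N[OF royden0_D0]] by simp

text \<open>
  A function that minimises the norm among its translates by a subspace is fixed by every contraction
  that moves it inside that subspace.
\<close>

lemma contraction_fixes:
  assumes u: "u \<in> N" and C: "normal_contraction C" and orth: "E u (\<lambda>x. C (u x) - u x) = 0"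
  shows "C (u x) = u x"
proof -
  note CN = N_normal_contraction[OF u C]
  have w: "(\<lambda>x. C (u x) - u x) \<in> N" by (rule diff_mem[OF CN(1) u])
  have "quad E (\<lambda>x. u x + (C (u x) - u x)) =
     E u u + quad E (\<lambda>x. C (u x) - u x)"
    using norm_add[OF u w] orth by simp
  then have "quad E (\<lambda>x. C (u x) - u x) = 0"
    using CN(2) nonneg[OF w] by simp
  from E_eq_0[OF w this, of x] show ?thesis by simp
qed

text \<open>
  The harmonic part minimises the norm in \<open>f + D\<^sup>D\<close>. Clipping at height \<open>r\<close> fixes \<open>f\<close>, so the clipped
  harmonic part differs from \<open>f\<close> by at most \<open>\<bar>royden0 f\<bar>\<close> and stays in this class.
\<close>

lemma harm_bounded:
  assumes f: "f \<in> N" and le: "\<And>x. \<bar>f x\<bar> \<le> r"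
  shows "\<bar>harm f x\<bar> \<le> r"
proof -
  have r: "0 \<le> r" using le[of x] by simp
  let ?C = "clip r"
  note C = normal_contraction_clip[OF r]
  note h = harm_N[OF f]
  have Cf: "?C (f x) = f x" for x by (rule clip_eq_self[OF le])
  have "(\<lambda>x. ?C (harm f x) - f x) \<in> D0"
  proof (rule D0_dominated[OF diff_mem[OF N_normal_contraction(1)[OF h C] f] royden0_D0[OF f]])
    fix x
    have "\<bar>?C (harm f x) - ?C (f x)\<bar> \<le> \<bar>harm f x - f x\<bar>" using C unfolding normal_contraction_def by blast
    then show "\<bar>?C (harm f x) - f x\<bar> \<le> \<bar>royden0 m b c f x\<bar>" unfolding Cf by (simp add: harm_def)
  qed
  from D0_add[OF this royden0_D0[OF f]]
  have "(\<lambda>x. ?C (harm f x) - harm f x) \<in> D0" by (simp add: harm_def algebra_simps)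
  then have "?C (harm f x) = harm f x"
    by (intro contraction_fixes[OF h C] harmonic_orthogonal[OF h harmonic_harm[OF f]])
  moreover have "\<bar>?C (harm f x)\<bar> \<le> r" by (rule abs_clip_le[OF r])
  ultimately show ?thesis by simp
qed

end

section \<open>Excess of a form over the Neumann form\<close>

context inner_fun_space
begin

lemma sum_mem: "finite I \<Longrightarrow> (\<And>i. i \<in> I \<Longrightarrow> u i \<in> D) \<Longrightarrow> (\<lambda>x. \<Sum>i\<in>I. a i * u i x) \<in> D"
  by (induction I rule: finite_induct) (simp_all add: zero_mem add_mem scale_mem)

lemma sum_left:
  assumes "finite I" "\<And>i. i \<in> I \<Longrightarrow> u i \<in> D" and h: "h \<in> D"
  shows "B (\<lambda>x. \<Sum>i\<in>I. a i * u i x) h = (\<Sum>i\<in>I. a i * B (u i) h)"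
  using assms(1,2)
proof (induction I rule: finite_induct)
  case empty
  then show ?case using scale_left[OF zero_mem h, of 0] by simp
next
  case (insert i I)
  then have "B (\<lambda>x. a i * u i x + (\<Sum>i\<in>I. a i * u i x)) h
      = B (\<lambda>x. a i * u i x) h + B (\<lambda>x. \<Sum>i\<in>I. a i * u i x) h"
    by (intro add_left scale_mem sum_mem h) auto
  then show ?case using insert scale_left[OF _ h, of "u i" "a i"] by simp
qed

end

text \<open>
  A quadratic form on a finite set is a sum of jump terms with weights \<open>- A x y\<close> and killing terms
  whose weights are the row sums. It is decreased by all normal contractions as soon as the
  off-diagonal weights and the row sums have the right signs.
\<close>

lemma finite_form_decomposition:
  fixes A :: "'a \<Rightarrow> 'a \<Rightarrow> real"
  assumes sym: "\<And>x y. \<lbrakk>x \<in> F; y \<in> F\<rbrakk> \<Longrightarrow> A x y = A y x"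
  shows "(\<Sum>x\<in>F. \<Sum>y\<in>F. g x * g y * A x y)
    = (\<Sum>x\<in>F. \<Sum>y\<in>F. (- A x y) * ((g x - g y)\<^sup>2 / 2)) + (\<Sum>y\<in>F. (\<Sum>x\<in>F. A x y) * (g y)\<^sup>2)"
proof -
  have 1: "(\<Sum>x\<in>F. \<Sum>y\<in>F. A x y * (g y)\<^sup>2) = (\<Sum>y\<in>F. (\<Sum>x\<in>F. A x y) * (g y)\<^sup>2)"
    by (subst sum.swap) (simp add: sum_distrib_right)
  have "(\<Sum>x\<in>F. \<Sum>y\<in>F. A x y * (g x)\<^sup>2) = (\<Sum>x\<in>F. \<Sum>y\<in>F. A y x * (g x)\<^sup>2)"
    by (intro sum.cong refl) (use sym in auto)
  also have "\<dots> = (\<Sum>x\<in>F. \<Sum>y\<in>F. A x y * (g y)\<^sup>2)" by (rule sum.swap)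
  finally have 2: "(\<Sum>x\<in>F. \<Sum>y\<in>F. A x y * (g x)\<^sup>2) = (\<Sum>y\<in>F. (\<Sum>x\<in>F. A x y) * (g y)\<^sup>2)" using 1 by simp
  have "(\<Sum>x\<in>F. \<Sum>y\<in>F. (- A x y) * ((g x - g y)\<^sup>2 / 2))
     = (\<Sum>x\<in>F. \<Sum>y\<in>F. g x * g y * A x y - (1/2) * (A x y * (g x)\<^sup>2) - (1/2) * (A x y * (g y)\<^sup>2))"
    by (intro sum.cong refl) (simp add: power2_eq_square field_simps)
  also have "\<dots> = (\<Sum>x\<in>F. \<Sum>y\<in>F. g x * g y * A x y) - (1/2) * (\<Sum>x\<in>F. \<Sum>y\<in>F. A x y * (g x)\<^sup>2)
      - (1/2) * (\<Sum>x\<in>F. \<Sum>y\<in>F. A x y * (g y)\<^sup>2)"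
    by (simp add: sum_subtractf sum_distrib_left)
  finally show ?thesis using 1 2 by simp
qed

locale graph_form = weighted_graph +
  fixes Q :: "'a qform"
  assumes quadratic: "quadratic_form (vmeas m) Q" and closed: "closed_form (vmeas m) Q"
    and markov: "markovian (vmeas m) Q" and finsupp_dom: "finsupp \<subseteq> form_dom Q"
begin

abbreviation "D \<equiv> form_dom Q"
abbreviation "B \<equiv> polar (form1 (vmeas m) Q)"

sublocale Q: inner_fun_space "form_dom Q" "polar (form1 (vmeas m) Q)"
  using quadratic_formD(3)[OF quadratic_form1[OF quadratic]] form_dom_form1[OF quadratic] by simp

lemma form1_B: "f \<in> D \<Longrightarrow> form1 V Q f = ennreal (B f f)"
  using quadratic_formD(4)[OF quadratic_form1[OF quadratic]] form_dom_form1[OF quadratic] by simp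

lemma complete_D: "complete_wrt B D"
  using closed closed_form_iff_complete[OF quadratic] by simp

lemma B_point_bound: "f \<in> D \<Longrightarrow> m x * (f x)\<^sup>2 \<le> B f f"
proof -
  assume f: "f \<in> D"
  have "ennreal (m x * (f x)\<^sup>2) \<le> normsq V f"
    unfolding normsq_vmeas using nn_integral_ge_point[of x UNIV "\<lambda>x. ennreal (m x * (f x)\<^sup>2)"] by simp
  also have "\<dots> \<le> form1 V Q f" by (simp add: form1_def)
  finally show ?thesis using form1_B[OF f] Q.nonneg[OF f] by simp
qed

lemma B_eval_bound: "\<exists>k. \<forall>g\<in>D. (g x)\<^sup>2 \<le> k * B g g"
proof (intro exI ballI)
  fix g assume "g \<in> D"
  from B_point_bound[OF this, of x] show "(g x)\<^sup>2 \<le> (1 / m x) * B g g"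
    using m_pos[of x] by (simp add: field_simps)
qed

lemma B_eq_0: "f \<in> D \<Longrightarrow> B f f = 0 \<Longrightarrow> f x = 0"
proof -
  assume "f \<in> D" "B f f = 0"
  then have "m x * (f x)\<^sup>2 \<le> 0" using B_point_bound[of f x] by simp
  moreover have "0 \<le> m x * (f x)\<^sup>2" using m_pos[of x] by simp
  ultimately have "m x * (f x)\<^sup>2 = 0" by simp
  then show "f x = 0" using m_pos[of x] by simp
qed

lemma D_normal_contraction:
  assumes f: "f \<in> D" and C: "normal_contraction C"
  shows "(\<lambda>x. C (f x)) \<in> D" and "quad B (\<lambda>x. C (f x)) \<le> B f f"
proof -
  have L: "f \<in> L2 V" by (rule form_dom_L2[OF quadratic f])
  have le: "Q (\<lambda>x. C (f x)) \<le> Q f" using markov L C by (simp add: markovian_def)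
  then show CD: "(\<lambda>x. C (f x)) \<in> D" using f by (auto simp: form_dom_def intro: le_less_trans)
  have "normsq V (\<lambda>x. C (f x)) \<le> normsq V f"
    unfolding normsq_vmeas
    using normal_contraction_abs_le[OF C]
    by (intro nn_integral_mono ennreal_leI mult_left_mono) (auto simp: m_pos less_imp_le abs_le_square_iff[symmetric])
  then have "form1 V Q (\<lambda>x. C (f x)) \<le> form1 V Q f" using le unfolding form1_def by (rule add_mono[rotated])
  then show "quad B (\<lambda>x. C (f x)) \<le> B f f"
    using form1_B[OF f] form1_B[OF CD] Q.nonneg[OF f] by simp
qed

text \<open>
  Minimality of the norm among all functions with the same values on \<open>F\<close>, expressed by orthogonality.
\<close>

definition minimal_off :: "'a set \<Rightarrow> ('a \<Rightarrow> real) \<Rightarrow> bool" where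
  "minimal_off F u \<longleftrightarrow> u \<in> D \<and> (\<forall>v\<in>D. (\<forall>x\<in>F. v x = 0) \<longrightarrow> B u v = 0)"

lemma minimal_extension:
  assumes f: "f \<in> D"
  obtains u where "minimal_off F u" "\<And>x. x \<in> F \<Longrightarrow> u x = f x"
proof -
  let ?S = "{v \<in> D. \<forall>x\<in>F. v x = 0}"
  have comp: "complete_wrt B ?S"
  proof (rule complete_wrtI)
    fix G assume G: "\<And>n. G n \<in> ?S" and C: "Cauchy_wrt B G"
    have GD: "G n \<in> D" for n using G by auto
    obtain g where g: "g \<in> D" "(\<lambda>n. quad B (G n \<ominus> g)) \<longlonglongrightarrow> 0" using complete_wrtE[OF complete_D GD C] by blast
    have "g x = 0" if x: "x \<in> F" for x
    proof -
      obtain k where k: "\<And>h. h \<in> D \<Longrightarrow> (h x)\<^sup>2 \<le> k * B h h" using B_eval_bound by blast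
      have "(\<lambda>n. G n x) \<longlonglongrightarrow> g x" by (rule Q.eval_tendsto[OF k GD g])
      then show ?thesis using G x LIMSEQ_unique[of "\<lambda>_. 0", OF tendsto_const] by simp
    qed
    then show "\<exists>f\<in>?S. (\<lambda>n. quad B (G n \<ominus> f)) \<longlonglongrightarrow> 0"
      using g by blast
  qed
  obtain s where s: "s \<in> ?S" and orth: "\<And>u. u \<in> ?S \<Longrightarrow> B (f \<ominus> s) u = 0"
  proof (rule Q.orthogonal_projection[OF _ comp _ _ f])
    show "?S \<subseteq> D" by blast
    show "(\<lambda>_. 0) \<in> ?S" using Q.zero_mem by simp
    show "(\<lambda>x. u x + a * v x) \<in> ?S" if "u \<in> ?S" "v \<in> ?S" for u v a
      using that Q.lincomb_mem[of u v a] by simp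
  qed blast
  show ?thesis
  proof (rule that[of "\<lambda>x. f x - s x"])
    show "minimal_off F (f \<ominus> s)"
      unfolding minimal_off_def using s f orth Q.diff_mem[of f s] by blast
    show "f x - s x = f x" if "x \<in> F" for x using s that by simp
  qed
qed

text \<open>
  The contracted function competes with the minimiser, as it has the same values on \<open>F\<close>.
\<close>

lemma minimal_contraction:
  assumes u: "minimal_off F u" and C: "normal_contraction C" and fix_F: "\<And>x. x \<in> F \<Longrightarrow> C (u x) = u x"
  shows "C (u x) = u x"
proof -
  have uD: "u \<in> D" using u by (simp add: minimal_off_def)
  note CD = D_normal_contraction[OF uD C]
  have w: "(\<lambda>x. C (u x) - u x) \<in> D" by (rule Q.diff_mem[OF CD(1) uD])
  have "B u (\<lambda>x. C (u x) - u x) = 0" using u w fix_F by (simp add: minimal_off_def)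
  then have "quad B (\<lambda>x. u x + (C (u x) - u x)) =
     B u u + quad B (\<lambda>x. C (u x) - u x)"
    using Q.norm_add[OF uD w] by simp
  then have "quad B (\<lambda>x. C (u x) - u x) = 0"
    using CD(2) Q.nonneg[OF w] by simp
  from B_eq_0[OF w this, of x] show ?thesis by simp
qed

lemma minimal_unit_interval:
  assumes u: "minimal_off F u" and F: "\<And>x. x \<in> F \<Longrightarrow> 0 \<le> u x \<and> u x \<le> 1"
  shows "0 \<le> u x" and "u x \<le> 1"
proof -
  have "max 0 (min (u x) 1) = u x"
    by (rule minimal_contraction[OF u normal_contraction_unit]) (use F in \<open>auto simp: max_def min_def\<close>)
  then show "0 \<le> u x" "u x \<le> 1" by (auto simp: max_def min_def split: if_splits)
qed

lemma minimal_le: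
  assumes u: "minimal_off F u" and f: "f \<in> D" and eq: "\<And>x. x \<in> F \<Longrightarrow> u x = f x"
  shows "B u u \<le> B f f"
proof -
  have uD: "u \<in> D" using u by (simp add: minimal_off_def)
  have w: "(f \<ominus> u) \<in> D" by (rule Q.diff_mem[OF f uD])
  have "B u (f \<ominus> u) = 0" using u w eq by (simp add: minimal_off_def)
  then have "quad B (\<lambda>x. u x + (f x - u x)) = B u u + quad B (f \<ominus> u)"
    using Q.norm_add[OF uD w] by simp
  then show ?thesis using Q.nonneg[OF w] by simp
qed

end

text \<open>
  The forms between \<open>Q\<^sup>N\<close> and \<open>Q\<^sup>D\<close>: by the first inequality the domain of \<open>Q\<close> is contained in \<open>D\<^sup>N\<close>, by
  the second it contains \<open>D\<^sup>D\<close>, and on \<open>D\<^sup>D\<close> both inequalities together determine \<open>Q\<close>.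
\<close>

locale graph_form_extension = graph_form +
  assumes QN_le: "form_le (vmeas m) (QN m b c) Q" and le_QD: "form_le (vmeas m) Q (QD m b c)"
begin

lemma D_N: "f \<in> D \<Longrightarrow> f \<in> N"
  using QN_le form_dom_L2[OF quadratic] by (auto simp: form_le_def form_dom_def intro: le_less_trans)

lemma D0_D: "f \<in> D0 \<Longrightarrow> f \<in> D"
  using le_QD form_dom_QD form_dom_L2[OF quadratic_form_QD] by (auto simp: form_le_def form_dom_def intro: le_less_trans)

lemma Q_eq_QN: "f \<in> D0 \<Longrightarrow> Q f = QN m b c f"
proof (rule antisym)
  assume f: "f \<in> D0"
  have L: "f \<in> L2 V" using f form_dom_L2[OF quadratic D0_D] by blast
  show "Q f \<le> QN m b c f" using le_QD L QD_eq_QN[OF f] by (auto simp: form_le_def)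
  show "QN m b c f \<le> Q f" using QN_le L by (auto simp: form_le_def)
qed

lemma E_le_B: "f \<in> D \<Longrightarrow> E f f \<le> B f f"
proof -
  assume f: "f \<in> D"
  have "N1 f \<le> form1 V Q f"
    using QN_le form_dom_L2[OF quadratic f] by (simp add: form1_def form_le_def add_right_mono)
  then show ?thesis using N1_E[OF D_N[OF f]] form1_B[OF f] Q.nonneg[OF f] by simp
qed

lemma inner_fun_space_excess: "inner_fun_space D (\<lambda>f g. B f g + (-1) * E f g)"
proof (rule inner_fun_space_lincomb[OF Q.inner_fun_space_axioms])
  show "inner_fun_space D E"
    by (rule inner_fun_space_subspace[OF inner_fun_space_axioms])
       (auto intro: D_N Q.zero_mem Q.add_mem Q.scale_mem)
qed (use E_le_B in auto)

text \<open>
  The difference of the two forms is positive semidefinite and vanishes on the diagonal at \<open>g\<close>, hence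
  also in every pair with \<open>g\<close>.
\<close>

lemma B_eq_E: "\<lbrakk>f \<in> D; g \<in> D0\<rbrakk> \<Longrightarrow> B f g = E f g"
proof -
  assume f: "f \<in> D" and g: "g \<in> D0"
  have "form1 V Q g = N1 g" using Q_eq_QN[OF g] by (simp add: form1_def)
  then have "B g g = E g g"
    using form1_B[OF D0_D[OF g]] N1_E[OF D0_N[OF g]] Q.nonneg[OF D0_D[OF g]] nonneg[OF D0_N[OF g]] by simp
  then show ?thesis
    using inner_fun_space.norm_zero_orthogonal[OF inner_fun_space_excess f D0_D[OF g]] by simp
qed

lemma excess_shift:
  assumes f: "f \<in> D" and g: "g \<in> D0"
  shows "quad B (f \<oplus> g) - quad E (f \<oplus> g) = B f f - E f f"
  using Q.norm_add[OF f D0_D[OF g]] norm_add[OF D_N[OF f] D0_N[OF g]] B_eq_E[OF f g] B_eq_E[OF D0_D[OF g] g]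
  by simp

text \<open>
  The part of \<open>Q\<^sup>N\<^sub>1\<close> that is carried by \<open>F\<close>: edges leaving \<open>F\<close> are dropped, so that its
  weights are \<open>b\<close> and \<open>c + m\<close> themselves.
\<close>

definition local_energy :: "'a set \<Rightarrow> ('a \<Rightarrow> real) \<Rightarrow> real" where
  "local_energy F g = (\<Sum>x\<in>F. \<Sum>y\<in>F. b x y * ((g x - g y)\<^sup>2 / 2)) + (\<Sum>y\<in>F. (m y + c y) * (g y)\<^sup>2)"

text \<open>
  With \<open>e y\<close> the minimiser that is the indicator of \<open>y\<close> on \<open>F\<close>, the minimum of \<open>Q\<^sub>1\<close> over extensions of \<open>a\<close>
  is the quadratic form of the matrix \<open>A\<close> in \<open>a\<close>. Since \<open>e y\<close> differs from the point mass at \<open>y\<close> by a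
  function vanishing on \<open>F\<close>, an entry of \<open>A\<close> is the product of a minimiser with a point mass, and there
  \<open>Q\<^sub>1\<close> may be replaced by \<open>Q\<^sup>N\<^sub>1\<close> and Green's formula applies.
\<close>

lemma finite_trace_excess:
  assumes F: "finite F" and f: "f \<in> D" and C: "normal_contraction C"
    and u: "minimal_off F u" "\<And>x. x \<in> F \<Longrightarrow> u x = C (f x)"
  shows "B u u - local_energy F (\<lambda>x. C (f x)) \<le> B f f - local_energy F f"
proof -
  have dD: "delta y \<in> D" for y by (rule subsetD[OF finsupp_dom finsupp_delta])
  have dD0: "delta y \<in> D0" for y by (rule subsetD[OF finsupp_D0 finsupp_delta])
  have "\<exists>e. minimal_off F e \<and> (\<forall>x\<in>F. e x = delta y x)" for y
    by (rule minimal_extension[OF dD[of y], of F]) blast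
  then obtain e where e: "\<And>y. minimal_off F (e y)" and eF: "\<And>x y. x \<in> F \<Longrightarrow> e y x = delta y x" by metis
  have eD: "e y \<in> D" for y using e[of y] unfolding minimal_off_def by blast
  have eN: "e y \<in> N" for y by (rule D_N[OF eD])
  have e0: "0 \<le> e y x" for x y
    by (rule minimal_unit_interval(1)[OF e]) (auto simp: eF delta_def)
  define A where "A x y = B (e x) (e y)" for x y
  have Asym: "A x y = A y x" for x y unfolding A_def by (rule Q.sym[OF eD eD])
  have B_delta: "B w (e y) = E w (delta y)" if "minimal_off F w" for w y
  proof -
    have wD: "w \<in> D" using that by (simp add: minimal_off_def)
    have "B w (e y \<ominus> delta y) = 0"
      using that Q.diff_mem[OF eD dD] eF by (simp add: minimal_off_def)
    then show ?thesis using Q.diff_right[OF eD dD wD] B_eq_E[OF wD dD0] by simp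
  qed
  \<comment> \<open>In Green's formula at \<open>y\<close> only the summand of \<open>x\<close>, where \<open>e x\<close> is \<open>1\<close>, is kept.\<close>
  have Ale: "A x y \<le> - b x y" if "x \<in> F" "y \<in> F" "x \<noteq> y" for x y
  proof -
    have exy: "e x y = 0" "e x x = 1" using eF that by (auto simp: delta_def)
    have s: "(\<lambda>z. b y z * e x z) summable_on UNIV"
      using edge_summable[OF eN[of x], of y] exy summable_on_uminus[of "\<lambda>z. b y z * e x z" UNIV] by simp
    have "sum (\<lambda>z. b y z * e x z) {x} \<le> (\<Sum>\<^sub>\<infinity>z. b y z * e x z)"
      by (rule finite_sum_le_infsum[OF s]) (auto simp: b_nonneg e0)
    moreover have "A x y = (\<Sum>\<^sub>\<infinity>z. - (b y z * e x z))"
      unfolding A_def B_delta[OF e] Green[OF eN] by (simp add: exy)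
    ultimately show ?thesis using exy b_sym[of x y] by (simp add: infsum_uminus)
  qed
  define s where "s = (\<lambda>x. \<Sum>y\<in>F. 1 * e y x)"
  have smin: "minimal_off F (\<lambda>x. \<Sum>y\<in>F. a y * e y x)" for a
    unfolding minimal_off_def
  proof (intro conjI ballI impI)
    show "(\<lambda>x. \<Sum>y\<in>F. a y * e y x) \<in> D" by (rule Q.sum_mem[OF F eD])
    fix v assume v: "v \<in> D" "\<forall>x\<in>F. v x = 0"
    have "B (e y) v = 0" for y using e v unfolding minimal_off_def by blast
    then show "B (\<lambda>x. \<Sum>y\<in>F. a y * e y x) v = 0" using Q.sum_left[OF F eD v(1)] by simp
  qed
  have sumF: "(\<Sum>y\<in>F. a y * e y x) = a x" if "x \<in> F" for a x
  proof -
    have "(\<Sum>y\<in>F. a y * e y x) = (\<Sum>y\<in>F. if y = x then a y else 0)"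
      using eF[OF that] by (intro sum.cong) (auto simp: delta_def)
    then show ?thesis using F that by simp
  qed
  \<comment> \<open>The sum of the functions \<open>e x\<close> minimises for the value \<open>1\<close> on \<open>F\<close>, so it is at most \<open>1\<close>.\<close>
  have row: "m y + c y \<le> (\<Sum>x\<in>F. A x y)" if y: "y \<in> F" for y
  proof -
    have sm: "minimal_off F s" unfolding s_def by (rule smin)
    have sF: "s x = 1" if "x \<in> F" for x unfolding s_def by (rule sumF[OF that])
    have sN: "s \<in> N" using sm D_N by (simp add: minimal_off_def)
    have s1: "s x \<le> 1" for x by (rule minimal_unit_interval(2)[OF sm]) (simp add: sF)
    have "(\<Sum>x\<in>F. A x y) = B s (e y)"
      unfolding s_def A_def by (subst Q.sum_left[OF F eD eD]) simp
    also have "\<dots> = m y + c y + (\<Sum>\<^sub>\<infinity>z. b y z * (s y - s z))"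
      unfolding B_delta[OF sm] Green[OF sN] by (simp add: sF[OF y])
    also have "\<dots> \<ge> m y + c y"
      by (simp add: infsum_nonneg b_nonneg s1 sF[OF y])
    finally show ?thesis .
  qed
  have BA: "quad B (\<lambda>x. \<Sum>y\<in>F. a y * e y x) = (\<Sum>x\<in>F. \<Sum>y\<in>F. a x * a y * A x y)" for a
  proof -
    let ?u = "\<lambda>x. \<Sum>y\<in>F. a y * e y x"
    have uD: "?u \<in> D" by (rule Q.sum_mem[OF F eD])
    have "B ?u ?u = (\<Sum>x\<in>F. a x * B (e x) ?u)" by (rule Q.sum_left[OF F eD uD])
    also have "\<dots> = (\<Sum>x\<in>F. a x * (\<Sum>y\<in>F. a y * B (e y) (e x)))"
      using Q.sum_left[OF F eD eD] Q.sym[OF eD uD] by simp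
    also have "\<dots> = (\<Sum>x\<in>F. \<Sum>y\<in>F. a x * a y * A x y)"
      using Asym by (simp add: A_def sum_distrib_left mult.assoc)
    finally show ?thesis .
  qed
  define R where "R a = (\<Sum>x\<in>F. \<Sum>y\<in>F. (- A x y - b x y) * ((a x - a y)\<^sup>2 / 2))
      + (\<Sum>y\<in>F. ((\<Sum>x\<in>F. A x y) - (m y + c y)) * (a y)\<^sup>2)" for a
  have Req: "quad B (\<lambda>x. \<Sum>y\<in>F. a y * e y x) - local_energy F a = R a" for a
  proof -
    have "(\<Sum>x\<in>F. \<Sum>y\<in>F. (- A x y - b x y) * ((a x - a y)\<^sup>2 / 2))
       = (\<Sum>x\<in>F. \<Sum>y\<in>F. (- A x y) * ((a x - a y)\<^sup>2 / 2)) - (\<Sum>x\<in>F. \<Sum>y\<in>F. b x y * ((a x - a y)\<^sup>2 / 2))"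
      unfolding sum_subtractf[symmetric] by (simp only: left_diff_distrib)
    moreover have "(\<Sum>y\<in>F. ((\<Sum>x\<in>F. A x y) - (m y + c y)) * (a y)\<^sup>2)
       = (\<Sum>y\<in>F. (\<Sum>x\<in>F. A x y) * (a y)\<^sup>2) - (\<Sum>y\<in>F. (m y + c y) * (a y)\<^sup>2)"
      unfolding sum_subtractf[symmetric] by (simp only: left_diff_distrib)
    moreover note finite_form_decomposition[where A = A and F = F and g = a, OF Asym]
    ultimately show ?thesis unfolding BA R_def local_energy_def by argo
  qed
  \<comment> \<open>All weights in \<open>R\<close> are nonnegative; for \<open>x = y\<close> the factor on the right is zero.\<close>
  have "R (\<lambda>x. C (f x)) \<le> R f"
    unfolding R_def
  proof (intro add_mono sum_mono)
    fix x y assume xy: "x \<in> F" "y \<in> F"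
    have "(C (f x) - C (f y))\<^sup>2 \<le> (f x - f y)\<^sup>2"
      using C by (auto simp: normal_contraction_def abs_le_square_iff[symmetric])
    then show "(- A x y - b x y) * ((C (f x) - C (f y))\<^sup>2 / 2) \<le> (- A x y - b x y) * ((f x - f y)\<^sup>2 / 2)"
      using Ale[OF xy] by (cases "x = y") (auto intro: mult_left_mono)
  next
    fix y assume "y \<in> F"
    have "(C (f y))\<^sup>2 \<le> (f y)\<^sup>2"
      using normal_contraction_abs_le[OF C] by (simp add: abs_le_square_iff[symmetric])
    then show "((\<Sum>x\<in>F. A x y) - (m y + c y)) * (C (f y))\<^sup>2 \<le> ((\<Sum>x\<in>F. A x y) - (m y + c y)) * (f y)\<^sup>2"
      using row[OF \<open>y \<in> F\<close>] by (intro mult_left_mono) auto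
  qed
  moreover have "quad B (\<lambda>x. \<Sum>y\<in>F. f y * e y x) \<le> B f f"
    by (rule minimal_le[OF smin f sumF])
  moreover have "B u u \<le> quad B (\<lambda>x. \<Sum>y\<in>F. C (f y) * e y x)"
  proof (rule minimal_le[OF u(1)])
    show "(\<lambda>x. \<Sum>y\<in>F. C (f y) * e y x) \<in> D" by (rule Q.sum_mem[OF F eD])
    show "u x = (\<Sum>y\<in>F. C (f y) * e y x)" if "x \<in> F" for x
      using u(2)[OF that] sumF[OF that, of "\<lambda>y. C (f y)"] by simp
  qed
  ultimately show ?thesis using Req[of f] Req[of "\<lambda>x. C (f x)"] by linarith
qed

lemma local_energy_tendsto:
  assumes f: "f \<in> N"
  shows "(\<lambda>n. local_energy {x. to_nat x < n} f) \<longlonglongrightarrow> E f f"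
proof -
  let ?F = "\<lambda>n. {x::'a. to_nat x < n}"
  have fin: "finite (?F n)" for n by (rule finite_to_nat_less)
  \<comment> \<open>The indices of \<open>grad\<close> that involve only vertices of \<open>?F n\<close>.\<close>
  define I where "I n = Inl ` (?F n \<times> ?F n) \<union> Inr ` (Inl ` ?F n \<union> Inr ` ?F n)" for n
  have finI: "finite (I n)" for n unfolding I_def using fin by simp
  have sumI: "sum (\<lambda>k. (grad f k)\<^sup>2) (I n) = local_energy (?F n) f" for n
  proof -
    have "sum (\<lambda>k. (grad f k)\<^sup>2) (I n)
       = sum (\<lambda>k. (grad f k)\<^sup>2) (Inl ` (?F n \<times> ?F n)) + sum (\<lambda>k. (grad f k)\<^sup>2) (Inr ` (Inl ` ?F n \<union> Inr ` ?F n))"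
      unfolding I_def using fin by (intro sum.union_disjoint) auto
    also have "sum (\<lambda>k. (grad f k)\<^sup>2) (Inl ` (?F n \<times> ?F n)) = (\<Sum>z\<in>?F n \<times> ?F n. (grad f (Inl z))\<^sup>2)"
      by (subst sum.reindex) (auto intro: inj_onI)
    also have "\<dots> = (\<Sum>x\<in>?F n. \<Sum>y\<in>?F n. b x y * ((f x - f y)\<^sup>2 / 2))"
      by (simp add: sum.cartesian_product grad_sq split_def)
         (intro sum.cong refl, metis grad_sq(1) prod.collapse times_divide_eq_right)
    also have "sum (\<lambda>k. (grad f k)\<^sup>2) (Inr ` (Inl ` ?F n \<union> Inr ` ?F n)) = (\<Sum>k\<in>Inl ` ?F n \<union> Inr ` ?F n. (grad f (Inr k))\<^sup>2)"
      by (subst sum.reindex) (auto intro: inj_onI)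
    also have "\<dots> = (\<Sum>k\<in>Inl ` ?F n. (grad f (Inr k))\<^sup>2) + (\<Sum>k\<in>Inr ` ?F n. (grad f (Inr k))\<^sup>2)"
      using fin by (intro sum.union_disjoint) auto
    also have "\<dots> = (\<Sum>y\<in>?F n. c y * (f y)\<^sup>2) + (\<Sum>y\<in>?F n. m y * (f y)\<^sup>2)"
      by (subst (1 2) sum.reindex) (auto intro: inj_onI simp: grad_sq)
    also have "\<dots> = (\<Sum>y\<in>?F n. (m y + c y) * (f y)\<^sup>2)"
      by (simp add: sum.distrib[symmetric] distrib_right add.commute)
    finally show ?thesis by (simp add: local_energy_def)
  qed
  have "((\<lambda>k. (grad f k)\<^sup>2) has_sum E f f) UNIV"
    using L2_inner_has_sum[of "grad f" "grad f"] f N_iff_grad E_grad[OF f f] by (simp add: power2_eq_square)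
  then have "(sum (\<lambda>k. (grad f k)\<^sup>2) \<longlongrightarrow> E f f) (finite_subsets_at_top UNIV)" by (simp add: has_sum_def)
  moreover have "filterlim I (finite_subsets_at_top UNIV) sequentially"
    unfolding filterlim_finite_subsets_at_top
  proof (intro allI impI)
    fix X :: "(('a \<times> 'a) + ('a + 'a)) set" assume X: "finite X \<and> X \<subseteq> UNIV"
    have "\<forall>k. \<exists>n0. \<forall>n\<ge>n0. k \<in> I n"
    proof
      fix k show "\<exists>n0. \<forall>n\<ge>n0. k \<in> I n"
      proof (cases k rule: index_cases)
        case (edge x y)
        show ?thesis by (rule exI[of _ "Suc (max (to_nat x) (to_nat y))"]) (auto simp: I_def edge)
      next
        case (killing x)
        show ?thesis by (rule exI[of _ "Suc (to_nat x)"]) (auto simp: I_def killing)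
      next
        case (mass x)
        show ?thesis by (rule exI[of _ "Suc (to_nat x)"]) (auto simp: I_def mass)
      qed
    qed
    then have "\<forall>k\<in>X. eventually (\<lambda>n. k \<in> I n) sequentially" by (auto simp: eventually_sequentially)
    then have "eventually (\<lambda>n. \<forall>k\<in>X. k \<in> I n) sequentially" using X by (simp add: eventually_ball_finite)
    then show "eventually (\<lambda>n. finite (I n) \<and> X \<subseteq> I n \<and> I n \<subseteq> UNIV) sequentially"
      by (rule eventually_mono) (use finI in auto)
  qed
  ultimately have "((\<lambda>n. sum (\<lambda>k. (grad f k)\<^sup>2) (I n)) \<longlongrightarrow> E f f) sequentially"
    by (rule filterlim_compose)
  then show ?thesis using sumI by simp
qed

text \<open>
  The minimisers that agree with \<open>C \<circ> f\<close> on larger and larger finite sets converge pointwise to \<open>C \<circ> f\<close>, so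
  the estimates on finite sets pass to the limit by \<open>pointwise_limit\<close>.
\<close>

theorem excess_markovian:
  assumes f: "f \<in> D" and C: "normal_contraction C"
  shows "quad B (\<lambda>x. C (f x)) - quad E (\<lambda>x. C (f x)) \<le> B f f - E f f"
proof -
  let ?F = "\<lambda>n. {x::'a. to_nat x < n}"
  let ?g = "\<lambda>x. C (f x)"
  have fin: "finite (?F n)" for n by (rule finite_to_nat_less)
  have g: "?g \<in> D" by (rule D_normal_contraction[OF f C])
  have "\<exists>u. minimal_off (?F n) u \<and> (\<forall>x\<in>?F n. u x = ?g x)" for n
    by (rule minimal_extension[OF g, of "?F n"]) blast
  then obtain u where u: "\<And>n. minimal_off (?F n) (u n)" and uF: "\<And>n x. x \<in> ?F n \<Longrightarrow> u n x = ?g x" by metis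
  have uD: "u n \<in> D" for n using u by (simp add: minimal_off_def)
  have lim: "(\<lambda>n. u n x) \<longlonglongrightarrow> ?g x" for x
  proof (rule tendsto_eventually)
    show "eventually (\<lambda>n. u n x = ?g x) sequentially"
      unfolding eventually_sequentially by (rule exI[of _ "Suc (to_nat x)"]) (auto intro: uF)
  qed
  have le: "quad B (u n) \<le> B f f - local_energy (?F n) f + local_energy (?F n) ?g" for n
    using finite_trace_excess[OF fin f C u uF, of n] by linarith
  have "(\<lambda>n. B f f - local_energy (?F n) f + local_energy (?F n) ?g) \<longlonglongrightarrow> B f f - E f f + E ?g ?g"
    by (intro tendsto_intros local_energy_tendsto D_N f g)
  from Q.pointwise_limit(2)[OF complete_D B_eval_bound uD lim le this] show ?thesis by simp
qed

end

section \<open>Squares of harmonic functions\<close>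

context weighted_graph
begin

lemma graph_form_QD: "graph_form m b c (QD m b c)"
  by unfold_locales (simp_all add: quadratic_form_QD closed_form_QD markovian_QD form_dom_QD finsupp_D0)

text \<open>
  Up to a factor, \<open>e\<close> is the Green function of \<open>Q\<^sup>D\<^sub>1\<close> with pole at \<open>x\<close>: it represents evaluation at \<open>x\<close>. It
  is obtained as the minimiser for the one-point set \<open>{x}\<close>.
\<close>

lemma equilibrium_function:
  obtains e where "e \<in> D0" "e x = 1" "\<And>y. 0 \<le> e y" "\<And>y. e y \<le> 1"
    "\<And>v. v \<in> D0 \<Longrightarrow> E v e = v x * E e e" "m x \<le> E e e"
proof -
  interpret QD: graph_form m b c "QD m b c" by (rule graph_form_QD)
  have d: "delta x \<in> D0" by (rule subsetD[OF finsupp_D0 finsupp_delta])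
  then have "delta x \<in> form_dom (QD m b c)" by (simp add: form_dom_QD)
  then obtain e where e: "QD.minimal_off {x} e" "\<And>y. y \<in> {x} \<Longrightarrow> e y = delta x y"
    by (rule QD.minimal_extension[where F = "{x}"]) blast
  have eD: "e \<in> D0" using e(1) by (simp add: QD.minimal_off_def form_dom_QD)
  have e1: "e x = 1" using e(2) by (simp add: delta_def)
  have orth: "E e v = 0" if "v \<in> D0" "v x = 0" for v
    using e(1) that polar_form1_QD[OF eD] by (simp add: QD.minimal_off_def form_dom_QD)
  show ?thesis
  proof (rule that[OF eD e1])
    show "0 \<le> e y" for y by (rule QD.minimal_unit_interval(1)[OF e(1)]) (simp add: e1)
    show "e y \<le> 1" for y by (rule QD.minimal_unit_interval(2)[OF e(1)]) (simp add: e1)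
    show "E v e = v x * E e e" if v: "v \<in> D0" for v
    proof -
      have "E e (\<lambda>y. v y - v x * e y) = 0"
        by (rule orth[OF D0.diff_mem[OF v D0_scale[OF eD]]]) (simp add: e1)
      then show ?thesis
        using D0.diff_right[OF v D0_scale[OF eD, of "v x"] eD] D0.scale_right[OF eD eD, of "v x"] D0.sym[OF v eD]
        by simp
    qed
    show "m x \<le> E e e" using point_bound[OF D0_N[OF eD], of x] e1 by simp
  qed
qed

lemma square_mem:
  assumes f: "f \<in> N" and le: "\<And>x. \<bar>f x\<bar> \<le> r"
  shows "(\<lambda>x. (f x)\<^sup>2) \<in> N"
proof (rule N_dominated(1)[OF scale_mem[OF f, of "2 * r"] zero_mem])
  fix x y
  have r: "0 \<le> r" using le[of x] by simp
  have "\<bar>f x + f y\<bar> \<le> 2 * r" using le[of x] le[of y] by simp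
  then have "\<bar>f x + f y\<bar> * \<bar>f x - f y\<bar> \<le> (2 * r) * \<bar>f x - f y\<bar>" by (rule mult_right_mono) simp
  moreover have "\<bar>(f x)\<^sup>2 - (f y)\<^sup>2\<bar> = \<bar>f x + f y\<bar> * \<bar>f x - f y\<bar>"
    by (simp add: abs_mult[symmetric] power2_eq_square algebra_simps)
  moreover have "\<bar>2 * r * f x - 2 * r * f y\<bar> = (2 * r) * \<bar>f x - f y\<bar>"
    using r by (simp add: abs_mult right_diff_distrib[symmetric])
  ultimately show "\<bar>(f x)\<^sup>2 - (f y)\<^sup>2\<bar> \<le> \<bar>2 * r * f x - 2 * r * f y\<bar> + \<bar>0 - 0\<bar>" by simp
  have "\<bar>f x\<bar> * \<bar>f x\<bar> \<le> r * \<bar>f x\<bar>" by (rule mult_right_mono[OF le]) simp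
  also have "\<dots> \<le> (2 * r) * \<bar>f x\<bar>" using r by (intro mult_right_mono) auto
  finally show "\<bar>(f x)\<^sup>2\<bar> \<le> \<bar>2 * r * f x\<bar> + \<bar>0\<bar>" using r by (simp add: power2_eq_square abs_mult)
qed

lemma product_mem:
  assumes f: "f \<in> N" and le: "\<And>x. \<bar>f x\<bar> \<le> r" and g: "g \<in> N" and gle: "\<And>x. \<bar>g x\<bar> \<le> s"
  shows "(\<lambda>x. f x * g x) \<in> N"
proof (rule N_dominated(1)[OF scale_mem[OF f, of s] scale_mem[OF g, of r]])
  fix x y
  have r: "0 \<le> r" and s: "0 \<le> s" using le[of x] gle[of x] by auto
  have "\<bar>f x * g x - f y * g y\<bar> = \<bar>g x * (f x - f y) + f y * (g x - g y)\<bar>" by (simp add: algebra_simps)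
  also have "\<dots> \<le> \<bar>g x\<bar> * \<bar>f x - f y\<bar> + \<bar>f y\<bar> * \<bar>g x - g y\<bar>"
    unfolding abs_mult[symmetric] by (rule abs_triangle_ineq)
  also have "\<dots> \<le> s * \<bar>f x - f y\<bar> + r * \<bar>g x - g y\<bar>"
    by (intro add_mono mult_right_mono le gle) auto
  finally show "\<bar>f x * g x - f y * g y\<bar> \<le> \<bar>s * f x - s * f y\<bar> + \<bar>r * g x - r * g y\<bar>"
    using r s by (simp add: right_diff_distrib[symmetric] abs_mult)
  have "\<bar>f x * g x\<bar> \<le> \<bar>s * f x\<bar>"
    using mult_right_mono[OF gle[of x], of "\<bar>f x\<bar>"] s by (simp add: abs_mult mult.commute)
  then show "\<bar>f x * g x\<bar> \<le> \<bar>s * f x\<bar> + \<bar>r * g x\<bar>" by simp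
qed

text \<open>
  Write \<open>s = f\<^sup>2\<close>. The value at \<open>x\<close> of its \<open>D\<^sup>D\<close>-part is the \<open>Q\<^sub>1\<close>-product of \<open>s\<close> with the
  equilibrium function \<open>e\<close>, divided by \<open>Q\<^sub>1(e) \<ge> m(x)\<close>. The product rule
  \<open>(f(x)\<^sup>2 - f(y)\<^sup>2)(e(x) - e(y)) = 2 (f(x) - f(y))((fe)(x) - (fe)(y)) - (e(x) + e(y))(f(x) - f(y))\<^sup>2\<close>
  and \<open>e \<le> 1\<close> bound this product from below by twice the product of \<open>f\<close> with \<open>fe\<close>, which is zero for harmonic
  \<open>f\<close>, minus \<open>2 Q\<^sub>1(f)\<close>.
\<close>

lemma harmonic_square_bound:
  assumes f: "f \<in> N" and h: "harmonic1 m b c f" and le: "\<And>x. \<bar>f x\<bar> \<le> r"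
  shows "harm (\<lambda>x. (f x)\<^sup>2) x \<le> 3 * E f f / m x"
proof -
  obtain e where e: "e \<in> D0" "e x = 1" "\<And>y. 0 \<le> e y" "\<And>y. e y \<le> 1"
    and ev: "\<And>v. v \<in> D0 \<Longrightarrow> E v e = v x * E e e" and em: "m x \<le> E e e"
    by (rule equilibrium_function[of x]) blast
  have eN: "e \<in> N" by (rule D0_N[OF e(1)])
  have r: "0 \<le> r" using le[of x] by simp
  define s where "s = (\<lambda>y. (f y)\<^sup>2)"
  define p where "p = (\<lambda>y. f y * e y)"
  have sN: "s \<in> N" unfolding s_def by (rule square_mem[OF f le])
  have pN: "p \<in> N" unfolding p_def by (rule product_mem[OF f le eN, of 1]) (simp add: e)
  have pD: "p \<in> D0"
  proof (rule D0_dominated[OF pN D0_scale[OF e(1), of r]])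
    fix y show "\<bar>p y\<bar> \<le> \<bar>r * e y\<bar>"
      unfolding p_def using mult_right_mono[OF le[of y], of "\<bar>e y\<bar>"] r by (simp add: abs_mult)
  qed
  have tm: "2 * (grad f k * grad p k) - 2 * (grad f k * grad f k) \<le> grad s k * grad e k" for k
  proof (cases k rule: index_cases)
    case (edge y w)
    have sq: "sqrt (b y w / 2) * u * (sqrt (b y w / 2) * v) = (b y w / 2) * (u * v)" for u v
    proof -
      have "sqrt (b y w / 2) * u * (sqrt (b y w / 2) * v) = (sqrt (b y w / 2) * sqrt (b y w / 2)) * (u * v)"
        by (simp only: mult_ac)
      then show ?thesis using b_nonneg[of y w] by simp
    qed
    have "0 \<le> (b y w / 2) * ((2 - e y - e w) * (f y - f w)\<^sup>2)"
      using b_nonneg[of y w] e(4)[of y] e(4)[of w] by (intro mult_nonneg_nonneg) auto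
    also have "\<dots> = (b y w / 2) * ((s y - s w) * (e y - e w)) -
        (2 * ((b y w / 2) * ((f y - f w) * (p y - p w))) - 2 * ((b y w / 2) * ((f y - f w) * (f y - f w))))"
      unfolding s_def p_def by (simp add: power2_eq_square field_simps)
    finally show ?thesis unfolding edge grad_simps sq by simp
  next
    case (killing y)
    have "0 \<le> c y * ((f y)\<^sup>2 * (2 - e y))"
      using c_nonneg[of y] e(4)[of y] by (intro mult_nonneg_nonneg) auto
    also have "\<dots> = c y * (s y * e y) - (2 * (c y * (f y * p y)) - 2 * (c y * (f y * f y)))"
      unfolding s_def p_def by (simp add: power2_eq_square algebra_simps)
    also have "c y = sqrt (c y) * sqrt (c y)" using c_nonneg[of y] by simp
    finally show ?thesis unfolding killing grad_simps by (simp add: mult_ac)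
  next
    case (mass y)
    have "0 \<le> m y * ((f y)\<^sup>2 * (2 - e y))"
      using m_pos[of y] e(4)[of y] by (intro mult_nonneg_nonneg) auto
    also have "\<dots> = m y * (s y * e y) - (2 * (m y * (f y * p y)) - 2 * (m y * (f y * f y)))"
      unfolding s_def p_def by (simp add: power2_eq_square algebra_simps)
    also have "m y = sqrt (m y) * sqrt (m y)" using m_pos[of y] by simp
    finally show ?thesis unfolding mass grad_simps by (simp add: mult_ac)
  qed
  have I: "integrable (count_space UNIV) (\<lambda>k. grad u k * grad v k)" if "u \<in> N" "v \<in> N" for u v
    using that N_iff_grad by (intro L2_mult_integrable) auto
  have "2 * E f p - 2 * E f f = (\<integral>k. 2 * (grad f k * grad p k) - 2 * (grad f k * grad f k) \<partial>count_space UNIV)"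
    unfolding E_grad[OF f pN] E_grad[OF f f] L2_inner_def
    using I[OF f pN] I[OF f f] by simp
  also have "\<dots> \<le> (\<integral>k. grad s k * grad e k \<partial>count_space UNIV)"
    using I[OF f pN] I[OF f f] I[OF sN eN] tm by (intro integral_mono) auto
  also have "\<dots> = E s e" unfolding E_grad[OF sN eN] L2_inner_def ..
  finally have "2 * E f p - 2 * E f f \<le> E s e" .
  moreover have "E f p = 0" by (rule harmonic_orthogonal[OF f h pD])
  moreover have "E s e = royden0 m b c s x * E e e"
  proof -
    note s0 = royden0_D0[OF sN]
    have "E (harm s \<oplus> royden0 m b c s) e = E (harm s) e + E (royden0 m b c s) e"
      by (rule add_left[OF harm_N[OF sN] D0_N[OF s0] eN])
    then show ?thesis
      using ev[OF s0] harmonic_orthogonal[OF harm_N[OF sN] harmonic_harm[OF sN] e(1)] by (simp add: harm_def)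
  qed
  ultimately have "- royden0 m b c s x * E e e \<le> 2 * E f f" by simp
  moreover have "- royden0 m b c s x * m x \<le> max 0 (- royden0 m b c s x * E e e)"
  proof (cases "royden0 m b c s x \<le> 0")
    case True
    then have "- royden0 m b c s x * m x \<le> - royden0 m b c s x * E e e" using em by (intro mult_left_mono) auto
    then show ?thesis by simp
  next
    case False
    then have "- royden0 m b c s x * m x \<le> 0" using m_pos[of x] by (simp add: mult_nonneg_nonneg)
    then show ?thesis by simp
  qed
  ultimately have "- royden0 m b c s x * m x \<le> 2 * E f f" using nonneg[OF f] by simp
  moreover have "s x * m x \<le> E f f" using point_bound[OF f, of x] by (simp add: s_def mult.commute)
  ultimately have "harm s x * m x \<le> 3 * E f f" by (simp add: harm_def left_diff_distrib)
  then show ?thesis unfolding s_def using m_pos[of x] by (simp add: field_simps)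
qed

text \<open>
  The squares of \<open>f\<close> and of its harmonic part differ by a function in \<open>D\<^sup>D\<close>.
\<close>

lemma bounded_square_bound:
  assumes f: "f \<in> N" and le: "\<And>x. \<bar>f x\<bar> \<le> r"
  shows "harm (\<lambda>x. (f x)\<^sup>2) x \<le> 3 * E f f / m x"
proof -
  note hb = harm_bounded[OF f le]
  note hN = harm_N[OF f]
  have "(\<lambda>x. (f x)\<^sup>2 - (harm f x)\<^sup>2) \<in> D0"
  proof (rule D0_dominated[OF diff_mem[OF square_mem[OF f le] square_mem[OF hN hb]] D0_scale[OF royden0_D0[OF f], of "2 * r"]])
    fix x
    have r: "0 \<le> r" using le[of x] by simp
    have "\<bar>f x + harm f x\<bar> \<le> 2 * r" using le[of x] hb[of x] by simp
    then have "\<bar>f x + harm f x\<bar> * \<bar>royden0 m b c f x\<bar> \<le> 2 * r * \<bar>royden0 m b c f x\<bar>" by (rule mult_right_mono) simp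
    moreover have "(f x)\<^sup>2 - (harm f x)\<^sup>2 = (f x + harm f x) * royden0 m b c f x"
      by (simp add: harm_def power2_eq_square algebra_simps)
    ultimately show "\<bar>(f x)\<^sup>2 - (harm f x)\<^sup>2\<bar> \<le> \<bar>2 * r * royden0 m b c f x\<bar>" using r by (simp add: abs_mult)
  qed
  then have "harm (\<lambda>x. (f x)\<^sup>2) = harm (\<lambda>x. (harm f x)\<^sup>2)"
    by (rule harm_cong[OF square_mem[OF f le] square_mem[OF hN hb]])
  then have "harm (\<lambda>x. (f x)\<^sup>2) x \<le> 3 * quad E (harm f) / m x"
    using harmonic_square_bound[OF hN harmonic_harm[OF f] hb] by simp
  also have "\<dots> \<le> 3 * E f f / m x"
    using E_harm_le[OF f] m_pos[of x] by (intro divide_right_mono) auto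
  finally show ?thesis .
qed

end

section \<open>Boundary values\<close>

lemma normal_contraction_arctan: "normal_contraction arctan"
  unfolding normal_contraction_def
proof (intro conjI allI)
  fix s t :: real
  have "norm (arctan s - arctan t) \<le> 1 * norm (s - t)"
  proof (rule field_differentiable_bound[of UNIV])
    show "(arctan has_field_derivative inverse (1 + x\<^sup>2)) (at x within UNIV)" for x
      by (simp add: DERIV_arctan)
    show "norm (inverse (1 + x\<^sup>2)) \<le> 1" for x :: real
      by (simp add: field_simps add_pos_nonneg)
  qed auto
  then show "\<bar>arctan s - arctan t\<bar> \<le> \<bar>s - t\<bar>" by simp
qed simp

text \<open>
  The homeomorphism of \<open>[-\<pi>/2, \<pi>/2]\<close> onto the extended reals inverse to the arctangent. Composing with
  it turns the continuous extension of \<open>arctan \<circ> f\<close>, a bounded function, into one of \<open>f\<close>.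
\<close>

definition tan_ext :: "real \<Rightarrow> ereal" where
  "tan_ext t = (if t \<ge> pi / 2 then \<infinity> else if t \<le> - pi / 2 then - \<infinity> else ereal (tan t))"

lemma tan_ext_less: "ereal r < tan_ext t \<longleftrightarrow> arctan r < t" and tan_ext_greater: "tan_ext t < ereal r \<longleftrightarrow> t < arctan r"
proof -
  have r: "arctan r < pi / 2" "- pi / 2 < arctan r" using arctan_bounded[of r] by auto
  have "arctan (tan t) = t" if "\<not> t \<ge> pi / 2" "\<not> t \<le> - pi / 2" using that by (intro arctan_tan) auto
  then have "(r < tan t \<longleftrightarrow> arctan r < t) \<and> (tan t < r \<longleftrightarrow> t < arctan r)"
    if "\<not> t \<ge> pi / 2" "\<not> t \<le> - pi / 2"
    using that arctan_less_iff[of r "tan t"] arctan_less_iff[of "tan t" r] by simp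
  then show "ereal r < tan_ext t \<longleftrightarrow> arctan r < t" "tan_ext t < ereal r \<longleftrightarrow> t < arctan r"
    using r unfolding tan_ext_def by (auto simp: not_le split: if_splits)
qed

lemma tan_ext_arctan: "tan_ext (arctan r) = ereal r"
  using arctan_bounded[of r] by (auto simp: tan_ext_def tan_arctan)

lemma continuous_tan_ext: "continuous_on UNIV tan_ext"
proof -
  have "(tan_ext \<longlongrightarrow> tan_ext t) (at t)" for t
  proof (rule order_tendstoI)
    fix a assume "a < tan_ext t"
    then obtain r where r: "a < ereal r" "ereal r < tan_ext t" using ereal_dense2 by blast
    then have "arctan r < t" by (simp add: tan_ext_less)
    then have "eventually (\<lambda>u. arctan r < u) (at t)"
      using order_tendstoD(1)[OF tendsto_ident_at] by blast
    then show "eventually (\<lambda>u. a < tan_ext u) (at t)"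
      by (rule eventually_mono) (metis tan_ext_less r(1) less_trans)
  next
    fix a assume "tan_ext t < a"
    then obtain r where r: "tan_ext t < ereal r" "ereal r < a" using ereal_dense2 by blast
    then have "t < arctan r" by (simp add: tan_ext_greater)
    then have "eventually (\<lambda>u. u < arctan r) (at t)"
      using order_tendstoD(2)[OF tendsto_ident_at] by blast
    then show "eventually (\<lambda>u. tan_ext u < a) (at t)"
      by (rule eventually_mono) (metis tan_ext_greater r(2) less_trans)
  qed
  then show ?thesis by (simp add: continuous_on_def)
qed

definition clip_ext :: "real \<Rightarrow> ereal \<Rightarrow> real" where
  "clip_ext r l = (if l = \<infinity> then r else if l = - \<infinity> then - r else clip r (real_of_ereal l))"

lemma clip_tendsto_id: "(\<lambda>n. clip (real n) t) \<longlonglongrightarrow> t"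
proof (rule tendsto_eventually)
  obtain n0 where "\<bar>t\<bar> \<le> real n0" using real_arch_simple by blast
  then show "eventually (\<lambda>n. clip (real n) t = t) sequentially"
    unfolding eventually_sequentially by (intro exI[of _ n0] allI impI clip_eq_self) (meson le_trans of_nat_mono order_trans)
qed

lemma tendsto_clip_ext:
  assumes lim: "((\<lambda>x. ereal (f x)) \<longlongrightarrow> l) F" and r: "0 \<le> r"
  shows "((\<lambda>x. clip r (f x)) \<longlongrightarrow> clip_ext r l) F"
proof (cases l)
  case (real t)
  then have "(f \<longlongrightarrow> t) F" using lim by simp
  then show ?thesis unfolding clip_ext_def clip_def real by (auto intro!: tendsto_intros)
next
  case PInf
  then have "eventually (\<lambda>x. ereal r < ereal (f x)) F" using order_tendstoD(1)[OF lim, of "ereal r"] by simp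
  then have "eventually (\<lambda>x. clip r (f x) = r) F" by (rule eventually_mono) (use r in \<open>auto simp: clip_def\<close>)
  then show ?thesis using PInf by (simp add: clip_ext_def tendsto_eventually)
next
  case MInf
  then have "eventually (\<lambda>x. ereal (f x) < ereal (- r)) F" using order_tendstoD(2)[OF lim, of "ereal (-r)"] by simp
  then have "eventually (\<lambda>x. clip r (f x) = - r) F" by (rule eventually_mono) (use r in \<open>auto simp: clip_def\<close>)
  then show ?thesis using MInf by (simp add: clip_ext_def tendsto_eventually)
qed

locale graph_compactification = weighted_graph +
  fixes K :: "'b topology" and i :: "'a \<Rightarrow> 'b"
  assumes compactification: "compactification m b c K i"
begin

abbreviation "bd \<equiv> bdry m b c K i"
abbreviation "\<gamma> \<equiv> gamma m b c K i"
abbreviation "\<gamma>2 \<equiv> gammaL2 m b c K i"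

text \<open>
  Convergence to a boundary point along vertices. Extended boundary values are limits along this
  filter, which reduces their algebra to that of limits.
\<close>

definition near :: "'b \<Rightarrow> 'a filter" where
  "near p = filtercomap i (nhdsin K p)"

lemma i_topspace: "i x \<in> topspace K"
  using compactification by (auto simp: compactification_def)

lemma bd_topspace: "p \<in> bd \<Longrightarrow> p \<in> topspace K"
  by (simp add: bdry_def)

lemma near_not_bot: "p \<in> topspace K \<Longrightarrow> near p \<noteq> bot"
  unfolding near_def
proof (rule filtercomap_neq_bot)
  fix P assume p: "p \<in> topspace K" and "eventually P (nhdsin K p)"
  then obtain S where S: "openin K S" "p \<in> S" "\<And>q. q \<in> S \<Longrightarrow> P q" by (auto simp: eventually_nhdsin)
  have "p \<in> K closure_of (range i)" using compactification p by (simp add: compactification_def)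
  then obtain q where "q \<in> range i" "q \<in> S" using S(1,2) unfolding in_closure_of by blast
  then show "\<exists>x. P (i x)" using S(3) by auto
qed

lemma continuous_map_near:
  assumes F: "continuous_map K euclidean F" and p: "p \<in> topspace K"
  shows "((\<lambda>x. F (i x)) \<longlongrightarrow> F p) (near p)"
proof (rule topological_tendstoI)
  fix S assume S: "open S" "F p \<in> S"
  let ?U = "{q \<in> topspace K. F q \<in> S}"
  have U: "openin K ?U" using F S(1) by (simp add: openin_continuous_map_preimage)
  have "eventually (\<lambda>q. q \<in> ?U) (nhdsin K p)"
    unfolding eventually_nhdsin using U p S(2) by blast
  then show "eventually (\<lambda>x. F (i x) \<in> S) (near p)"
    unfolding near_def eventually_filtercomap by blast
qed

lemma bounded_extension:
  assumes "f \<in> N" "\<And>x. \<bar>f x\<bar> \<le> r"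
  obtains G where "continuous_map K euclideanreal G" "\<And>x. G (i x) = f x"
proof -
  have "f \<in> N \<inter> bddfun" using assms by (auto simp: bddfun_def bounded_iff)
  then show ?thesis using compactification that unfolding compactification_def by blast
qed

lemma ext_exists: "f \<in> N \<Longrightarrow> \<exists>F. continuous_map K euclidean F \<and> (\<forall>x. F (i x) = ereal (f x))"
proof -
  assume f: "f \<in> N"
  have "\<bar>arctan (f x)\<bar> \<le> pi / 2" for x using arctan_bounded[of "f x"] by (auto simp: abs_le_iff)
  then obtain G where G: "continuous_map K euclideanreal G" "\<And>x. G (i x) = arctan (f x)"
    using bounded_extension[OF N_normal_contraction(1)[OF f normal_contraction_arctan]] by metis
  have "continuous_map euclideanreal euclidean tan_ext" using continuous_tan_ext by simp
  from continuous_map_compose[OF G(1) this] have "continuous_map K euclidean (tan_ext \<circ> G)" .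
  then show ?thesis by (intro exI[of _ "tan_ext \<circ> G"]) (simp add: G(2) tan_ext_arctan)
qed

lemma cont_ext:
  assumes "f \<in> N"
  shows cont_ext_continuous: "continuous_map K euclidean (cont_ext K i f)" and cont_ext_vertex: "cont_ext K i f (i x) = ereal (f x)"
  using someI_ex[OF ext_exists[OF assms]] unfolding cont_ext_def by auto

lemma cont_ext_tendsto:
  assumes "f \<in> N" "p \<in> topspace K" shows "((\<lambda>x. ereal (f x)) \<longlongrightarrow> cont_ext K i f p) (near p)"
  using continuous_map_near[OF cont_ext_continuous[OF assms(1)] assms(2)] cont_ext_vertex[OF assms(1)] by simp

lemma cont_ext_eqI:
  assumes "f \<in> N" "p \<in> topspace K" "((\<lambda>x. ereal (f x)) \<longlongrightarrow> l) (near p)" shows "cont_ext K i f p = l"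
  using tendsto_unique[OF near_not_bot[OF assms(2)] cont_ext_tendsto[OF assms(1,2)] assms(3)] .

lemma cont_ext_real:
  assumes "f \<in> N" "p \<in> topspace K" "cont_ext K i f p = ereal t" shows "(f \<longlongrightarrow> t) (near p)"
  using cont_ext_tendsto[OF assms(1,2)] assms(3) by simp

lemma bdry_D0_bounded: "p \<in> bd \<Longrightarrow> f \<in> D0 \<Longrightarrow> (\<And>x. \<bar>f x\<bar> \<le> r) \<Longrightarrow> cont_ext K i f p = 0"
  unfolding bdry_def form_dom_QD by (auto simp: bddfun_def bounded_iff)

lemma bdry_D0:
  assumes p: "p \<in> bd" and f: "f \<in> D0" shows "cont_ext K i f p = 0" and "(f \<longlongrightarrow> 0) (near p)"
proof -
  note pK = bd_topspace[OF p]
  note aD = D0_normal_contraction[OF f normal_contraction_arctan]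
  have "\<bar>arctan (f x)\<bar> \<le> pi / 2" for x using arctan_bounded[of "f x"] by (auto simp: abs_le_iff)
  from bdry_D0_bounded[OF p aD this] have "cont_ext K i (\<lambda>x. arctan (f x)) p = ereal 0" by (simp add: zero_ereal_def)
  then have "((\<lambda>x. arctan (f x)) \<longlongrightarrow> 0) (near p)" by (rule cont_ext_real[OF D0_N[OF aD] pK])
  moreover have "isCont tan (0::real)" by (rule isCont_tan) simp
  ultimately have "((\<lambda>x. tan (arctan (f x))) \<longlongrightarrow> tan 0) (near p)"
    using isCont_tendsto_compose by blast
  then show l: "(f \<longlongrightarrow> 0) (near p)" by (simp add: tan_arctan)
  then have "((\<lambda>x. ereal (f x)) \<longlongrightarrow> ereal 0) (near p)" by simp
  from cont_ext_eqI[OF D0_N[OF f] pK this] show "cont_ext K i f p = 0" by (simp add: zero_ereal_def)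
qed

text \<open>
  A vertex is separated from the boundary by its point mass, any other point by the definition of the
  boundary; scaling makes the function large on a neighbourhood.
\<close>

lemma exists_nonvanishing_D0:
  assumes p: "p \<in> topspace K" and nb: "p \<notin> bd"
  obtains U g where "openin K U" "p \<in> U" "g \<in> D0" "\<And>x. i x \<in> U \<Longrightarrow> 1 \<le> \<bar>g x\<bar>"
proof -
  obtain f r where f: "f \<in> D0" "\<And>x. \<bar>f x\<bar> \<le> r" and nz: "cont_ext K i f p \<noteq> 0"
  proof (cases "p \<in> range i")
    case True
    then obtain x where x: "p = i x" by blast
    have d: "delta x \<in> D0" by (rule subsetD[OF finsupp_D0 finsupp_delta])
    show ?thesis
    proof (rule that[OF d, of 1])
      show "\<bar>delta x y\<bar> \<le> 1" for y by (simp add: delta_def)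
      show "cont_ext K i (delta x) p \<noteq> 0" unfolding x cont_ext_vertex[OF D0_N[OF d]] by (simp add: delta_def)
    qed
  next
    case False
    then obtain f where "f \<in> D0 \<inter> bddfun" "cont_ext K i f p \<noteq> 0"
      using p nb unfolding bdry_def form_dom_QD by blast
    then show ?thesis using that by (auto simp: bddfun_def bounded_iff)
  qed
  have fN: "f \<in> N" by (rule D0_N[OF f(1)])
  obtain G where G: "continuous_map K euclideanreal G" "\<And>x. G (i x) = f x"
    using bounded_extension[OF fN f(2)] by blast
  have "((\<lambda>x. ereal (f x)) \<longlongrightarrow> ereal (G p)) (near p)" using continuous_map_near[OF G(1) p] G(2) by simp
  then have "cont_ext K i f p = ereal (G p)" by (rule cont_ext_eqI[OF fN p])
  then have Gp: "G p \<noteq> 0" using nz by (auto simp: zero_ereal_def)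
  define a where "a = \<bar>G p\<bar> / 2"
  have a: "a > 0" using Gp by (simp add: a_def)
  let ?U = "{q \<in> topspace K. G q \<in> {t. a < \<bar>t\<bar>}}"
  have "open {t::real. a < \<bar>t\<bar>}" by (intro open_Collect_less continuous_intros)
  from openin_continuous_map_preimage[OF G(1) iffD1[OF open_openin this]] have "openin K ?U" .
  moreover have "p \<in> ?U" using p Gp by (simp add: a_def)
  moreover have "(\<lambda>x. (1 / a) * f x) \<in> D0" by (rule D0_scale[OF f(1)])
  moreover have "1 \<le> \<bar>(1 / a) * f x\<bar>" if "i x \<in> ?U" for x
    using that a G(2) by (simp add: abs_mult field_simps)
  ultimately show ?thesis by (rule that)
qed

lemma D0_abs: "f \<in> D0 \<Longrightarrow> (\<lambda>x. \<bar>f x\<bar>) \<in> D0"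
  by (rule D0_normal_contraction[of f abs]) (auto simp: normal_contraction_def)

text \<open>
  Finitely many neighbourhoods cover, and the sum of the absolute values of the corresponding functions
  works for all of them.
\<close>

lemma D0_large_on_compact:
  assumes S: "closedin K S" and disj: "S \<inter> bd = {}"
  obtains g where "g \<in> D0" "\<And>x. i x \<in> S \<Longrightarrow> 1 \<le> \<bar>g x\<bar>"
proof -
  define \<U> where "\<U> = {U. openin K U \<and> (\<exists>g\<in>D0. \<forall>x. i x \<in> U \<longrightarrow> 1 \<le> \<bar>g x\<bar>)}"
  have SK: "S \<subseteq> topspace K" using S closedin_subset by blast
  have "compactin K S"
    using compactification S closedin_compact_space by (auto simp: compactification_def)
  moreover have "\<forall>U\<in>\<U>. openin K U" by (simp add: \<U>_def)
  moreover have "S \<subseteq> \<Union>\<U>"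
  proof
    fix p assume p: "p \<in> S"
    then have "p \<in> topspace K" "p \<notin> bd" using SK disj by auto
    then obtain U g where "openin K U" "p \<in> U" "g \<in> D0" "\<And>x. i x \<in> U \<Longrightarrow> 1 \<le> \<bar>g x\<bar>"
      by (rule exists_nonvanishing_D0) blast
    then show "p \<in> \<Union>\<U>" unfolding \<U>_def by blast
  qed
  ultimately obtain \<F> where \<F>: "finite \<F>" "\<F> \<subseteq> \<U>" "S \<subseteq> \<Union>\<F>" unfolding compactin_def by meson
  have "\<exists>g\<in>D0. \<forall>x. i x \<in> \<Union>\<F> \<longrightarrow> 1 \<le> \<bar>g x\<bar>"
    using \<F>(1,2)
  proof (induction \<F> rule: finite_induct)
    case empty
    then show ?case using D0_zero by blast
  next
    case (insert U \<F>)
    then obtain g where g: "g \<in> D0" "\<And>x. i x \<in> \<Union>\<F> \<Longrightarrow> 1 \<le> \<bar>g x\<bar>" by auto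
    obtain h where h: "h \<in> D0" "\<And>x. i x \<in> U \<Longrightarrow> 1 \<le> \<bar>h x\<bar>" using insert.prems by (auto simp: \<U>_def)
    have "(\<lambda>x. \<bar>g x\<bar> + \<bar>h x\<bar>) \<in> D0" by (intro D0_add D0_abs g h)
    moreover have "\<forall>x. i x \<in> \<Union>(insert U \<F>) \<longrightarrow> 1 \<le> \<bar>\<bar>g x\<bar> + \<bar>h x\<bar>\<bar>"
    proof (intro allI impI)
      fix x assume "i x \<in> \<Union>(insert U \<F>)"
      then have "1 \<le> \<bar>g x\<bar> \<or> 1 \<le> \<bar>h x\<bar>" using g(2)[of x] h(2)[of x] by blast
      then show "1 \<le> \<bar>\<bar>g x\<bar> + \<bar>h x\<bar>\<bar>" by auto
    qed
    ultimately show ?case by (intro bexI[of _ "\<lambda>x. \<bar>g x\<bar> + \<bar>h x\<bar>"])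
  qed
  then obtain g where g: "g \<in> D0" "\<forall>x. i x \<in> \<Union>\<F> \<longrightarrow> 1 \<le> \<bar>g x\<bar>" by (elim bexE)
  show ?thesis
  proof (rule that[OF g(1)])
    fix x assume "i x \<in> S"
    then have "i x \<in> \<Union>\<F>" using \<F>(3) by blast
    with g(2) show "1 \<le> \<bar>g x\<bar>" by simp
  qed
qed

lemma normal_contraction_band: "0 \<le> s \<Longrightarrow> s \<le> r \<Longrightarrow> normal_contraction (clip r \<ominus> clip s)"
  unfolding normal_contraction_def clip_def by (auto simp: max_def min_def abs_if)

lemma abs_band_le: "0 \<le> s \<Longrightarrow> s \<le> r \<Longrightarrow> \<bar>clip r t - clip s t\<bar> \<le> r"
  unfolding clip_def by (auto simp: max_def min_def abs_if)

text \<open>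
  The parts of \<open>f\<close> between heights \<open>1/(n+1)\<close> and \<open>n+1\<close> are supported in \<open>{\<bar>f\<bar> \<ge> 1/(n+1)}\<close>, a set whose closure
  misses the boundary. They are dominated by functions in \<open>D\<^sup>D\<close> and converge to \<open>f\<close> with bounded norm.
\<close>

theorem vanishing_boundary_values:
  assumes f: "f \<in> N" and z: "\<And>p. p \<in> bd \<Longrightarrow> cont_ext K i f p = 0"
  shows "f \<in> D0"
proof -
  define F where "F n x = clip (real (Suc n)) (f x) - clip (inverse (real (Suc n))) (f x)" for n x
  have inv: "0 \<le> inverse (real (Suc n))" "inverse (real (Suc n)) \<le> real (Suc n)" for n
    by (auto simp: field_simps intro: order_trans[of _ 1])
  note C = normal_contraction_band[OF inv]
  have FN: "F n \<in> N" and FE: "quad E (F n) \<le> E f f" for n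
    using N_normal_contraction[OF f C[of n]] by (simp_all add: F_def[abs_def])
  have FD: "F n \<in> D0" for n
  proof -
    define \<epsilon> where "\<epsilon> = inverse (real (Suc n))"
    have \<epsilon>: "\<epsilon> > 0" by (simp add: \<epsilon>_def)
    let ?S = "{p \<in> topspace K. cont_ext K i f p \<in> {l. ereal \<epsilon> \<le> \<bar>l\<bar>}}"
    have "{l::ereal. ereal \<epsilon> \<le> \<bar>l\<bar>} = {l. ereal \<epsilon> \<le> l} \<union> {l. l \<le> ereal (- \<epsilon>)}"
    proof (rule set_eqI)
      fix l :: ereal show "l \<in> {l. ereal \<epsilon> \<le> \<bar>l\<bar>} \<longleftrightarrow> l \<in> {l. ereal \<epsilon> \<le> l} \<union> {l. l \<le> ereal (- \<epsilon>)}"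
        using \<epsilon> by (cases l) auto
    qed
    then have "closed {l::ereal. ereal \<epsilon> \<le> \<bar>l\<bar>}" by (simp add: closed_Collect_le continuous_on_const continuous_on_id closed_Un)
    from closedin_continuous_map_preimage[OF cont_ext_continuous[OF f] iffD1[OF closed_closedin this]]
    have cl: "closedin K ?S" .
    have disj: "?S \<inter> bd = {}" using z \<epsilon> by (auto simp: zero_ereal_def)
    obtain g where g: "g \<in> D0" "\<And>x. i x \<in> ?S \<Longrightarrow> 1 \<le> \<bar>g x\<bar>" using D0_large_on_compact[OF cl disj] by blast
    show ?thesis
    proof (rule D0_dominated[OF FN D0_scale[OF g(1), of "real (Suc n)"]])
      fix x
      show "\<bar>F n x\<bar> \<le> \<bar>real (Suc n) * g x\<bar>"
      proof (cases "\<epsilon> \<le> \<bar>f x\<bar>")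
        case True
        then have "i x \<in> ?S" by (simp add: i_topspace cont_ext_vertex[OF f])
        then have "1 \<le> \<bar>g x\<bar>" by (rule g(2))
        then have "real (Suc n) * 1 \<le> real (Suc n) * \<bar>g x\<bar>" by (intro mult_left_mono) auto
        moreover have "\<bar>F n x\<bar> \<le> real (Suc n)"
          unfolding F_def by (rule abs_band_le[OF inv])
        ultimately have "\<bar>F n x\<bar> \<le> real (Suc n) * \<bar>g x\<bar>" by (simp only: mult_1_right)
        then show ?thesis by (simp only: abs_mult abs_of_nat)
      next
        case False
        then have "F n x = 0"
          using inv[of n] unfolding F_def \<epsilon>_def by (simp add: clip_eq_self)
        then show ?thesis by simp
      qed
    qed
  qed
  have lim: "(\<lambda>n. F n x) \<longlonglongrightarrow> f x" for x
  proof -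
    have 1: "(\<lambda>n. clip (real (Suc n)) (f x)) \<longlonglongrightarrow> f x" using LIMSEQ_Suc[OF clip_tendsto_id] .
    have "(\<lambda>n. clip (inverse (real (Suc n))) (f x)) \<longlonglongrightarrow> max (- 0) (min (f x) 0)"
      unfolding clip_def by (intro tendsto_intros LIMSEQ_inverse_real_of_nat)
    then have 2: "(\<lambda>n. clip (inverse (real (Suc n))) (f x)) \<longlonglongrightarrow> 0" by (simp add: max_def min_def split: if_splits)
    show ?thesis unfolding F_def using tendsto_diff[OF 1 2] by simp
  qed
  show ?thesis by (rule D0_pointwise_limit[OF FD lim FE])
qed

subsection \<open>The trace map\<close>

lemma gamma_bd: "p \<in> bd \<Longrightarrow> \<gamma> f p = cont_ext K i f p"
  by (simp add: gamma_def)

lemma gamma_cong_D0: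
  assumes f: "f \<in> N" and g: "g \<in> N" and d: "(f \<ominus> g) \<in> D0"
  shows "\<gamma> f = \<gamma> g"
proof -
  have "cont_ext K i f p = cont_ext K i g p" if p: "p \<in> bd" for p
  proof -
    have "((\<lambda>x. ereal (f x - g x)) \<longlongrightarrow> ereal 0) (near p)" using bdry_D0(2)[OF p d] by simp
    \<comment> \<open>Adding a null function preserves infinite limits as well.\<close>
    then have "((\<lambda>x. ereal (g x) + ereal (f x - g x)) \<longlongrightarrow> cont_ext K i g p + ereal 0) (near p)"
      by (intro tendsto_add_ereal_general1 cont_ext_tendsto[OF g bd_topspace[OF p]]) auto
    then have "((\<lambda>x. ereal (f x)) \<longlongrightarrow> cont_ext K i g p) (near p)" by (simp add: zero_ereal_def[symmetric])
    then show ?thesis by (rule cont_ext_eqI[OF f bd_topspace[OF p]])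
  qed
  then show ?thesis by (auto simp: gamma_def restrict_def)
qed

lemma gamma_clip:
  assumes f: "f \<in> N" and r: "0 \<le> r" and p: "p \<in> bd"
  shows "\<gamma> (\<lambda>x. clip r (f x)) p = ereal (clip_ext r (\<gamma> f p))"
proof -
  note pK = bd_topspace[OF p]
  have "((\<lambda>x. ereal (clip r (f x))) \<longlongrightarrow> ereal (clip_ext r (cont_ext K i f p))) (near p)"
    using tendsto_clip_ext[OF cont_ext_tendsto[OF f pK] r] by simp
  from cont_ext_eqI[OF N_normal_contraction(1)[OF f normal_contraction_clip[OF r]] pK this]
  show ?thesis by (simp add: gamma_bd[OF p])
qed

text \<open>
  The difference of two infinite boundary values is undefined, so \<open>f\<close> and \<open>g\<close> are compared after clipping,
  where all boundary values are finite.
\<close>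

lemma D0_if_gamma_eq:
  assumes f: "f \<in> N" and g: "g \<in> N" and eq: "\<gamma> f = \<gamma> g"
  shows "(f \<ominus> g) \<in> D0"
proof -
  define F where "F n x = clip (real n) (f x) - clip (real n) (g x)" for n x
  note C = normal_contraction_clip[OF of_nat_0_le_iff]
  have cf: "(\<lambda>x. clip (real n) (h x)) \<in> N" "quad E (\<lambda>x. clip (real n) (h x)) \<le> E h h"
    if "h \<in> N" for h n using N_normal_contraction[OF that C[of n]] .
  have FN: "F n \<in> N" for n unfolding F_def by (intro diff_mem cf f g)
  have FE: "quad E (F n) \<le> 2 * E f f + 2 * E g g" for n
  proof -
    have "quad E (F n) \<le> 2 * quad E (\<lambda>x. clip (real n) (f x))
        + 2 * quad E (\<lambda>x. clip (real n) (g x))"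
      using norm_add_le[OF cf(1)[OF f] scale_mem[OF cf(1)[OF g], of "-1"], of n n]
        norm_scale[OF cf(1)[OF g], of "-1" n] by (simp add: F_def[abs_def])
    then show ?thesis using cf(2)[OF f, of n] cf(2)[OF g, of n] by simp
  qed
  have FD: "F n \<in> D0" for n
  proof (rule vanishing_boundary_values[OF FN])
    fix p assume p: "p \<in> bd"
    note pK = bd_topspace[OF p]
    have "cont_ext K i f p = cont_ext K i g p" using eq p by (metis gamma_bd)
    then have "(F n \<longlongrightarrow> 0) (near p)"
      unfolding F_def[abs_def]
      using tendsto_diff[OF tendsto_clip_ext[OF cont_ext_tendsto[OF f pK] of_nat_0_le_iff[of n]]
          tendsto_clip_ext[OF cont_ext_tendsto[OF g pK] of_nat_0_le_iff[of n]]] by simp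
    then have "((\<lambda>x. ereal (F n x)) \<longlongrightarrow> ereal 0) (near p)" by simp
    from cont_ext_eqI[OF FN pK this] show "cont_ext K i (F n) p = 0" by (simp add: zero_ereal_def)
  qed
  have lim: "(\<lambda>n. F n x) \<longlonglongrightarrow> f x - g x" for x
    unfolding F_def by (intro tendsto_diff clip_tendsto_id)
  show ?thesis by (rule D0_pointwise_limit[OF FD lim FE])
qed

lemma gamma_harm: "f \<in> N \<Longrightarrow> \<gamma> (harm f) = \<gamma> f"
  using gamma_cong_D0[OF _ harm_N, of f f] royden0_D0[of f] by (simp add: harm_def)

lemma harmonic_ext_gamma:
  assumes f: "f \<in> N" shows "harmonic_ext m b c K i (\<gamma> f) = harm f"
  unfolding harmonic_ext_def
proof (rule the_equality)
  show "harm f \<in> N \<and> harmonic1 m b c (harm f) \<and> \<gamma> (harm f) = \<gamma> f"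
    using royden[OF f] gamma_harm[OF f] by simp
  fix h assume h: "h \<in> N \<and> harmonic1 m b c h \<and> \<gamma> h = \<gamma> f"
  then have "(h \<ominus> harm f) \<in> D0" using D0_if_gamma_eq harm_N[OF f] gamma_harm[OF f] by simp
  moreover have "harmonic1 m b c (h \<ominus> harm f)" using h royden[OF f] by (intro harmonic1_diff) auto
  ultimately have "h x - harm f x = 0" for x by (rule harmonic_D0_zero)
  then show "h = harm f" by (simp add: fun_eq_iff)
qed

end

section \<open>The trace as a map into \<open>L\<^sup>2\<close>\<close>

text \<open>
  The vertex \<open>z\<close> is the base point whose harmonic measure defines \<open>L\<^sup>2(\<partial>X)\<close>. The bounded densities
  transport null sets of this measure to the measures of all other vertices.
\<close>

locale harmonic_boundary = graph_compactification +
  fixes hm :: "'a \<Rightarrow> 'b measure" and z :: 'a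
  assumes harmonic_measures: "\<And>x. harmonic_measure m b c K i x (hm x)"
    and bounded_densities: "\<And>x y. bounded_density (hm x) (hm y)"
begin

abbreviation "\<mu> \<equiv> hm z"

lemma space_hm: "space (hm x) = bd" and sets_hm: "sets (hm x) = sigma_sets bd {U. openin (subtopology K bd) U}"
proof -
  have "topspace (subtopology K bd) = bd" using bd_topspace by auto
  then show "space (hm x) = bd" "sets (hm x) = sigma_sets bd {U. openin (subtopology K bd) U}"
    using harmonic_measures[of x] unfolding harmonic_measure_def radon_on_def by auto
qed

lemma finite_measure_hm: "finite_measure (hm x)"
proof
  have "emeasure (hm x) (space (hm x)) \<le> 1"
    using harmonic_measures[of x] by (simp add: harmonic_measure_def space_hm)
  then show "emeasure (hm x) (space (hm x)) \<noteq> \<infinity>" by (auto simp: top_unique)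
qed

lemma AE_hm: "AE p in \<mu>. P p \<Longrightarrow> AE p in hm x. P p"
proof -
  assume P: "AE p in \<mu>. P p"
  obtain \<rho> where \<rho>: "\<rho> \<in> borel_measurable \<mu>" "hm x = density \<mu> \<rho>"
    using bounded_densities[of z x] unfolding bounded_density_def by blast
  show ?thesis unfolding \<rho>(2) AE_density[OF \<rho>(1)] using P by (rule eventually_mono) simp
qed

lemma AE_bd: "(\<And>p. p \<in> bd \<Longrightarrow> P p) \<Longrightarrow> AE p in hm x. P p"
  by (rule AE_I2) (simp add: space_hm)

lemma measurable_gamma: "f \<in> N \<Longrightarrow> \<gamma> f \<in> borel_measurable (hm x)"
proof (rule borel_measurableI)
  fix S :: "ereal set" assume f: "f \<in> N" and S: "open S"
  let ?U = "{p \<in> topspace K. cont_ext K i f p \<in> S}"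
  have "openin K ?U" by (rule openin_continuous_map_preimage[OF cont_ext_continuous[OF f] iffD1[OF open_openin S]])
  then have "openin (subtopology K bd) (?U \<inter> bd)" by (auto simp: openin_subtopology)
  moreover have "\<gamma> f -` S \<inter> space (hm x) = ?U \<inter> bd"
    unfolding space_hm using bd_topspace gamma_bd by auto
  ultimately show "\<gamma> f -` S \<inter> space (hm x) \<in> sets (hm x)" unfolding sets_hm by (simp add: sigma_sets.Basic)
qed

lemma measurable_gammaL2: "f \<in> N \<Longrightarrow> \<gamma>2 f \<in> borel_measurable (hm x)"
  unfolding gammaL2_def by (intro borel_measurable_real_of_ereal measurable_gamma)

lemma harm_integral:
  assumes f: "f \<in> N" and le: "\<And>x. \<bar>f x\<bar> \<le> r"
  shows "harm f x = (\<integral>p. \<gamma>2 f p \<partial>hm x)"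
proof -
  have "f \<in> N \<inter> bddfun" using f le by (auto simp: bddfun_def bounded_iff)
  then have "harmonic_ext m b c K i (\<gamma> f) x = (\<integral>p. real_of_ereal (\<gamma> f p) \<partial>hm x)"
    using harmonic_measures[of x] unfolding harmonic_measure_def by blast
  then show ?thesis unfolding harmonic_ext_gamma[OF f] gammaL2_def .
qed

lemma gamma_bounded:
  assumes f: "f \<in> N" and le: "\<And>x. \<bar>f x\<bar> \<le> r" and p: "p \<in> bd"
  shows "\<gamma> f p = ereal (\<gamma>2 f p)" and "\<bar>\<gamma>2 f p\<bar> \<le> r"
proof -
  have r: "0 \<le> r" using order_trans[OF abs_ge_zero le] .
  have "(\<lambda>x. clip r (f x)) = f" using clip_eq_self[OF le] by auto
  with gamma_clip[OF f r p] have e: "\<gamma> f p = ereal (clip_ext r (\<gamma> f p))" by simp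
  have "\<bar>clip_ext r l\<bar> \<le> r" for l using r abs_clip_le[OF r] by (auto simp: clip_ext_def)
  with e show "\<gamma> f p = ereal (\<gamma>2 f p)" "\<bar>\<gamma>2 f p\<bar> \<le> r" unfolding gammaL2_def by (metis real_of_ereal.simps(1))+
qed

lemma gamma_tendsto:
  assumes f: "f \<in> N" and p: "p \<in> bd" and fin: "\<bar>\<gamma> f p\<bar> \<noteq> \<infinity>"
  shows "(f \<longlongrightarrow> \<gamma>2 f p) (near p)"
proof -
  have "cont_ext K i f p = ereal (\<gamma>2 f p)" using fin by (simp add: gammaL2_def gamma_bd[OF p] ereal_real)
  then show ?thesis by (rule cont_ext_real[OF f bd_topspace[OF p]])
qed

lemma gammaL2_eqI:
  assumes f: "f \<in> N" and p: "p \<in> bd" and lim: "(f \<longlongrightarrow> t) (near p)"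
  shows "\<gamma>2 f p = t"
proof -
  have "((\<lambda>x. ereal (f x)) \<longlongrightarrow> ereal t) (near p)" using lim by simp
  from cont_ext_eqI[OF f bd_topspace[OF p] this] show ?thesis by (simp add: gammaL2_def gamma_bd[OF p])
qed

lemma gammaL2_square:
  assumes f: "f \<in> N" and le: "\<And>x. \<bar>f x\<bar> \<le> r" and p: "p \<in> bd"
  shows "\<gamma>2 (\<lambda>x. (f x)\<^sup>2) p = (\<gamma>2 f p)\<^sup>2"
proof -
  have "(f \<longlongrightarrow> \<gamma>2 f p) (near p)" by (rule gamma_tendsto[OF f p]) (simp add: gamma_bounded(1)[OF f le p])
  then have "((\<lambda>x. (f x)\<^sup>2) \<longlongrightarrow> (\<gamma>2 f p)\<^sup>2) (near p)" by (rule tendsto_power)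
  then show ?thesis by (rule gammaL2_eqI[OF square_mem[OF f le] p])
qed

text \<open>
  The integral of \<open>(\<gamma>f)\<^sup>2 = \<gamma>(f\<^sup>2)\<close> is the value at \<open>x\<close> of the harmonic part of \<open>f\<^sup>2\<close>.
\<close>

lemma bounded_trace_bound:
  assumes f: "f \<in> N" and le: "\<And>x. \<bar>f x\<bar> \<le> r"
  shows "normsq (hm x) (\<gamma>2 f) \<le> ennreal (3 / m x * E f f)"
proof -
  interpret finite_measure "hm x" by (rule finite_measure_hm)
  have int: "integrable (hm x) (\<lambda>p. (\<gamma>2 f p)\<^sup>2)"
  proof (rule integrable_const_bound[where B = "r\<^sup>2"])
    show "AE p in hm x. norm ((\<gamma>2 f p)\<^sup>2) \<le> r\<^sup>2"
      using gamma_bounded(2)[OF f le] by (intro AE_bd) (metis abs_ge_zero norm_power power_mono real_norm_def)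
    show "(\<lambda>p. (\<gamma>2 f p)\<^sup>2) \<in> borel_measurable (hm x)" using measurable_gammaL2[OF f] by simp
  qed
  have sqb: "\<bar>(f y)\<^sup>2\<bar> \<le> r\<^sup>2" for y using le[of y] by (metis abs_ge_zero power2_abs power_abs power_mono)
  have "normsq (hm x) (\<gamma>2 f) = ennreal (\<integral>p. (\<gamma>2 f p)\<^sup>2 \<partial>hm x)"
    unfolding normsq_def by (rule nn_integral_eq_integral[OF int]) simp
  also have "(\<integral>p. (\<gamma>2 f p)\<^sup>2 \<partial>hm x) = (\<integral>p. \<gamma>2 (\<lambda>x. (f x)\<^sup>2) p \<partial>hm x)"
    by (rule Bochner_Integration.integral_cong) (auto simp: space_hm gammaL2_square[OF f le])
  also have "\<dots> = harm (\<lambda>x. (f x)\<^sup>2) x"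
    by (rule harm_integral[OF square_mem[OF f le] sqb, symmetric])
  also have "ennreal \<dots> \<le> ennreal (3 / m x * E f f)"
    using bounded_square_bound[OF f le, of x] by (intro ennreal_leI) simp
  finally show ?thesis .
qed

text \<open>
  Fatou's lemma for the clipped functions. The lower limit \<open>L\<close> of their squared traces is infinite where
  \<open>\<gamma>f\<close> is infinite, so its finite integral also shows that \<open>\<gamma>f\<close> is finite almost everywhere.
\<close>

lemma trace_bound_by_clipping:
  assumes f: "f \<in> N"
  shows AE_gamma_finite_hm: "AE p in hm x. \<bar>\<gamma> f p\<bar> \<noteq> \<infinity>"
    and trace_bound_hm: "normsq (hm x) (\<gamma>2 f) \<le> ennreal (3 / m x * E f f)"
proof -
  define F where "F n = (\<lambda>y. clip (real n) (f y))" for n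
  note C = normal_contraction_clip[OF of_nat_0_le_iff]
  have FN: "F n \<in> N" and FE: "quad E (F n) \<le> E f f" for n
    using N_normal_contraction[OF f C[of n]] by (simp_all add: F_def)
  have Fb: "\<bar>F n y\<bar> \<le> real n" for n y unfolding F_def by (rule abs_clip_le) simp
  have F\<gamma>: "\<gamma>2 (F n) p = clip_ext (real n) (\<gamma> f p)" if "p \<in> bd" for n p
    using gamma_clip[OF f of_nat_0_le_iff that, of n] by (simp add: gammaL2_def F_def)
  define L where "L p = liminf (\<lambda>n. ennreal ((\<gamma>2 (F n) p)\<^sup>2))" for p
  have Lfin: "L p = ennreal ((\<gamma>2 f p)\<^sup>2)" if p: "p \<in> bd" and fin: "\<bar>\<gamma> f p\<bar> \<noteq> \<infinity>" for p
    unfolding L_def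
  proof (rule lim_imp_Liminf)
    have "clip_ext (real n) (\<gamma> f p) = clip (real n) (\<gamma>2 f p)" for n
      using fin by (cases "\<gamma> f p") (auto simp: clip_ext_def gammaL2_def)
    then show "(\<lambda>n. ennreal ((\<gamma>2 (F n) p)\<^sup>2)) \<longlonglongrightarrow> ennreal ((\<gamma>2 f p)\<^sup>2)"
      unfolding F\<gamma>[OF p] by (auto intro!: tendsto_ennrealI tendsto_power clip_tendsto_id)
  qed simp
  have Linf: "L p = \<infinity>" if p: "p \<in> bd" and inf: "\<bar>\<gamma> f p\<bar> = \<infinity>" for p
    unfolding L_def
  proof (rule lim_imp_Liminf)
    have eq: "(clip_ext (real n) (\<gamma> f p))\<^sup>2 = (real n)\<^sup>2" for n
      using inf by (cases "\<gamma> f p") (auto simp: clip_ext_def)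
    have "filterlim (\<lambda>n. (real n)\<^sup>2) at_top sequentially"
    proof (rule filterlim_at_top_mono[OF filterlim_real_sequentially])
      show "eventually (\<lambda>n. real n \<le> (real n)\<^sup>2) sequentially"
        by (intro always_eventually allI) (metis of_nat_le_iff of_nat_power power2_nat_le_imp_le order_refl le_square power2_eq_square)
    qed
    then show "(\<lambda>n. ennreal ((\<gamma>2 (F n) p)\<^sup>2)) \<longlonglongrightarrow> \<infinity>"
      unfolding F\<gamma>[OF p] eq by (simp add: ennreal_tendsto_top_eq_at_top)
  qed simp
  have Lm: "L \<in> borel_measurable (hm x)"
    unfolding L_def[abs_def] using measurable_gammaL2[OF FN] by measurable
  have "(\<integral>\<^sup>+p. L p \<partial>hm x) \<le> liminf (\<lambda>n. normsq (hm x) (\<gamma>2 (F n)))"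
    unfolding L_def normsq_def using measurable_gammaL2[OF FN] by (intro nn_integral_liminf) measurable
  also have "\<dots> \<le> limsup (\<lambda>n. normsq (hm x) (\<gamma>2 (F n)))" by (rule Liminf_le_Limsup) simp
  also have "\<dots> \<le> ennreal (3 / m x * E f f)"
  proof (rule Limsup_bounded, intro always_eventually allI)
    fix n
    have "3 / m x * quad E (F n) \<le> 3 / m x * E f f"
      using FE[of n] m_pos[of x] by (intro mult_left_mono) auto
    then show "normsq (hm x) (\<gamma>2 (F n)) \<le> ennreal (3 / m x * E f f)"
      using bounded_trace_bound[OF FN Fb, of x n] by (meson ennreal_leI order_trans)
  qed
  finally have Lint: "(\<integral>\<^sup>+p. L p \<partial>hm x) \<le> ennreal (3 / m x * E f f)" .
  then have "(\<integral>\<^sup>+p. L p \<partial>hm x) \<noteq> \<infinity>" by (auto simp: top_unique)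
  then have "AE p in hm x. L p \<noteq> \<infinity>" by (rule nn_integral_PInf_AE[OF Lm])
  then show "AE p in hm x. \<bar>\<gamma> f p\<bar> \<noteq> \<infinity>"
    using AE_space by eventually_elim (auto simp: space_hm Linf)
  have "normsq (hm x) (\<gamma>2 f) \<le> (\<integral>\<^sup>+p. L p \<partial>hm x)"
    unfolding normsq_def
  proof (rule nn_integral_mono)
    fix p assume "p \<in> space (hm x)"
    then have p: "p \<in> bd" by (simp add: space_hm)
    show "ennreal ((\<gamma>2 f p)\<^sup>2) \<le> L p"
      using Lfin[OF p] Linf[OF p] by (cases "\<bar>\<gamma> f p\<bar> = \<infinity>") auto
  qed
  with Lint show "normsq (hm x) (\<gamma>2 f) \<le> ennreal (3 / m x * E f f)" by simp
qed

lemmas AE_gamma_finite = AE_gamma_finite_hm[where x = z]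

lemma gammaL2_L2: "f \<in> N \<Longrightarrow> \<gamma>2 f \<in> L2 \<mu>"
proof -
  assume f: "f \<in> N"
  have "normsq \<mu> (\<gamma>2 f) < \<infinity>" using trace_bound_hm[OF f, of z] ennreal_less_top le_less_trans by fastforce
  then show ?thesis using measurable_gammaL2[OF f] by (simp add: L2_iff)
qed

lemma trace_bound: "f \<in> N \<Longrightarrow> L2_inner \<mu> (\<gamma>2 f) (\<gamma>2 f) \<le> 3 / m z * E f f"
  using trace_bound_hm[of f z] normsq_L2[OF gammaL2_L2, of f] nonneg[of f] m_pos[of z]
    L2.nonneg[OF gammaL2_L2, of f] by simp

lemma gammaL2_lincomb:
  assumes f: "f \<in> N" and g: "g \<in> N"
  shows "AE p in \<mu>. \<gamma>2 (\<lambda>x. f x + a * g x) p = \<gamma>2 f p + a * \<gamma>2 g p"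
  using AE_gamma_finite[OF f] AE_gamma_finite[OF g] AE_space
proof eventually_elim
  case (elim p)
  then have p: "p \<in> bd" by (simp add: space_hm)
  have "((\<lambda>x. f x + a * g x) \<longlongrightarrow> \<gamma>2 f p + a * \<gamma>2 g p) (near p)"
    by (intro tendsto_intros gamma_tendsto f g p elim)
  then show ?case by (rule gammaL2_eqI[OF lincomb_mem[OF f g] p])
qed

lemma gammaL2_contraction:
  assumes f: "f \<in> N" and C: "normal_contraction C"
  shows "AE p in \<mu>. \<gamma>2 (\<lambda>x. C (f x)) p = C (\<gamma>2 f p)"
  using AE_gamma_finite[OF f] AE_space
proof eventually_elim
  case (elim p)
  then have p: "p \<in> bd" by (simp add: space_hm)
  have "((\<lambda>x. f x - \<gamma>2 f p) \<longlongrightarrow> 0) (near p)" using gamma_tendsto[OF f p] elim by (simp add: LIM_zero_iff)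
  then have l: "((\<lambda>x. \<bar>f x - \<gamma>2 f p\<bar>) \<longlongrightarrow> 0) (near p)" by (simp add: tendsto_rabs_zero_iff)
  have "\<forall>x. norm (C (f x) - C (\<gamma>2 f p)) \<le> \<bar>f x - \<gamma>2 f p\<bar>" using C by (simp add: normal_contraction_def)
  from Lim_null_comparison[OF always_eventually[OF this] l]
  have "((\<lambda>x. C (f x)) \<longlongrightarrow> C (\<gamma>2 f p)) (near p)" by (simp add: LIM_zero_iff)
  then show ?case by (rule gammaL2_eqI[OF N_normal_contraction(1)[OF f C] p])
qed

lemma gammaL2_D0: "f \<in> D0 \<Longrightarrow> AE p in \<mu>. \<gamma>2 f p = 0"
  by (rule AE_bd) (simp add: gammaL2_def gamma_bd bdry_D0(1))

text \<open>
  The harmonic parts of the clipped functions are integrals of their traces at every vertex, hence zero.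
\<close>

lemma D0_if_gammaL2_zero:
  assumes f: "f \<in> N" and zero: "AE p in \<mu>. \<gamma>2 f p = 0"
  shows "f \<in> D0"
proof -
  define F where "F n = (\<lambda>y. clip (real n) (f y))" for n
  note C = normal_contraction_clip[OF of_nat_0_le_iff]
  have FN: "F n \<in> N" and FE: "quad E (F n) \<le> E f f" for n
    using N_normal_contraction[OF f C[of n]] by (simp_all add: F_def)
  have Fb: "\<bar>F n y\<bar> \<le> real n" for n y unfolding F_def by (rule abs_clip_le) simp
  have FD: "F n \<in> D0" for n
  proof -
    have "AE p in \<mu>. \<gamma>2 (F n) p = clip (real n) (\<gamma>2 f p)"
      unfolding F_def by (rule gammaL2_contraction[OF f C])
    with zero have "AE p in \<mu>. \<gamma>2 (F n) p = 0" by eventually_elim (simp add: clip_def)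
    then have "AE p in hm x. \<gamma>2 (F n) p = 0" for x by (rule AE_hm)
    then have "harm (F n) x = 0" for x
      unfolding harm_integral[OF FN Fb] using integral_eq_zero_AE by blast
    then have "F n = royden0 m b c (F n)" by (simp add: harm_def fun_eq_iff)
    then show ?thesis using royden0_D0[OF FN] by metis
  qed
  have "(\<lambda>n. F n x) \<longlonglongrightarrow> f x" for x unfolding F_def by (rule clip_tendsto_id)
  then show ?thesis by (rule D0_pointwise_limit[OF FD _ FE])
qed

end

section \<open>Trace forms\<close>

lemma polar_cong_AE:
  assumes Q: "quadratic_form M Q" and dom: "f \<in> form_dom Q" "f' \<in> form_dom Q" "g \<in> form_dom Q"
    and ae: "AE x in M. f x = f' x"
  shows "polar Q f g = polar Q f' g"
proof -
  interpret inner_fun_space "form_dom Q" "polar Q" by (rule quadratic_formD(3)[OF Q])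
  note L = form_dom_L2[OF Q]
  have "Q (f \<oplus> g) = Q (f' \<oplus> g)"
    by (rule quadratic_formD(2)[OF Q L[OF add_mem[OF dom(1,3)]] L[OF add_mem[OF dom(2,3)]]])
       (use ae in eventually_elim, simp)
  moreover have "Q (f \<ominus> g) = Q (f' \<ominus> g)"
    by (rule quadratic_formD(2)[OF Q L[OF diff_mem[OF dom(1,3)]] L[OF diff_mem[OF dom(2,3)]]])
       (use ae in eventually_elim, simp)
  ultimately show ?thesis unfolding polar_def by simp
qed

lemma form_dom_cong_AE:
  assumes Q: "quadratic_form M Q" and "f \<in> form_dom Q" "g \<in> L2 M" "AE x in M. f x = g x"
  shows "g \<in> form_dom Q" and "Q g = Q f"
  using quadratic_formD(2)[OF Q form_dom_L2[OF Q assms(2)] assms(3,4)] assms(2) by (simp_all add: form_dom_def)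

lemma quad_polar_cong_AE:
  assumes Q: "quadratic_form M Q" and f: "f \<in> form_dom Q" and g: "g \<in> L2 M" and ae: "AE x in M. f x = g x"
  shows "quad (polar Q) g = quad (polar Q) f"
proof -
  interpret inner_fun_space "form_dom Q" "polar Q" by (rule quadratic_formD(3)[OF Q])
  note g' = form_dom_cong_AE[OF Q f g ae]
  show ?thesis using g'(2) quadratic_formD(4)[OF Q] f g'(1) nonneg[OF f] nonneg[OF g'(1)] by simp
qed

lemma L2_normal_contraction:
  assumes "f \<in> L2 M" "normal_contraction C" shows "(\<lambda>x. C (f x)) \<in> L2 M"
proof -
  have lip: "norm (C s - C t) \<le> norm (s - t)" for s t using assms(2) by (simp add: normal_contraction_def)
  have "continuous_on UNIV C"
    unfolding continuous_on_iff dist_norm using lip by (metis le_less_trans)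
  then have "C \<in> borel_measurable borel" by (rule borel_measurable_continuous_onI)
  then have meas: "(\<lambda>x. C (f x)) \<in> borel_measurable M" using assms(1) by (auto simp: L2_def)
  have le: "\<bar>C s\<bar> \<le> \<bar>s\<bar>" for s using lip[of s 0] assms(2) by (simp add: normal_contraction_def)
  have "normsq M (\<lambda>x. C (f x)) \<le> normsq M f"
    unfolding normsq_def by (intro nn_integral_mono ennreal_leI) (simp add: le abs_le_square_iff[symmetric])
  then show ?thesis using meas assms(1) by (auto simp: L2_iff intro: le_less_trans)
qed

lemma (in weighted_graph) densely_defined_if_finsupp:
  assumes "finsupp \<subseteq> form_dom Q" shows "densely_defined V Q"
  unfolding densely_defined_def
proof (intro ballI allI impI)
  fix f :: "'a \<Rightarrow> real" and e :: ennreal assume f: "f \<in> L2 V" and e: "0 < e"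
  define g where "g n x = (if to_nat x < n then f x else 0)" for n :: nat and x :: 'a
  have gs: "g n \<in> finsupp" for n
  proof -
    have "finite {x. g n x \<noteq> 0}" by (rule rev_finite_subset[OF finite_to_nat_less[of n]]) (auto simp: g_def)
    then show ?thesis by (simp add: finsupp_def)
  qed
  have "(\<lambda>n. normsq V (f \<ominus> g n)) \<longlonglongrightarrow> (\<integral>\<^sup>+x. 0 \<partial>count_space (UNIV::'a set))"
    unfolding normsq_vmeas
  proof (rule nn_integral_dominated_convergence[where w = "\<lambda>x. ennreal (m x * (f x)\<^sup>2)"])
    show "(\<integral>\<^sup>+x. ennreal (m x * (f x)\<^sup>2) \<partial>count_space UNIV) < \<infinity>" using f by (simp add: L2_vmeas normsq_vmeas)
    show "AE x in count_space UNIV. ennreal (m x * (f x - g n x)\<^sup>2) \<le> ennreal (m x * (f x)\<^sup>2)" for n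
      by (simp add: AE_count_space g_def m_pos less_imp_le)
    show "AE x in count_space UNIV. (\<lambda>n. ennreal (m x * (f x - g n x)\<^sup>2)) \<longlonglongrightarrow> 0"
      unfolding AE_count_space
    proof (intro ballI tendsto_eventually)
      fix x
      show "eventually (\<lambda>n. ennreal (m x * (f x - g n x)\<^sup>2) = 0) sequentially"
        unfolding eventually_sequentially by (rule exI[of _ "Suc (to_nat x)"]) (auto simp: g_def)
    qed
  qed simp_all
  then have "(\<lambda>n. normsq V (f \<ominus> g n)) \<longlonglongrightarrow> 0" by simp
  from order_tendstoD(2)[OF this e] obtain n where "normsq V (f \<ominus> g n) < e"
    by (auto simp: eventually_sequentially)
  then show "\<exists>g\<in>form_dom Q. normsq V (f \<ominus> g) < e" using gs assms by blast
qed

lemma (in weighted_graph) QN_DF: "QN m b c \<in> DF m b c"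
proof -
  have "form_le V (QN m b c) (QD m b c)"
    unfolding form_le_def using QD_eq_QN by (auto simp: QD_def)
  then show ?thesis
    unfolding DF_def dirichlet_form_def dirichlet_form_wide_def
    using quadratic_form_QN closed_form_QN markovian_QN densely_defined_if_finsupp[OF finsupp_N]
    by (simp add: form_le_def)
qed

lemma (in weighted_graph) DF_extension:
  assumes "Q \<in> DF m b c" shows "graph_form_extension m b c Q"
proof -
  have Q: "quadratic_form V Q" "closed_form V Q" "markovian V Q" "form_le V (QN m b c) Q" "form_le V Q (QD m b c)"
    using assms by (auto simp: DF_def dirichlet_form_def dirichlet_form_wide_def)
  have "finsupp \<subseteq> form_dom Q"
  proof
    fix f :: "'a \<Rightarrow> real" assume "f \<in> finsupp"
    then have f: "f \<in> D0" using finsupp_D0 by blast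
    then have "Q f \<le> QD m b c f" using Q(5) form_dom_L2[OF quadratic_form_QD] by (simp add: form_le_def form_dom_QD)
    moreover have "QD m b c f < \<infinity>" using f form_dom_QD unfolding form_dom_def by blast
    ultimately show "f \<in> form_dom Q" unfolding form_dom_def by (simp add: le_less_trans)
  qed
  with Q graph show ?thesis by unfold_locales auto
qed

lemma (in weighted_graph) harmonic1_lincomb:
  assumes "f \<in> N" "g \<in> N" "harmonic1 m b c f" "harmonic1 m b c g"
  shows "harmonic1 m b c (\<lambda>x. f x + a * g x)"
  using assms(3,4) add_left[OF assms(1) scale_mem[OF assms(2)] delta_mem] scale_left[OF assms(2) delta_mem]
  by (simp add: harmonic1_iff_delta lincomb_mem assms(1,2))

context harmonic_boundary
begin

text \<open>
  The domain of \<open>q\<^sup>D\<^sup>N\<close>: all square integrable functions that are traces up to null sets.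
\<close>

definition trace_space :: "('b \<Rightarrow> real) set" where
  "trace_space = {\<phi> \<in> L2 \<mu>. \<exists>f\<in>N. AE p in \<mu>. \<phi> p = \<gamma>2 f p}"

text \<open>
  The harmonic extension of a class in \<open>L\<^sup>2(\<partial>X)\<close>. By \<open>hext_eq\<close> the choice of a function with the given trace
  does not matter.
\<close>

definition hext :: "('b \<Rightarrow> real) \<Rightarrow> 'a \<Rightarrow> real" where
  "hext \<phi> = harm (SOME f. f \<in> N \<and> (AE p in \<mu>. \<phi> p = \<gamma>2 f p))"

lemma harm_eq_if_trace_eq:
  assumes f: "f \<in> N" and g: "g \<in> N" and ae: "AE p in \<mu>. \<gamma>2 f p = \<gamma>2 g p"
  shows "(f \<ominus> g) \<in> D0" and "harm f = harm g"
proof -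
  have "AE p in \<mu>. \<gamma>2 (\<lambda>x. f x + (-1) * g x) p = 0"
    using gammaL2_lincomb[OF f g, of "-1"] ae by eventually_elim simp
  from D0_if_gammaL2_zero[OF lincomb_mem[OF f g] this] show d: "(f \<ominus> g) \<in> D0" by simp
  show "harm f = harm g" by (rule harm_cong[OF f g d])
qed

lemma hext_eq:
  assumes f: "f \<in> N" and ae: "AE p in \<mu>. \<phi> p = \<gamma>2 f p"
  shows "hext \<phi> = harm f"
proof -
  define g where "g = (SOME f. f \<in> N \<and> (AE p in \<mu>. \<phi> p = \<gamma>2 f p))"
  have g: "g \<in> N \<and> (AE p in \<mu>. \<phi> p = \<gamma>2 g p)"
    unfolding g_def by (rule someI[of _ f]) (use f ae in simp)
  have "AE p in \<mu>. \<gamma>2 g p = \<gamma>2 f p" using ae g[THEN conjunct2] by eventually_elim simp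
  with g f have "harm g = harm f" by (intro harm_eq_if_trace_eq) auto
  then show ?thesis unfolding hext_def g_def .
qed

lemma gammaL2_trace_space: "f \<in> N \<Longrightarrow> \<gamma>2 f \<in> trace_space"
  using gammaL2_L2 unfolding trace_space_def by blast

lemma hext_gammaL2: "f \<in> N \<Longrightarrow> hext (\<gamma>2 f) = harm f"
  by (rule hext_eq) auto

lemma AE_gammaL2_harm: "f \<in> N \<Longrightarrow> AE p in \<mu>. \<gamma>2 (harm f) p = \<gamma>2 f p"
  by (simp add: gammaL2_def gamma_harm)

lemma hext:
  assumes "\<phi> \<in> trace_space"
  shows hext_N: "hext \<phi> \<in> N" and harmonic_hext: "harmonic1 m b c (hext \<phi>)"
    and trace_hext: "AE p in \<mu>. \<phi> p = \<gamma>2 (hext \<phi>) p" and trace_space_L2: "\<phi> \<in> L2 \<mu>"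
proof -
  obtain f where f: "f \<in> N" and ae: "AE p in \<mu>. \<phi> p = \<gamma>2 f p" using assms by (auto simp: trace_space_def)
  note e = hext_eq[OF f ae]
  show "hext \<phi> \<in> N" "harmonic1 m b c (hext \<phi>)" using royden[OF f] by (simp_all add: e)
  show "AE p in \<mu>. \<phi> p = \<gamma>2 (hext \<phi>) p" unfolding e using ae AE_gammaL2_harm[OF f] by eventually_elim simp
  show "\<phi> \<in> L2 \<mu>" using assms by (simp add: trace_space_def)
qed

lemma trace_lincomb:
  assumes \<phi>: "\<phi> \<in> trace_space" and \<psi>: "\<psi> \<in> trace_space"
  shows trace_space_lincomb: "(\<lambda>p. \<phi> p + a * \<psi> p) \<in> trace_space"
    and hext_lincomb: "hext (\<lambda>p. \<phi> p + a * \<psi> p) = (\<lambda>x. hext \<phi> x + a * hext \<psi> x)"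
proof -
  let ?f = "\<lambda>x. hext \<phi> x + a * hext \<psi> x"
  have f: "?f \<in> N" by (rule lincomb_mem[OF hext_N[OF \<phi>] hext_N[OF \<psi>]])
  have ae: "AE p in \<mu>. \<phi> p + a * \<psi> p = \<gamma>2 ?f p"
    using gammaL2_lincomb[OF hext_N[OF \<phi>] hext_N[OF \<psi>], of a] trace_hext[OF \<phi>] trace_hext[OF \<psi>]
    by eventually_elim simp
  show "(\<lambda>p. \<phi> p + a * \<psi> p) \<in> trace_space"
    unfolding trace_space_def using f ae L2.lincomb_mem[OF trace_space_L2[OF \<phi>] trace_space_L2[OF \<psi>], of a] by blast
  show "hext (\<lambda>p. \<phi> p + a * \<psi> p) = ?f"
    unfolding hext_eq[OF f ae]
    by (rule harm_harmonic[OF f harmonic1_lincomb]) (intro hext_N harmonic_hext \<phi> \<psi>)+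
qed

lemma trace_contraction:
  assumes \<phi>: "\<phi> \<in> trace_space" and C: "normal_contraction C"
  shows trace_space_contraction: "(\<lambda>p. C (\<phi> p)) \<in> trace_space"
    and hext_contraction: "hext (\<lambda>p. C (\<phi> p)) = harm (\<lambda>x. C (hext \<phi> x))"
proof -
  note f = hext_N[OF \<phi>]
  note Cf = N_normal_contraction(1)[OF f C]
  have ae: "AE p in \<mu>. C (\<phi> p) = \<gamma>2 (\<lambda>x. C (hext \<phi> x)) p"
    using gammaL2_contraction[OF f C] trace_hext[OF \<phi>] by eventually_elim simp
  show "(\<lambda>p. C (\<phi> p)) \<in> trace_space"
    unfolding trace_space_def using Cf ae L2_normal_contraction[OF trace_space_L2[OF \<phi>] C] by blast
  show "hext (\<lambda>p. C (\<phi> p)) = harm (\<lambda>x. C (hext \<phi> x))" by (rule hext_eq[OF Cf ae])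
qed

lemma trace_space_zero: "(\<lambda>_. 0) \<in> trace_space" and hext_zero: "hext (\<lambda>_. 0) = (\<lambda>_. 0)"
proof -
  have ae: "AE p in \<mu>. 0 = \<gamma>2 (\<lambda>_. 0) p" using gammaL2_D0[OF D0_zero] by eventually_elim simp
  show "(\<lambda>_. 0) \<in> trace_space" unfolding trace_space_def using ae zero_mem L2.zero_mem by blast
  have "harm (\<lambda>_. 0) = (\<lambda>_. 0)"
    using harm_harmonic[OF zero_mem] harmonic1_iff_delta[OF zero_mem] scale_left[OF zero_mem delta_mem, of 0] by simp
  then show "hext (\<lambda>_. 0) = (\<lambda>_. 0)" using hext_eq[OF zero_mem ae] by simp
qed

abbreviation "Tr \<equiv> trace_form m b c K i \<mu>"
abbreviation "q\<^sub>D\<^sub>N \<equiv> qDN m b c K i \<mu>"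

text \<open>
  In place of a choice that depends on \<open>Q\<close>, all trace forms are expressed by the single map \<open>hext\<close>; the
  form \<open>Q\<^sub>1\<close> takes care of the domain by being infinite outside.
\<close>

lemma trace_form_eq:
  assumes Q: "Q \<in> DF m b c"
  shows "Tr Q \<phi> = (if \<phi> \<in> trace_space then form1 V Q (hext \<phi>) else \<infinity>)"
proof -
  interpret Q: graph_form_extension m b c Q by (rule DF_extension[OF Q])
  define P where "P f \<longleftrightarrow> f \<in> form_dom Q \<and> (AE p in \<mu>. \<phi> p = \<gamma>2 f p)" for f
  have tr: "Tr Q \<phi> = (if \<phi> \<in> L2 \<mu> \<and> (\<exists>f. P f) then form1 V Q (harmonic_ext m b c K i (\<gamma> (SOME f. P f))) else \<infinity>)"
    unfolding trace_form_def Let_def P_def ..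
  show ?thesis
  proof (cases "\<phi> \<in> L2 \<mu> \<and> (\<exists>f. P f)")
    case True
    then have P: "P (SOME f. P f)" by (metis someI_ex)
    then have f: "(SOME f. P f) \<in> N" and ae: "AE p in \<mu>. \<phi> p = \<gamma>2 (SOME f. P f) p"
      unfolding P_def using Q.D_N by blast+
    have "\<phi> \<in> trace_space" using True f ae unfolding trace_space_def by blast
    moreover have "harmonic_ext m b c K i (\<gamma> (SOME f. P f)) = hext \<phi>"
      unfolding harmonic_ext_gamma[OF f] hext_eq[OF f ae] ..
    ultimately show ?thesis using True tr by simp
  next
    case False
    have "form1 V Q (hext \<phi>) = \<infinity>" if \<phi>: "\<phi> \<in> trace_space"
    proof (rule ccontr)
      assume "form1 V Q (hext \<phi>) \<noteq> \<infinity>"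
      then have "hext \<phi> \<in> form_dom (form1 V Q)" by (simp add: form_dom_def less_top)
      then have "P (hext \<phi>)"
        using form_dom_form1[OF Q.quadratic] trace_hext[OF \<phi>] by (simp add: P_def)
      then show False using False trace_space_L2[OF \<phi>] by blast
    qed
    then show ?thesis using False tr by auto
  qed
qed

lemma trace_form_dom:
  assumes Q: "Q \<in> DF m b c" shows "form_dom (Tr Q) = {\<phi> \<in> trace_space. hext \<phi> \<in> form_dom Q}"
proof -
  interpret Q: graph_form_extension m b c Q by (rule DF_extension[OF Q])
  have "hext \<phi> \<in> form_dom Q \<longleftrightarrow> form1 V Q (hext \<phi>) < \<infinity>" for \<phi>
    using form_dom_form1[OF Q.quadratic] unfolding form_dom_def by blast
  then show ?thesis unfolding form_dom_def[of "Tr Q"] using trace_form_eq[OF Q] by auto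
qed

lemma inner_fun_space_trace_space: "inner_fun_space trace_space (L2_inner \<mu>)"
proof (rule inner_fun_space_subspace[OF inner_fun_space_L2])
  show "(\<lambda>p. \<phi> p + \<psi> p) \<in> trace_space" if "\<phi> \<in> trace_space" "\<psi> \<in> trace_space" for \<phi> \<psi>
    using trace_space_lincomb[OF that, of 1] by simp
  show "(\<lambda>p. a * \<phi> p) \<in> trace_space" if "\<phi> \<in> trace_space" for a \<phi>
    using trace_space_lincomb[OF trace_space_zero that, of a] by simp
qed (use trace_space_L2 trace_space_zero in auto)

lemma inner_fun_space_hext:
  assumes "inner_fun_space D' B'"
  shows "inner_fun_space {\<phi> \<in> trace_space. hext \<phi> \<in> D'} (\<lambda>\<phi> \<psi>. B' (hext \<phi>) (hext \<psi>))"
proof (rule inner_fun_space_pullback[OF assms inner_fun_space_trace_space])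
  show "hext (\<lambda>p. \<phi> p + \<psi> p) = (\<lambda>x. hext \<phi> x + hext \<psi> x)" if "\<phi> \<in> trace_space" "\<psi> \<in> trace_space" for \<phi> \<psi>
    using hext_lincomb[OF that, of 1] by simp
  show "hext (\<lambda>p. a * \<phi> p) = (\<lambda>x. a * hext \<phi> x)" if "\<phi> \<in> trace_space" for a \<phi>
    using hext_lincomb[OF trace_space_zero that, of a] hext_zero by simp
qed

lemma trace_space_diff:
  assumes "\<phi> \<in> trace_space" "\<psi> \<in> trace_space"
  shows "(\<lambda>p. \<phi> p - \<psi> p) \<in> trace_space" and "hext (\<lambda>p. \<phi> p - \<psi> p) = (\<lambda>x. hext \<phi> x - hext \<psi> x)"
  using trace_space_lincomb[OF assms, of "-1"] hext_lincomb[OF assms, of "-1"] by simp_all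

lemma hext_cong_AE:
  assumes "\<phi> \<in> trace_space" "\<psi> \<in> L2 \<mu>" "AE p in \<mu>. \<phi> p = \<psi> p"
  shows "\<psi> \<in> trace_space" and "hext \<psi> = hext \<phi>"
proof -
  have ae: "AE p in \<mu>. \<psi> p = \<gamma>2 (hext \<phi>) p" using assms(3) trace_hext[OF assms(1)] by eventually_elim simp
  show "\<psi> \<in> trace_space" using assms(2) hext_N[OF assms(1)] ae unfolding trace_space_def by blast
  show "hext \<psi> = hext \<phi>"
    using hext_eq[OF hext_N[OF assms(1)] ae] harm_harmonic[OF hext_N harmonic_hext, OF assms(1) assms(1)] by simp
qed

lemma trace_space_bound:
  assumes "\<phi> \<in> trace_space" shows "L2_inner \<mu> \<phi> \<phi> \<le> 3 / m z * quad E (hext \<phi>)"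
proof -
  show ?thesis
    using L2_inner_cong_AE[OF trace_space_L2[OF assms] gammaL2_L2[OF hext_N[OF assms]] trace_hext[OF assms]]
      trace_bound[OF hext_N[OF assms]] by simp
qed

end

locale traced_form = harmonic_boundary + graph_form_extension
begin

lemma harm_D: "f \<in> D \<Longrightarrow> harm f \<in> D"
  using Q.diff_mem[OF _ D0_D[OF royden0_D0[OF D_N]]] by (simp add: harm_def[abs_def])

text \<open>
  The mixed term vanishes because on pairs with \<open>D\<^sup>D\<close> the form \<open>Q\<^sub>1\<close> agrees with \<open>Q\<^sup>N\<^sub>1\<close>, for which harmonic
  functions are orthogonal to \<open>D\<^sup>D\<close>.
\<close>

lemma B_harm_le: "f \<in> D \<Longrightarrow> quad B (harm f) \<le> B f f"
proof -
  assume f: "f \<in> D"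
  note 0 = royden0_D0[OF D_N[OF f]]
  have "quad B (harm f \<oplus> royden0 m b c f)
     = quad B (harm f) + 2 * B (harm f) (royden0 m b c f) + quad B (royden0 m b c f)"
    by (rule Q.norm_add[OF harm_D[OF f] D0_D[OF 0]])
  moreover have "B (harm f) (royden0 m b c f) = 0"
    unfolding B_eq_E[OF harm_D[OF f] 0] by (rule harmonic_orthogonal) (use royden[OF D_N[OF f]] in auto)
  ultimately show ?thesis using Q.nonneg[OF D0_D[OF 0]] by (simp add: harm_def)
qed

lemma excess_harm: "f \<in> D \<Longrightarrow> quad B (harm f) - quad E (harm f) = B f f - E f f"
  using excess_shift[OF harm_D royden0_D0[OF D_N], of f f] by (simp add: harm_def)

lemma Q_DF: "Q \<in> DF m b c"
  unfolding DF_def dirichlet_form_def dirichlet_form_wide_def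
  using quadratic closed markov QN_le le_QD densely_defined_if_finsupp[OF finsupp_dom] by simp

lemma dom_iff: "\<phi> \<in> form_dom (Tr Q) \<longleftrightarrow> \<phi> \<in> trace_space \<and> hext \<phi> \<in> D"
  unfolding trace_form_dom[OF Q_DF] by simp

lemma trace_value: "\<phi> \<in> form_dom (Tr Q) \<Longrightarrow> Tr Q \<phi> = ennreal (quad B (hext \<phi>))"
  using trace_form_eq[OF Q_DF] form1_B by (simp add: dom_iff)

lemma inner_trace: "inner_fun_space (form_dom (Tr Q)) (\<lambda>\<phi> \<psi>. B (hext \<phi>) (hext \<psi>))"
  unfolding trace_form_dom[OF Q_DF] by (rule inner_fun_space_hext[OF Q.inner_fun_space_axioms])

lemma quadratic_trace: "quadratic_form \<mu> (Tr Q)"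
proof (rule quadratic_formI[OF _ _ inner_trace trace_value])
  show "Tr Q \<phi> = \<infinity>" if "\<phi> \<notin> L2 \<mu>" for \<phi>
    using that trace_space_L2[of \<phi>] trace_form_eq[OF Q_DF, of \<phi>] by auto
  show "Tr Q \<phi> = Tr Q \<psi>" if "\<phi> \<in> L2 \<mu>" "\<psi> \<in> L2 \<mu>" "AE p in \<mu>. \<phi> p = \<psi> p" for \<phi> \<psi>
  proof -
    have "AE p in \<mu>. \<psi> p = \<phi> p" using that(3) by eventually_elim simp
    then have "\<phi> \<in> trace_space \<longleftrightarrow> \<psi> \<in> trace_space"
      using hext_cong_AE(1)[OF _ that(2,3)] hext_cong_AE(1)[OF _ that(1)] by blast
    then show ?thesis
      using hext_cong_AE(2)[OF _ that(2,3)] trace_form_eq[OF Q_DF] by simp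
  qed
qed

lemma polar_trace1:
  assumes "\<phi> \<in> form_dom (Tr Q)"
  shows "polar (form1 \<mu> (Tr Q)) \<phi> \<phi> = quad B (hext \<phi>) + L2_inner \<mu> \<phi> \<phi>"
  using polar_form1[OF quadratic_trace assms assms] polar_unique[OF inner_trace trace_value assms assms] by simp

text \<open>
  Harmonic extension does not increase norms, and the \<open>L\<^sup>2\<close>-norm on the boundary is controlled by the form
  on the graph; so \<open>hext\<close> and the trace transfer completeness.
\<close>

lemma closed_trace: "closed_form \<mu> (Tr Q)"
  unfolding closed_form_iff_complete[OF quadratic_trace]
proof (rule complete_transfer[OF complete_D, where u = hext and v = \<gamma>2 and k = "1 + 3 / m z"])
  let ?p = "polar (form1 \<mu> (Tr Q))"
  interpret T: inner_fun_space "form_dom (Tr Q)" "\<lambda>\<phi> \<psi>. B (hext \<phi>) (hext \<psi>)" by (rule inner_trace)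
  show hD: "hext \<phi> \<in> D" if "\<phi> \<in> form_dom (Tr Q)" for \<phi> using that by (simp add: dom_iff)
  show gD: "\<gamma>2 f \<in> form_dom (Tr Q)" if f: "f \<in> D" for f
    using gammaL2_trace_space[OF D_N[OF f]] harm_D[OF f] by (simp add: dom_iff hext_gammaL2[OF D_N[OF f]])
  have p: "quad ?p \<phi> = quad B (hext \<phi>) + L2_inner \<mu> \<phi> \<phi>" "0 \<le> L2_inner \<mu> \<phi> \<phi>" "0 \<le> quad B (hext \<phi>)"
    if "\<phi> \<in> form_dom (Tr Q)" for \<phi>
    using polar_trace1[OF that] L2.nonneg[of \<phi>] form_dom_L2[OF quadratic_trace that] T.nonneg[OF that] by auto
  show "quad B (hext \<phi> \<ominus> hext \<psi>) \<le> quad ?p (\<phi> \<ominus> \<psi>)" if "\<phi> \<in> form_dom (Tr Q)" "\<psi> \<in> form_dom (Tr Q)" for \<phi> \<psi>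
    using p[OF T.diff_mem[OF that]] trace_space_diff(2) that by (simp add: dom_iff)
  fix \<phi> f assume \<phi>: "\<phi> \<in> form_dom (Tr Q)" and f: "f \<in> D"
  let ?\<psi> = "\<phi> \<ominus> \<gamma>2 f" and ?g = "hext \<phi> \<ominus> f"
  have \<psi>: "?\<psi> \<in> form_dom (Tr Q)" by (rule T.diff_mem[OF \<phi> gD[OF f]])
  have \<phi>T: "\<phi> \<in> trace_space" using \<phi> by (simp add: dom_iff)
  show "0 \<le> quad ?p ?\<psi>" using p[OF \<psi>] by simp
  have "AE p in \<mu>. ?\<psi> p = \<gamma>2 (\<lambda>x. hext \<phi> x + (-1) * f x) p"
    using gammaL2_lincomb[OF hext_N[OF \<phi>T] D_N[OF f], of "-1"] trace_hext[OF \<phi>T] by eventually_elim simp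
  from hext_eq[OF lincomb_mem[OF hext_N[OF \<phi>T] D_N[OF f]] this] have "hext ?\<psi> = harm ?g" by simp
  then have h: "quad B (hext ?\<psi>) \<le> quad B ?g" using B_harm_le[OF Q.diff_mem[OF hD[OF \<phi>] f]] by simp
  have "L2_inner \<mu> ?\<psi> ?\<psi> \<le> 3 / m z * quad E (hext ?\<psi>)" by (rule trace_space_bound) (use \<psi> in \<open>simp add: dom_iff\<close>)
  also have "\<dots> \<le> 3 / m z * quad B ?g"
    using E_le_B[OF hD[OF \<psi>]] h m_pos[of z] by (intro mult_left_mono) auto
  finally show "quad ?p ?\<psi> \<le> (1 + 3 / m z) * quad B ?g" using p(1)[OF \<psi>] h by (simp add: distrib_right)
qed

lemma markovian_trace: "markovian \<mu> (Tr Q)"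
  unfolding markovian_def
proof (intro ballI allI impI)
  fix \<phi> :: "'b \<Rightarrow> real" and C :: "real \<Rightarrow> real" assume C: "normal_contraction C"
  show "Tr Q (\<lambda>x. C (\<phi> x)) \<le> Tr Q \<phi>"
  proof (cases "\<phi> \<in> form_dom (Tr Q)")
    case True
    then have \<phi>: "\<phi> \<in> trace_space" and h: "hext \<phi> \<in> D" by (auto simp: dom_iff)
    note Ch = D_normal_contraction[OF h C]
    have "(\<lambda>x. C (\<phi> x)) \<in> form_dom (Tr Q)"
      using trace_space_contraction[OF \<phi> C] harm_D[OF Ch(1)] by (simp add: dom_iff hext_contraction[OF \<phi> C])
    then show ?thesis
      using trace_value trace_value[OF True] B_harm_le[OF Ch(1)] Ch(2)
      by (simp add: hext_contraction[OF \<phi> C] ennreal_leI)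
  qed (simp add: form_dom_def less_top[symmetric])
qed

lemma qDN_value: "\<phi> \<in> trace_space \<Longrightarrow> q\<^sub>D\<^sub>N \<phi> = ennreal (quad E (hext \<phi>))"
  unfolding qDN_def trace_form_eq[OF QN_DF] using N1_E[OF hext_N] by simp

lemma qDN_le_trace: "form_le \<mu> q\<^sub>D\<^sub>N (Tr Q)"
  unfolding form_le_def
proof
  fix \<phi> show "q\<^sub>D\<^sub>N \<phi> \<le> Tr Q \<phi>"
  proof (cases "\<phi> \<in> form_dom (Tr Q)")
    case True
    then show ?thesis using trace_value[OF True] qDN_value E_le_B by (auto simp: dom_iff intro: ennreal_leI)
  qed (simp add: form_dom_def less_top[symmetric])
qed

lemma diff_value:
  assumes \<phi>: "\<phi> \<in> form_dom (Tr Q)"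
  shows "form_diff (Tr Q) q\<^sub>D\<^sub>N \<phi> = ennreal (quad B (hext \<phi>) - quad E (hext \<phi>))"
  using \<phi> trace_value[OF \<phi>] qDN_value[of \<phi>] nonneg[OF hext_N, of \<phi>]
  by (simp add: form_diff_def dom_iff ennreal_minus)

text \<open>
  The difference at \<open>C \<circ> \<phi>\<close> is the excess of the harmonic part of \<open>C \<circ> hext \<phi>\<close>, which is the excess of the
  function \<open>C \<circ> hext \<phi>\<close> itself.
\<close>

lemma markovian_diff: "markovian \<mu> (form_diff (Tr Q) q\<^sub>D\<^sub>N)"
  unfolding markovian_def
proof (intro ballI allI impI)
  fix \<phi> :: "'b \<Rightarrow> real" and C :: "real \<Rightarrow> real" assume C: "normal_contraction C"
  show "form_diff (Tr Q) q\<^sub>D\<^sub>N (\<lambda>x. C (\<phi> x)) \<le> form_diff (Tr Q) q\<^sub>D\<^sub>N \<phi>"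
  proof (cases "\<phi> \<in> form_dom (Tr Q)")
    case True
    then have \<phi>: "\<phi> \<in> trace_space" and h: "hext \<phi> \<in> D" by (auto simp: dom_iff)
    note Ch = D_normal_contraction[OF h C]
    have dom: "(\<lambda>x. C (\<phi> x)) \<in> form_dom (Tr Q)"
      using trace_space_contraction[OF \<phi> C] harm_D[OF Ch(1)] by (simp add: dom_iff hext_contraction[OF \<phi> C])
    show ?thesis
      unfolding diff_value[OF True] diff_value[OF dom] hext_contraction[OF \<phi> C] excess_harm[OF Ch(1)]
      by (rule ennreal_leI[OF excess_markovian[OF h C]])
  qed (simp add: form_diff_def)
qed

lemma trace_TrDF: "Tr Q \<in> TrDF m b c K i \<mu>"
  unfolding TrDF_def dirichlet_form_wide_def
  using quadratic_trace closed_trace markovian_trace qDN_le_trace markovian_diff by simp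

lemma represented_by_trace: "represented_by m b c K i \<mu> Q (Tr Q)"
  unfolding represented_by_def
proof (intro conjI ballI impI)
  fix f assume f: "f \<in> D"
  have fN: "f \<in> N" by (rule D_N[OF f])
  have dom: "\<gamma>2 f \<in> form_dom (Tr Q)"
    using gammaL2_trace_space[OF fN] harm_D[OF f] by (simp add: dom_iff hext_gammaL2[OF fN])
  then show "\<gamma>2 f \<in> form_dom (Tr Q)" .
  have v: "Tr Q (\<gamma>2 f) = ennreal (quad B (harm f))"
    using trace_value[OF dom] by (simp add: hext_gammaL2[OF fN])
  have w: "q\<^sub>D\<^sub>N (\<gamma>2 f) = ennreal (quad E (harm f))"
    using qDN_value[OF gammaL2_trace_space[OF fN]] by (simp add: hext_gammaL2[OF fN])
  have pos: "0 \<le> polar Q f f" "0 \<le> polar (QN m b c) f f"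
    using inner_fun_space.nonneg[OF quadratic_formD(3)[OF quadratic] f]
      inner_fun_space.nonneg[OF quadratic_formD(3)[OF quadratic_form_QN] fN] .
  have "polar Q f f = polar (QN m b c) f f + (quad B (harm f) - quad E (harm f))"
    using polar_form1[OF quadratic f f] polar_form1[OF quadratic_form_QN fN fN] excess_harm[OF f] by simp
  then show "Q f = QN m b c f + Tr Q (\<gamma>2 f) - q\<^sub>D\<^sub>N (\<gamma>2 f)"
    unfolding v w quadratic_formD(4)[OF quadratic f] quadratic_formD(4)[OF quadratic_form_QN fN]
    using pos nonneg[OF harm_N[OF fN]] Q.nonneg[OF harm_D[OF f]]
    by (simp add: ennreal_plus[symmetric] ennreal_minus del: ennreal_plus)
  have "B f f = quad E (royden0 m b c f) + quad B (harm f)"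
    using E_royden[OF fN] excess_harm[OF f] by simp
  then show "form1 V Q f = form1 V (QD m b c) (royden0 m b c f) + Tr Q (\<gamma>2 f)"
    unfolding v form1_B[OF f] form1_QD[OF royden0_D0[OF fN]] N1_E[OF D0_N[OF royden0_D0[OF fN]]]
    using nonneg[OF D0_N[OF royden0_D0[OF fN]]] Q.nonneg[OF harm_D[OF f]] by simp
next
  fix f assume f: "f \<in> N" and "\<gamma>2 f \<in> form_dom (Tr Q)"
  then have "harm f \<in> D" by (simp add: dom_iff hext_gammaL2)
  from Q.add_mem[OF this D0_D[OF royden0_D0[OF f]]] show "f \<in> D" by (simp add: harm_def)
qed

end

section \<open>Forms with prescribed trace\<close>

text \<open>
  A boundary form \<open>q\<close> as in the theorem, from which the form on the graph is to be constructed.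
\<close>

locale boundary_form = harmonic_boundary +
  fixes q :: "'b qform"
  assumes q_TrDF: "q \<in> TrDF m b c K i (hm z)"
begin

lemma q_quadratic: "quadratic_form \<mu> q" and q_closed: "closed_form \<mu> q"
  and qDN_le_q: "form_le \<mu> q\<^sub>D\<^sub>N q" and q_markov_diff: "markovian \<mu> (form_diff q q\<^sub>D\<^sub>N)"
  using q_TrDF by (auto simp: TrDF_def dirichlet_form_wide_def)

sublocale q: inner_fun_space "form_dom q" "polar q"
  by (rule quadratic_formD(3)[OF q_quadratic])

lemma q_L2: "\<phi> \<in> form_dom q \<Longrightarrow> \<phi> \<in> L2 \<mu>"
  by (rule form_dom_L2[OF q_quadratic])

lemma qDN_eq: "q\<^sub>D\<^sub>N \<phi> = (if \<phi> \<in> trace_space then ennreal (quad E (hext \<phi>)) else \<infinity>)"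
  unfolding qDN_def trace_form_eq[OF QN_DF] using N1_E[OF hext_N] by simp

text \<open>
  As \<open>q \<ge> q\<^sup>D\<^sup>N\<close>, elements of the domain of \<open>q\<close> are traces.
\<close>

lemma dom_trace_space: "\<phi> \<in> form_dom q \<Longrightarrow> \<phi> \<in> trace_space"
proof (rule ccontr)
  assume \<phi>: "\<phi> \<in> form_dom q" and "\<phi> \<notin> trace_space"
  moreover have "q\<^sub>D\<^sub>N \<phi> \<le> q \<phi>" using qDN_le_q q_L2[OF \<phi>] by (simp add: form_le_def)
  ultimately have "\<infinity> \<le> q \<phi>" by (simp add: qDN_eq)
  then show False using \<phi> by (simp add: form_dom_def top_unique)
qed

lemma q_value: "\<phi> \<in> form_dom q \<Longrightarrow> q \<phi> = ennreal (polar q \<phi> \<phi>)"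
  by (rule quadratic_formD(4)[OF q_quadratic])

text \<open>
  The bilinear form of \<open>q - q\<^sup>D\<^sup>N\<close>, in the shape of \<open>inner_fun_space_lincomb\<close>.
\<close>

definition excess :: "('b \<Rightarrow> real) \<Rightarrow> ('b \<Rightarrow> real) \<Rightarrow> real" where
  "excess \<phi> \<psi> = polar q \<phi> \<psi> + (-1) * E (hext \<phi>) (hext \<psi>)"

lemma excess_nonneg: "\<phi> \<in> form_dom q \<Longrightarrow> 0 \<le> excess \<phi> \<phi>"
proof -
  assume \<phi>: "\<phi> \<in> form_dom q"
  have "q\<^sub>D\<^sub>N \<phi> \<le> q \<phi>" using qDN_le_q q_L2[OF \<phi>] by (simp add: form_le_def)
  then show ?thesis
    using q.nonneg[OF \<phi>] dom_trace_space[OF \<phi>] by (simp add: qDN_eq q_value[OF \<phi>] excess_def)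
qed

lemma diff_value_q: "\<phi> \<in> form_dom q \<Longrightarrow> form_diff q q\<^sub>D\<^sub>N \<phi> = ennreal (excess \<phi> \<phi>)"
  using dom_trace_space[of \<phi>] nonneg[OF hext_N, of \<phi>]
  by (simp add: form_diff_def qDN_eq q_value excess_def ennreal_minus)

lemma inner_excess: "inner_fun_space (form_dom q) excess"
  unfolding excess_def[abs_def]
proof (rule inner_fun_space_lincomb[OF q.inner_fun_space_axioms])
  show "inner_fun_space (form_dom q) (\<lambda>\<phi> \<psi>. E (hext \<phi>) (hext \<psi>))"
    by (rule inner_fun_space_subspace[OF inner_fun_space_hext[OF inner_fun_space_axioms] _ q.zero_mem q.add_mem q.scale_mem])
       (use dom_trace_space hext_N in auto)
qed (use excess_nonneg in \<open>simp add: excess_def\<close>)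

lemma excess_cong:
  assumes "\<phi> \<in> form_dom q" "\<phi>' \<in> form_dom q" "\<psi> \<in> form_dom q" "AE p in \<mu>. \<phi> p = \<phi>' p"
  shows "excess \<phi> \<psi> = excess \<phi>' \<psi>"
  unfolding excess_def polar_cong_AE[OF q_quadratic assms]
    hext_cong_AE(2)[OF dom_trace_space[OF assms(1)] q_L2[OF assms(2)] assms(4)] ..

definition lifted_dom :: "('a \<Rightarrow> real) set" where
  "lifted_dom = {f \<in> N. \<gamma>2 f \<in> form_dom q}"

definition lifted :: "'a qform" where
  "lifted f = (if f \<in> lifted_dom then QN m b c f + form_diff q q\<^sub>D\<^sub>N (\<gamma>2 f) else \<infinity>)"

lemma lifted_value: "f \<in> lifted_dom \<Longrightarrow> lifted f = QN m b c f + ennreal (excess (\<gamma>2 f) (\<gamma>2 f))"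
  by (simp add: lifted_def diff_value_q lifted_dom_def)

lemma form_dom_lifted: "form_dom lifted = lifted_dom"
proof -
  have "lifted f < \<infinity> \<longleftrightarrow> f \<in> lifted_dom" for f
  proof (cases "f \<in> lifted_dom")
    case True
    then have "QN m b c f < \<infinity>" by (simp add: lifted_dom_def form_dom_def)
    then show ?thesis using True lifted_value[OF True] by simp
  qed (simp add: lifted_def)
  then show ?thesis by (auto simp: form_dom_def)
qed

lemma lifted_lincomb:
  assumes f: "f \<in> lifted_dom" and g: "g \<in> lifted_dom"
  shows "(\<lambda>x. f x + a * g x) \<in> lifted_dom"
proof -
  have N: "f \<in> N" "g \<in> N" and q: "\<gamma>2 f \<in> form_dom q" "\<gamma>2 g \<in> form_dom q" using f g by (auto simp: lifted_dom_def)
  have "AE p in \<mu>. \<gamma>2 f p + a * \<gamma>2 g p = \<gamma>2 (\<lambda>x. f x + a * g x) p"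
    using gammaL2_lincomb[OF N, of a] by eventually_elim simp
  from form_dom_cong_AE(1)[OF q_quadratic q.lincomb_mem[OF q] gammaL2_L2[OF lincomb_mem[OF N]] this]
  show ?thesis using lincomb_mem[OF N] by (simp add: lifted_dom_def)
qed

lemma gammaL2_lincomb_excess:
  assumes f: "f \<in> lifted_dom" and g: "g \<in> lifted_dom" and h: "h \<in> lifted_dom"
  shows "excess (\<gamma>2 (\<lambda>x. f x + a * g x)) (\<gamma>2 h) = excess (\<gamma>2 f) (\<gamma>2 h) + a * excess (\<gamma>2 g) (\<gamma>2 h)"
proof -
  interpret ex: inner_fun_space "form_dom q" excess by (rule inner_excess)
  have N: "f \<in> N" "g \<in> N" and q: "\<gamma>2 f \<in> form_dom q" "\<gamma>2 g \<in> form_dom q" "\<gamma>2 h \<in> form_dom q"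
    using f g h by (auto simp: lifted_dom_def)
  have "excess (\<gamma>2 (\<lambda>x. f x + a * g x)) (\<gamma>2 h) = excess (\<lambda>p. \<gamma>2 f p + a * \<gamma>2 g p) (\<gamma>2 h)"
    using lifted_lincomb[OF f g, of a] gammaL2_lincomb[OF N, of a]
    by (intro excess_cong q.lincomb_mem q) (auto simp: lifted_dom_def)
  then show ?thesis
    using ex.add_left[OF q(1) ex.scale_mem[OF q(2)] q(3), of a] ex.scale_left[OF q(2,3), of a] by simp
qed

lemma lifted_dom_D0: "D0 \<subseteq> lifted_dom"
proof
  fix f assume f: "f \<in> D0"
  have "AE p in \<mu>. 0 = \<gamma>2 f p" using gammaL2_D0[OF f] by eventually_elim simp
  from form_dom_cong_AE(1)[OF q_quadratic q.zero_mem gammaL2_L2[OF D0_N[OF f]] this]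
  show "f \<in> lifted_dom" using D0_N[OF f] by (simp add: lifted_dom_def)
qed

lemma inner_lifted: "inner_fun_space lifted_dom (\<lambda>f g. E f g + 1 * excess (\<gamma>2 f) (\<gamma>2 g))"
proof (rule inner_fun_space_lincomb)
  interpret ex: inner_fun_space "form_dom q" excess by (rule inner_excess)
  have sc: "(\<lambda>x. a * f x) \<in> lifted_dom" if "f \<in> lifted_dom" for a f
    using lifted_lincomb[OF subsetD[OF lifted_dom_D0 D0_zero] that, of a] by simp
  have ad: "(f \<oplus> g) \<in> lifted_dom" if "f \<in> lifted_dom" "g \<in> lifted_dom" for f g
    using lifted_lincomb[OF that, of 1] by simp
  have z0: "(\<lambda>_. 0) \<in> lifted_dom" by (rule subsetD[OF lifted_dom_D0 D0_zero])
  show "inner_fun_space lifted_dom E"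
    by (rule inner_fun_space_subspace[OF inner_fun_space_axioms _ z0 ad sc]) (auto simp: lifted_dom_def)
  show "inner_fun_space lifted_dom (\<lambda>f g. excess (\<gamma>2 f) (\<gamma>2 g))"
  proof
    fix f g h a assume f: "f \<in> lifted_dom" and h: "h \<in> lifted_dom"
    then have q: "\<gamma>2 f \<in> form_dom q" "\<gamma>2 h \<in> form_dom q" by (auto simp: lifted_dom_def)
    show "excess (\<gamma>2 f) (\<gamma>2 h) = excess (\<gamma>2 h) (\<gamma>2 f)" by (rule ex.sym[OF q])
    show "0 \<le> excess (\<gamma>2 f) (\<gamma>2 f)" by (rule ex.nonneg[OF q(1)])
    have "excess (\<gamma>2 (\<lambda>_. 0)) (\<gamma>2 h) = 0"
      using gammaL2_lincomb_excess[OF z0 z0 h, of 1] by simp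
    then show "excess (\<gamma>2 (\<lambda>x. a * f x)) (\<gamma>2 h) = a * excess (\<gamma>2 f) (\<gamma>2 h)"
      using gammaL2_lincomb_excess[OF z0 f h, of a] by simp
    assume g: "g \<in> lifted_dom"
    show "excess (\<gamma>2 (f \<oplus> g)) (\<gamma>2 h) = excess (\<gamma>2 f) (\<gamma>2 h) + excess (\<gamma>2 g) (\<gamma>2 h)"
      using gammaL2_lincomb_excess[OF f g h, of 1] by simp
    show "(f \<oplus> g) \<in> lifted_dom" by (rule ad[OF f g])
  qed (use z0 sc in auto)
qed (use excess_nonneg nonneg in \<open>auto simp: lifted_dom_def intro!: add_nonneg_nonneg\<close>)

lemma form1_lifted: "f \<in> lifted_dom \<Longrightarrow> form1 V lifted f = ennreal (E f f + 1 * excess (\<gamma>2 f) (\<gamma>2 f))"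
proof -
  assume f: "f \<in> lifted_dom"
  have fN: "f \<in> N" using f by (simp add: lifted_dom_def)
  have "form1 V lifted f = N1 f + ennreal (excess (\<gamma>2 f) (\<gamma>2 f))"
    by (simp add: form1_def lifted_value[OF f] ac_simps)
  then show ?thesis using N1_E[OF fN] nonneg[OF fN] excess_nonneg[of "\<gamma>2 f"] f by (simp add: lifted_dom_def)
qed

lemma quadratic_lifted: "quadratic_form V lifted"
proof (rule quadratic_form_if_form1[where B = "\<lambda>f g. E f g + 1 * excess (\<gamma>2 f) (\<gamma>2 g)"])
  show "lifted f = \<infinity>" if "f \<notin> L2 V" for f
    using that form_dom_L2[OF quadratic_form_QN] by (auto simp: lifted_def lifted_dom_def)
  show "lifted f = lifted g" if "AE x in V. f x = g x" for f g
  proof -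
    have "f = g" using that AE_vmeas by auto
    then show ?thesis by simp
  qed
qed (use form_dom_lifted inner_lifted form1_lifted in auto)

lemma polar_lifted1:
  assumes f: "f \<in> lifted_dom"
  shows "polar (form1 V lifted) f f = E f f + excess (\<gamma>2 f) (\<gamma>2 f)"
proof -
  note dom = form_dom_form1[OF quadratic_lifted, unfolded form_dom_lifted]
  have "polar (form1 V lifted) f f = E f f + 1 * excess (\<gamma>2 f) (\<gamma>2 f)"
    by (rule polar_unique) (use dom inner_lifted form1_lifted f in simp_all)
  then show ?thesis by simp
qed

text \<open>
  The contribution of the harmonic part to \<open>Q\<^sup>N\<^sub>1(f)\<close> is \<open>q\<^sup>D\<^sup>N(\<gamma>f)\<close>, which cancels the subtracted term.
\<close>

lemma polar_lifted1_royden: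
  assumes f: "f \<in> lifted_dom"
  shows "polar (form1 V lifted) f f = quad E (royden0 m b c f) + polar q (\<gamma>2 f) (\<gamma>2 f)"
proof -
  have fN: "f \<in> N" using f by (simp add: lifted_dom_def)
  show ?thesis unfolding polar_lifted1[OF f] E_royden[OF fN] excess_def hext_gammaL2[OF fN] by simp
qed

text \<open>
  A Cauchy sequence converges for \<open>Q\<^sup>N\<^sub>1\<close> to some \<open>f\<close>, and its traces converge for \<open>q\<^sub>1\<close> to some \<open>\<psi>\<close>. Since the
  trace is continuous into \<open>L\<^sup>2\<close>, \<open>\<psi> = \<gamma>f\<close> almost everywhere, so \<open>f\<close> is in the domain.
\<close>

lemma closed_lifted: "closed_form V lifted"
  unfolding closed_form_iff_complete[OF quadratic_lifted] form_dom_lifted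
proof (rule complete_wrtI)
  fix F :: "nat \<Rightarrow> 'a \<Rightarrow> real"
  let ?p = "polar (form1 V lifted)"
  let ?q1 = "polar (form1 \<mu> q)"
  note q1_quadratic = quadratic_form1[OF q_quadratic]
  note q1_dom = form_dom_form1[OF q_quadratic]
  interpret L: inner_fun_space lifted_dom "\<lambda>f g. E f g + 1 * excess (\<gamma>2 f) (\<gamma>2 g)" by (rule inner_lifted)
  interpret q1: inner_fun_space "form_dom q" ?q1 using quadratic_formD(3)[OF q1_quadratic] by (simp add: q1_dom)
  assume FD: "\<And>n. F n \<in> lifted_dom" and C: "Cauchy_wrt ?p F"
  have FN: "F n \<in> N" and Fq: "\<gamma>2 (F n) \<in> form_dom q" for n using FD by (auto simp: lifted_dom_def)
  have k: "0 < 1 + 3 / m z" using m_pos[of z] by (simp add: add_pos_pos)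
  have q1: "quad ?q1 \<phi> = quad (polar q) \<phi> + L2_inner \<mu> \<phi> \<phi>" if "\<phi> \<in> form_dom q" for \<phi>
    by (rule polar_form1[OF q_quadratic that that])
  have ae: "AE p in \<mu>. \<gamma>2 (g \<ominus> h) p = \<gamma>2 g p - \<gamma>2 h p" if "g \<in> N" "h \<in> N" for g h
    using gammaL2_lincomb[OF that, of "-1"] by simp
  have E_le: "quad E f \<le> quad ?p f" if "f \<in> lifted_dom" for f
    using polar_lifted1[OF that] excess_nonneg[of "\<gamma>2 f"] that by (simp add: lifted_dom_def)
  have q_le: "quad (polar q) (\<gamma>2 f) \<le> quad ?p f" if "f \<in> lifted_dom" for f
    using polar_lifted1_royden[OF that] nonneg[OF D0_N[OF royden0_D0[of f]]] that by (simp add: lifted_dom_def)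
  have "Cauchy_wrt E F" by (rule Cauchy_wrt_mono[OF C, of 1]) (simp_all add: E_le L.diff_mem FD)
  then obtain f where f: "f \<in> N" and flim: "(\<lambda>n. quad E (F n \<ominus> f)) \<longlonglongrightarrow> 0"
    using complete_wrtE[where F = F, OF complete_N FN] by blast
  have "Cauchy_wrt ?q1 (\<lambda>n. \<gamma>2 (F n))"
  proof (rule Cauchy_wrt_mono[OF C k])
    fix i j
    let ?\<phi> = "\<gamma>2 (F i) \<ominus> \<gamma>2 (F j)" and ?g = "F i \<ominus> F j"
    have g: "?g \<in> lifted_dom" by (rule L.diff_mem[OF FD FD])
    then have gN: "?g \<in> N" and gq: "\<gamma>2 ?g \<in> form_dom q" by (auto simp: lifted_dom_def)
    have "quad ?q1 ?\<phi> = quad ?q1 (\<gamma>2 ?g)"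
      by (rule quad_polar_cong_AE[OF q1_quadratic _ q_L2[OF q.diff_mem[OF Fq Fq]] ae[OF FN FN]]) (simp add: q1_dom gq)
    also have "\<dots> \<le> quad ?p ?g + 3 / m z * quad E ?g"
      unfolding q1[OF gq] by (intro add_mono q_le g trace_bound gN)
    also have "3 / m z * quad E ?g \<le> 3 / m z * quad ?p ?g"
      using E_le[OF g] m_pos[of z] by (intro mult_left_mono) auto
    finally show "quad ?q1 ?\<phi> \<le> (1 + 3 / m z) * quad ?p ?g" by (simp add: distrib_right)
  qed
  moreover have "complete_wrt ?q1 (form_dom q)" using q_closed closed_form_iff_complete[OF q_quadratic] by simp
  ultimately obtain \<psi> where \<psi>: "\<psi> \<in> form_dom q" and \<psi>lim: "(\<lambda>n. quad ?q1 (\<gamma>2 (F n) \<ominus> \<psi>)) \<longlonglongrightarrow> 0"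
    using complete_wrtE[where F = "\<lambda>n. \<gamma>2 (F n)"] Fq by blast
  have q\<psi>: "(\<gamma>2 (F n) \<ominus> \<psi>) \<in> form_dom q" for n by (rule q.diff_mem[OF Fq \<psi>])
  have fL: "\<gamma>2 f \<in> L2 \<mu>" by (rule gammaL2_L2[OF f])
  have ae\<psi>: "AE p in \<mu>. \<psi> p = \<gamma>2 f p"
  proof -
    let ?d = "\<psi> \<ominus> \<gamma>2 f"
    have dL: "?d \<in> L2 \<mu>" by (rule L2.diff_mem[OF q_L2[OF \<psi>] fL])
    have le: "L2_inner \<mu> ?d ?d \<le> 2 * quad ?q1 (\<gamma>2 (F n) \<ominus> \<psi>) + 2 * (3 / m z * quad E (F n \<ominus> f))" for n
    proof -
      let ?u = "\<gamma>2 (F n \<ominus> f)" and ?v = "\<gamma>2 (F n) \<ominus> \<psi>"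
      have g: "(F n \<ominus> f) \<in> N" by (rule diff_mem[OF FN f])
      note u = gammaL2_L2[OF g] and v = q_L2[OF q\<psi>]
      have "AE p in \<mu>. ?d p = ?u p + (-1) * ?v p" using ae[OF FN[of n] f] by eventually_elim simp
      from L2_inner_cong_AE[OF dL L2.lincomb_mem[OF u v] this]
      have "L2_inner \<mu> ?d ?d = L2_inner \<mu> (\<lambda>p. ?u p + (-1) * ?v p) (\<lambda>p. ?u p + (-1) * ?v p)" .
      also have "\<dots> \<le> 2 * L2_inner \<mu> ?u ?u + 2 * L2_inner \<mu> ?v ?v"
        using L2.norm_add_le[OF u L2.scale_mem[OF v, of "-1"]] L2.norm_scale[OF v, of "-1"] by simp
      finally show ?thesis using trace_bound[OF g] q1[OF q\<psi>, of n] q.nonneg[OF q\<psi>, of n] by simp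
    qed
    have "(\<lambda>n. 2 * quad ?q1 (\<gamma>2 (F n) \<ominus> \<psi>) + 2 * (3 / m z * quad E (F n \<ominus> f))) \<longlonglongrightarrow> 2 * 0 + 2 * (3 / m z * 0)"
      by (intro tendsto_intros \<psi>lim flim)
    then have "L2_inner \<mu> ?d ?d \<le> 2 * 0 + 2 * (3 / m z * 0)"
      by (rule LIMSEQ_le_const) (use le in auto)
    then have "L2_inner \<mu> ?d ?d = 0" using L2.nonneg[OF dL] by simp
    then have "(\<integral>p. (?d p)\<^sup>2 \<partial>\<mu>) = 0" by (simp add: L2_inner_def power2_eq_square)
    moreover have "integrable \<mu> (\<lambda>p. (?d p)\<^sup>2)" using dL by (simp add: L2_def)
    ultimately have "AE p in \<mu>. (?d p)\<^sup>2 = 0" by (subst (asm) integral_nonneg_eq_0_iff_AE) auto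
    then show ?thesis by eventually_elim simp
  qed
  have fD: "f \<in> lifted_dom"
    using form_dom_cong_AE(1)[OF q_quadratic \<psi> fL ae\<psi>] f by (simp add: lifted_dom_def)
  have g: "(F n \<ominus> f) \<in> lifted_dom" for n by (rule L.diff_mem[OF FD fD])
  have le: "quad ?p (F n \<ominus> f) \<le> 1 * (quad E (F n \<ominus> f) + quad ?q1 (\<gamma>2 (F n) \<ominus> \<psi>))" for n
  proof -
    let ?g = "F n \<ominus> f" and ?v = "\<gamma>2 (F n) \<ominus> \<psi>"
    have gN: "?g \<in> N" and gq: "\<gamma>2 ?g \<in> form_dom q" using g[of n] by (auto simp: lifted_dom_def)
    have "AE p in \<mu>. ?v p = \<gamma>2 ?g p" using ae[OF FN[of n] f] ae\<psi> by eventually_elim simp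
    from quad_polar_cong_AE[OF q_quadratic q\<psi> q_L2[OF gq] this]
    have "quad (polar q) (\<gamma>2 ?g) \<le> quad ?q1 ?v" using q1[OF q\<psi>, of n] L2.nonneg[OF q_L2[OF q\<psi>], of n] by simp
    moreover have "quad E (royden0 m b c ?g) \<le> quad E ?g"
      using E_royden[OF gN] nonneg[OF harm_N[OF gN]] by simp
    ultimately show ?thesis unfolding polar_lifted1_royden[OF g] by simp
  qed
  have "(\<lambda>n. quad ?p (F n \<ominus> f)) \<longlonglongrightarrow> 0"
  proof (rule null_sequence_le[OF _ _ le])
    show "(\<lambda>n. quad E (F n \<ominus> f) + quad ?q1 (\<gamma>2 (F n) \<ominus> \<psi>)) \<longlonglongrightarrow> 0"
      using tendsto_add[OF flim \<psi>lim] by simp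
    show "0 \<le> quad ?p (F n \<ominus> f)" for n
      using E_le[OF g] nonneg[OF diff_mem[OF FN f]] by (rule order_trans[rotated])
  qed
  then show "\<exists>f\<in>lifted_dom. (\<lambda>n. quad ?p (F n \<ominus> f)) \<longlonglongrightarrow> 0" using fD by blast
qed

lemma markovian_lifted: "markovian V lifted"
  unfolding markovian_def
proof (intro ballI allI impI)
  fix f :: "'a \<Rightarrow> real" and C :: "real \<Rightarrow> real" assume L: "f \<in> L2 V" and C: "normal_contraction C"
  show "lifted (\<lambda>x. C (f x)) \<le> lifted f"
  proof (cases "f \<in> lifted_dom")
    case True
    then have f: "f \<in> N" and \<phi>: "\<gamma>2 f \<in> form_dom q" by (auto simp: lifted_dom_def)
    note Cf = N_normal_contraction(1)[OF f C]
    have le: "form_diff q q\<^sub>D\<^sub>N (\<lambda>p. C (\<gamma>2 f p)) \<le> form_diff q q\<^sub>D\<^sub>N (\<gamma>2 f)"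
      using q_markov_diff gammaL2_L2[OF f] C by (simp add: markovian_def)
    then have C\<phi>: "(\<lambda>p. C (\<gamma>2 f p)) \<in> form_dom q"
      using diff_value_q[OF \<phi>] by (auto simp: form_diff_def top_unique split: if_splits)
    have ae: "AE p in \<mu>. C (\<gamma>2 f p) = \<gamma>2 (\<lambda>x. C (f x)) p"
      using gammaL2_contraction[OF f C] by eventually_elim simp
    have \<gamma>C: "\<gamma>2 (\<lambda>x. C (f x)) \<in> form_dom q"
      by (rule form_dom_cong_AE(1)[OF q_quadratic C\<phi> gammaL2_L2[OF Cf] ae])
    then have dom: "(\<lambda>x. C (f x)) \<in> lifted_dom" using Cf by (simp add: lifted_dom_def)
    interpret ex: inner_fun_space "form_dom q" excess by (rule inner_excess)
    have "excess (\<lambda>p. C (\<gamma>2 f p)) (\<lambda>p. C (\<gamma>2 f p)) = excess (\<gamma>2 (\<lambda>x. C (f x))) (\<gamma>2 (\<lambda>x. C (f x)))"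
      using excess_cong[OF C\<phi> \<gamma>C C\<phi> ae] excess_cong[OF C\<phi> \<gamma>C \<gamma>C ae] ex.sym[OF C\<phi> \<gamma>C] by simp
    then have "ennreal (excess (\<gamma>2 (\<lambda>x. C (f x))) (\<gamma>2 (\<lambda>x. C (f x)))) \<le> ennreal (excess (\<gamma>2 f) (\<gamma>2 f))"
      using le unfolding diff_value_q[OF \<phi>] diff_value_q[OF C\<phi>] by simp
    moreover have "QN m b c (\<lambda>x. C (f x)) \<le> QN m b c f" using markovian_QN L C by (simp add: markovian_def)
    ultimately show ?thesis unfolding lifted_value[OF True] lifted_value[OF dom] by (intro add_mono)
  qed (simp add: lifted_def)
qed

lemma lifted_DF: "lifted \<in> DF m b c"
proof -
  have "QN m b c f \<le> lifted f" for f by (simp add: lifted_def)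
  moreover have "lifted f \<le> QD m b c f" for f
  proof (cases "f \<in> D0")
    case True
    have dom: "f \<in> lifted_dom" using True lifted_dom_D0 by blast
    then have \<phi>: "\<gamma>2 f \<in> form_dom q" by (simp add: lifted_dom_def)
    interpret ex: inner_fun_space "form_dom q" excess by (rule inner_excess)
    have "excess (\<gamma>2 f) (\<gamma>2 f) = excess (\<lambda>_. 0) (\<gamma>2 f)"
      by (rule excess_cong[OF \<phi> q.zero_mem \<phi> gammaL2_D0[OF True]])
    also have "\<dots> = 0" using ex.scale_left[OF q.zero_mem \<phi>, of 0] by simp
    finally show ?thesis using lifted_value[OF dom] QD_eq_QN[OF True] by simp
  qed (simp add: QD_def)
  moreover have "densely_defined V lifted"
    using densely_defined_if_finsupp[of lifted] finsupp_D0 lifted_dom_D0 by (auto simp: form_dom_lifted)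
  ultimately show ?thesis
    unfolding DF_def dirichlet_form_def dirichlet_form_wide_def form_le_def
    using quadratic_lifted closed_lifted markovian_lifted by simp
qed

text \<open>
  A class \<open>\<phi>\<close> is the trace of \<open>hext \<phi>\<close>, a harmonic function, for which the interior term in
  \<open>polar_lifted1_royden\<close> vanishes.
\<close>

lemma trace_lifted: "Tr lifted = q"
proof
  fix \<phi> show "Tr lifted \<phi> = q \<phi>"
  proof (cases "\<phi> \<in> trace_space")
    case T: True
    note h = hext_N[OF T]
    have ae: "AE p in \<mu>. \<gamma>2 (hext \<phi>) p = \<phi> p" using trace_hext[OF T] by eventually_elim simp
    show ?thesis
    proof (cases "\<phi> \<in> form_dom q")
      case True
      note \<gamma>q = form_dom_cong_AE[OF q_quadratic True gammaL2_L2[OF h] trace_hext[OF T]]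
      have dom: "hext \<phi> \<in> lifted_dom" using h \<gamma>q(1) by (simp add: lifted_dom_def)
      have "royden0 m b c (hext \<phi>) = (\<lambda>_. 0)"
        by (rule royden_unique[OF h D0_zero]) (simp add: harmonic_hext[OF T])
      then have "polar (form1 V lifted) (hext \<phi>) (hext \<phi>) = polar q (\<gamma>2 (hext \<phi>)) (\<gamma>2 (hext \<phi>))"
        using polar_lifted1_royden[OF dom] scale_left[OF zero_mem zero_mem, of 0] by simp
      then have "form1 V lifted (hext \<phi>) = q \<phi>"
        using form1_lifted[OF dom] polar_lifted1[OF dom] q_value[OF \<gamma>q(1)] \<gamma>q(2) by simp
      then show ?thesis using trace_form_eq[OF lifted_DF] T by simp
    next
      case False
      have "hext \<phi> \<notin> lifted_dom"
        using False form_dom_cong_AE(1)[OF q_quadratic _ trace_space_L2[OF T] ae] by (auto simp: lifted_dom_def)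
      then have "form1 V lifted (hext \<phi>) = \<infinity>" by (simp add: form1_def lifted_def)
      then show ?thesis using trace_form_eq[OF lifted_DF] T False by (simp add: form_dom_def less_top[symmetric])
    qed
  next
    case False
    then have "\<phi> \<notin> form_dom q" using dom_trace_space by blast
    then show ?thesis using trace_form_eq[OF lifted_DF] False by (simp add: form_dom_def less_top[symmetric])
  qed
qed

text \<open>
  The representation determines both the domain and the values of \<open>Q\<close>. This gives the implication from
  the representation to membership and the injectivity of the trace map at once.
\<close>

lemma eq_lifted_if_represented:
  assumes sub: "form_dom Q \<subseteq> N" and rep: "represented_by m b c K i \<mu> Q q"
  shows "Q = lifted"
proof
  have dom: "form_dom Q = lifted_dom"
    using sub rep unfolding represented_by_def lifted_dom_def by blast
  fix f show "Q f = lifted f"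
  proof (cases "f \<in> lifted_dom")
    case True
    have f: "f \<in> N" and \<phi>: "\<gamma>2 f \<in> form_dom q" using True by (auto simp: lifted_dom_def)
    have T: "\<gamma>2 f \<in> trace_space" by (rule dom_trace_space[OF \<phi>])
    have "Q f = QN m b c f + q (\<gamma>2 f) - q\<^sub>D\<^sub>N (\<gamma>2 f)"
      using rep True dom unfolding represented_by_def by blast
    also have "\<dots> = QN m b c f + ennreal (excess (\<gamma>2 f) (\<gamma>2 f))"
    proof -
      have p: "0 \<le> polar (QN m b c) f f"
        using inner_fun_space.nonneg[OF quadratic_formD(3)[OF quadratic_form_QN] f] .
      show ?thesis
        using p excess_nonneg[OF \<phi>] q.nonneg[OF \<phi>] nonneg[OF hext_N[OF T]] T
        unfolding quadratic_formD(4)[OF quadratic_form_QN f] q_value[OF \<phi>] qDN_eq excess_def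
        by (simp add: ennreal_plus[symmetric] ennreal_minus del: ennreal_plus)
    qed
    finally show ?thesis by (simp add: lifted_value[OF True])
  next
    case False
    then show ?thesis using dom by (auto simp: lifted_def form_dom_def less_top[symmetric])
  qed
qed

end

section \<open>The boundary representation\<close>

theorem theorem11p1:
  fixes m :: "'a::countable \<Rightarrow> real"
    and b :: "'a \<Rightarrow> 'a \<Rightarrow> real"
    and c :: "'a \<Rightarrow> real"
    and K :: "'b topology"
    and i :: "'a \<Rightarrow> 'b"
    and hm :: "'a \<Rightarrow> 'b measure"
    and z :: 'a
    and \<mu> :: "'b measure"
  assumes "graph m b c"
    and "compactification m b c K i"
    and "\<And>x. harmonic_measure m b c K i x (hm x)"
    and "\<And>x y. bounded_density (hm x) (hm y)"
    and "\<mu> = hm z"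
  shows "(\<forall>Q. quadratic_form (vmeas m) Q \<and> closed_form (vmeas m) Q \<longrightarrow>
            (Q \<in> DF m b c \<longleftrightarrow>
               form_dom Q \<subseteq> form_dom (QN m b c) \<and>
               (\<exists>q \<in> TrDF m b c K i \<mu>. represented_by m b c K i \<mu> Q q))) \<and>
         (\<forall>Q \<in> DF m b c. trace_form m b c K i \<mu> Q \<in> TrDF m b c K i \<mu> \<and>
            represented_by m b c K i \<mu> Q (trace_form m b c K i \<mu> Q)) \<and>
         bij_betw (trace_form m b c K i \<mu>) (DF m b c) (TrDF m b c K i \<mu>)"
proof -
  interpret harmonic_boundary m b c K i hm z
    using assms(1-4) by unfold_locales
  have trace: "trace_form m b c K i \<mu> Q \<in> TrDF m b c K i \<mu>"
      "represented_by m b c K i \<mu> Q (trace_form m b c K i \<mu> Q)" "form_dom Q \<subseteq> form_dom (QN m b c)"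
    if Q: "Q \<in> DF m b c" for Q
  proof -
    interpret Q: graph_form_extension m b c Q by (rule DF_extension[OF Q])
    interpret Q: traced_form m b c K i hm z Q by unfold_locales
    show "trace_form m b c K i \<mu> Q \<in> TrDF m b c K i \<mu>"
      "represented_by m b c K i \<mu> Q (trace_form m b c K i \<mu> Q)" "form_dom Q \<subseteq> form_dom (QN m b c)"
      using Q.trace_TrDF Q.represented_by_trace Q.D_N unfolding assms(5) by blast+
  qed
  have lift: "\<exists>P. P \<in> DF m b c \<and> trace_form m b c K i \<mu> P = q \<and>
      (\<forall>Q. form_dom Q \<subseteq> form_dom (QN m b c) \<and> represented_by m b c K i \<mu> Q q \<longrightarrow> Q = P)"
    if q: "q \<in> TrDF m b c K i \<mu>" for q
  proof -
    interpret q: boundary_form m b c K i hm z q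
      using q unfolding assms(5) by unfold_locales
    show ?thesis
      using q.lifted_DF q.trace_lifted q.eq_lifted_if_represented unfolding assms(5) by blast
  qed
  have "bij_betw (trace_form m b c K i \<mu>) (DF m b c) (TrDF m b c K i \<mu>)"
    unfolding bij_betw_def
  proof
    show "inj_on (trace_form m b c K i \<mu>) (DF m b c)"
    proof (rule inj_onI)
      fix Q Q' assume Q: "Q \<in> DF m b c" "Q' \<in> DF m b c"
        and eq: "trace_form m b c K i \<mu> Q = trace_form m b c K i \<mu> Q'"
      show "Q = Q'" using lift[OF trace(1)[OF Q(1)]] trace(2,3)[OF Q(1)] trace(2,3)[OF Q(2)] eq by metis
    qed
    show "trace_form m b c K i \<mu> ` DF m b c = TrDF m b c K i \<mu>"
      using trace(1) lift by blast
  qed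
  moreover have "Q \<in> DF m b c"
    if "form_dom Q \<subseteq> form_dom (QN m b c)" "q \<in> TrDF m b c K i \<mu>" "represented_by m b c K i \<mu> Q q" for Q q
    using lift[OF that(2)] that(1,3) by blast
  ultimately show ?thesis using trace by blast
qed

end
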